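(* Let $f_0:\mathbb{C}\to\hat{\mathbb{C}}$ be a transcendental meromorphic function of finite order $\rho>0$ such that: (1) $\infty$ is not an asymptotic value of $f_0$; (2) there exist $R^*>0$ and a co-finite subset $\mathcal{P}^*$ of the set $\mathcal{P}$ of poles of $f_0$ (i.e. $\mathcal{P}\setminus\mathcal{P}^*$ finite) such that $\mathrm{dist}(\mathrm{Sing}(f_0^{-1}),a)>R^*$ for all $a\in\mathcal{P}^*$; (3) there exists $R^\dagger>0$ such that $B(a_1,R^\dagger)\cap B(a_2,R^\dagger)=\emptyset$ for distinct poles $a_1,a_2\in\mathcal{P}$; (4) there exist $M\in\mathbb{N}$ and $\beta\geq0$ such that for each $a\in\mathcal{P}^*$ we have $1\leq m(a)\leq M$ and $$|f_0(z)|\asymp\frac{|a|^{-\beta}}{|z-a|^{m(a)}},\qquad |f_0'(z)|\asymp\frac{m(a)|a|^{-\beta}}{|z-a|^{m(a)+1}}\quad\text{for }z\in B(a,R^\dagger).$$ Then there is $\varepsilon>0$ such that if $(c_n)$ is a sequence in $\mathbb{C}$ with $|c_n|<\varepsilon$ for all $n$, then $$\frac{\rho M^*}{\beta+M^*+1}\leq \mathrm{HD}(I_\infty(F_+))\leq \mathrm{ED}(F_+)\leq\frac{\rho M}{\beta+M+1}\quad\text{and}\quad \frac{\rho M^*}{\beta+M^*+1}\leq \mathrm{EHD}(F_+)\leq \mathrm{ED}(F_+).$$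
   Context: $m(a)$ is the multiplicity of the pole $a$; $\mathrm{Sing}(f^{-1})$ is the set of finite critical and asymptotic values. $A\asymp B$ means there is a constant $C\geq1$, independent of $a$ and $z$, with $C^{-1}A\leq B\leq CA$. $M^*$ is the largest integer $1\leq M^*\leq M$ such that $\sum_{a\in\mathcal{P},\,m(a)=M^*}|a|^{-t}$ converges for $t>\rho$ and diverges for $t<\rho$. Given $(c_n)$, $f_n(z)=f_0(z)+c_n$ and $F_+^n=f_n\circ\dots\circ f_1$. For a sequence of compositions $F^n$: the Fatou set is the set of $z\in\mathbb{C}$ having a neighborhood on which all $F^n$ are defined and normal, $\mathcal{J}(F)$ its complement; $I_\infty(F)=\{z\in\mathcal{J}(F):F^n(z)\to\infty\}$; the radial Julia set $\mathcal{J}_r(F)$ is the set of $z\in\mathcal{J}(F)$ with all $F^n(z)$ defined and some $\delta>0$ such that for infinitely many $n$ the disk $B(F^n(z),\delta)$ pulls back univalently along the orbit of $z$; $\mathrm{ED}(F)=\lim_{R\to\infty}\mathrm{HD}\{z\in\mathcal{J}(F):|F^n(z)|>R\ \forall n\geq1\}$ and $\mathrm{EHD}(F)=\lim_{R\to\infty}\mathrm{HD}\{z\in\mathcal{J}_r(F):|F^n(z)|>R\ \forall n\geq1\}$. HD is Hausdorff dimension. *)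

theory Defs
  imports "HOL-Complex_Analysis.Complex_Analysis" "HOL-Computational_Algebra.Polynomial"
begin

text \<open>A meromorphic function f on C with values in the Riemann sphere is represented by a
function complex => complex; its value at a pole is irrelevant (it stands for infinity).\<close>

definition poles :: "(complex \<Rightarrow> complex) \<Rightarrow> complex set" where
  "poles f = {z. is_pole f z}"

definition entire_meromorphic :: "(complex \<Rightarrow> complex) \<Rightarrow> bool" where
  "entire_meromorphic f \<longleftrightarrow> f meromorphic_on UNIV \<and> f holomorphic_on (- poles f)"

definition pole_mult :: "(complex \<Rightarrow> complex) \<Rightarrow> complex \<Rightarrow> nat" where
  "pole_mult f a = nat (- zorder f a)"

definition rational_fun :: "(complex \<Rightarrow> complex) \<Rightarrow> bool" where
  "rational_fun f \<longleftrightarrow> (\<exists>p q :: complex poly. q \<noteq> 0 \<and>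
      (\<forall>z. poly q z \<noteq> 0 \<longrightarrow> f z = poly p z / poly q z))"

definition transcendental_mero :: "(complex \<Rightarrow> complex) \<Rightarrow> bool" where
  "transcendental_mero f \<longleftrightarrow> entire_meromorphic f \<and> \<not> rational_fun f"

definition log_plus :: "real \<Rightarrow> real" where
  "log_plus x = max 0 (ln x)"

definition nev_m :: "(complex \<Rightarrow> complex) \<Rightarrow> real \<Rightarrow> real" where
  "nev_m f r = (1 / (2 * pi)) * integral {0..2*pi} (\<lambda>\<theta>. log_plus (norm (f (of_real r * cis \<theta>))))"

definition nev_n :: "(complex \<Rightarrow> complex) \<Rightarrow> real \<Rightarrow> real" where
  "nev_n f t = (\<Sum>a\<in>poles f \<inter> cball 0 t. real (pole_mult f a))"

definition nev_N :: "(complex \<Rightarrow> complex) \<Rightarrow> real \<Rightarrow> real" where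
  "nev_N f r = integral {0..r} (\<lambda>t. (nev_n f t - nev_n f 0) / t) + nev_n f 0 * ln r"

definition nev_T :: "(complex \<Rightarrow> complex) \<Rightarrow> real \<Rightarrow> real" where
  "nev_T f r = nev_m f r + nev_N f r"

definition mero_order :: "(complex \<Rightarrow> complex) \<Rightarrow> ereal" where
  "mero_order f = Limsup at_top (\<lambda>r. ereal (ln (nev_T f r) / ln r))"

definition asymptotic_value :: "(complex \<Rightarrow> complex) \<Rightarrow> complex \<Rightarrow> bool" where
  "asymptotic_value f w \<longleftrightarrow> (\<exists>\<gamma> :: real \<Rightarrow> complex. continuous_on {0..} \<gamma> \<and>
      (\<forall>t\<ge>0. \<gamma> t \<notin> poles f) \<and> filterlim \<gamma> at_infinity at_top \<and>
      ((\<lambda>t. f (\<gamma> t)) \<longlongrightarrow> w) at_top)"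

definition infinity_asymptotic_value :: "(complex \<Rightarrow> complex) \<Rightarrow> bool" where
  "infinity_asymptotic_value f \<longleftrightarrow> (\<exists>\<gamma> :: real \<Rightarrow> complex. continuous_on {0..} \<gamma> \<and>
      (\<forall>t\<ge>0. \<gamma> t \<notin> poles f) \<and> filterlim \<gamma> at_infinity at_top \<and>
      filterlim (\<lambda>t. f (\<gamma> t)) at_infinity at_top)"

definition critical_values :: "(complex \<Rightarrow> complex) \<Rightarrow> complex set" where
  "critical_values f = {f c | c. c \<notin> poles f \<and> deriv f c = 0}"

definition sing_values :: "(complex \<Rightarrow> complex) \<Rightarrow> complex set" where
  "sing_values f = critical_values f \<union> {w. asymptotic_value f w}"

definition Mstar_prop :: "(complex \<Rightarrow> complex) \<Rightarrow> real \<Rightarrow> nat \<Rightarrow> nat \<Rightarrow> bool" where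
  "Mstar_prop f \<rho> M k \<longleftrightarrow> 1 \<le> k \<and> k \<le> M \<and>
     (\<forall>t>\<rho>. (\<lambda>a. norm a powr (-t)) summable_on {a\<in>poles f. pole_mult f a = k}) \<and>
     (\<forall>t<\<rho>. \<not> (\<lambda>a. norm a powr (-t)) summable_on {a\<in>poles f. pole_mult f a = k})"

definition is_Mstar :: "(complex \<Rightarrow> complex) \<Rightarrow> real \<Rightarrow> nat \<Rightarrow> nat \<Rightarrow> bool" where
  "is_Mstar f \<rho> M k \<longleftrightarrow> Mstar_prop f \<rho> M k \<and> (\<forall>j. Mstar_prop f \<rho> M j \<longrightarrow> j \<le> k)"

definition hausdorff_pre :: "real \<Rightarrow> real \<Rightarrow> complex set \<Rightarrow> ennreal" where
  "hausdorff_pre s \<delta> S = (INF U \<in> {U :: nat \<Rightarrow> complex set. S \<subseteq> (\<Union>i. U i) \<and>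
       (\<forall>i. bounded (U i) \<and> diameter (U i) \<le> \<delta>)}. (\<Sum>i. ennreal (diameter (U i) powr s)))"

definition hausdorff_measure :: "real \<Rightarrow> complex set \<Rightarrow> ennreal" where
  "hausdorff_measure s S = (SUP \<delta> \<in> {0<..}. hausdorff_pre s \<delta> S)"

definition hausdorff_dim :: "complex set \<Rightarrow> real" where
  "hausdorff_dim S = Inf {s. 0 \<le> s \<and> hausdorff_measure s S = 0}"

primrec Fcomp :: "(complex \<Rightarrow> complex) \<Rightarrow> (nat \<Rightarrow> complex) \<Rightarrow> nat \<Rightarrow> complex \<Rightarrow> complex" where
  "Fcomp f c 0 = (\<lambda>z. z)"
| "Fcomp f c (Suc n) = (\<lambda>z. f (Fcomp f c n z) + c (Suc n))"

definition orbit_defined :: "(complex \<Rightarrow> complex) \<Rightarrow> (nat \<Rightarrow> complex) \<Rightarrow> nat \<Rightarrow> complex \<Rightarrow> bool" where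
  "orbit_defined f c n z \<longleftrightarrow> (\<forall>k<n. Fcomp f c k z \<notin> poles f)"

text \<open>Normality (w.r.t. the spherical metric) of a sequence of holomorphic maps on a domain U:
every subsequence has a further subsequence converging locally uniformly to a function or to infinity.\<close>
definition normal_seq_on :: "complex set \<Rightarrow> (nat \<Rightarrow> complex \<Rightarrow> complex) \<Rightarrow> bool" where
  "normal_seq_on U g \<longleftrightarrow> (\<forall>r :: nat \<Rightarrow> nat. strict_mono r \<longrightarrow> (\<exists>s :: nat \<Rightarrow> nat. strict_mono s \<and>
     ((\<exists>h. \<forall>K. compact K \<and> K \<subseteq> U \<longrightarrow> uniform_limit K (\<lambda>n. g (r (s n))) h sequentially) \<or>
      (\<forall>K. compact K \<and> K \<subseteq> U \<longrightarrow>
         (\<forall>B. eventually (\<lambda>n. \<forall>z\<in>K. B < norm (g (r (s n)) z)) sequentially)))))"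

definition fatou_set :: "(complex \<Rightarrow> complex) \<Rightarrow> (nat \<Rightarrow> complex) \<Rightarrow> complex set" where
  "fatou_set f c = {z. \<exists>U. open U \<and> connected U \<and> z \<in> U \<and>
      (\<forall>n. \<forall>w\<in>U. orbit_defined f c n w) \<and> normal_seq_on U (Fcomp f c)}"

definition julia_set :: "(complex \<Rightarrow> complex) \<Rightarrow> (nat \<Rightarrow> complex) \<Rightarrow> complex set" where
  "julia_set f c = - fatou_set f c"

definition escaping_julia :: "(complex \<Rightarrow> complex) \<Rightarrow> (nat \<Rightarrow> complex) \<Rightarrow> complex set" where
  "escaping_julia f c = {z \<in> julia_set f c. (\<forall>n. orbit_defined f c n z) \<and>
      filterlim (\<lambda>n. Fcomp f c n z) at_infinity sequentially}"

definition univalent_pullback :: "(complex \<Rightarrow> complex) \<Rightarrow> (nat \<Rightarrow> complex) \<Rightarrow> nat \<Rightarrow> complex \<Rightarrow> real \<Rightarrow> bool" where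
  "univalent_pullback f c n z \<delta> \<longleftrightarrow>
     (let B = ball (Fcomp f c n z) \<delta>;
          V = connected_component_set {w. orbit_defined f c n w \<and> Fcomp f c n w \<in> B} z
      in inj_on (Fcomp f c n) V \<and> Fcomp f c n ` V = B)"

definition radial_julia :: "(complex \<Rightarrow> complex) \<Rightarrow> (nat \<Rightarrow> complex) \<Rightarrow> complex set" where
  "radial_julia f c = {z \<in> julia_set f c. (\<forall>n. orbit_defined f c n z) \<and>
      (\<exists>\<delta>>0. infinite {n. univalent_pullback f c n z \<delta>})}"

definition escaping_dim :: "(complex \<Rightarrow> complex) \<Rightarrow> (nat \<Rightarrow> complex) \<Rightarrow> real" where
  "escaping_dim f c = Lim at_top (\<lambda>R. hausdorff_dim
      {z \<in> julia_set f c. \<forall>n\<ge>1. orbit_defined f c n z \<and> R < norm (Fcomp f c n z)})"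

definition eventual_hyp_dim :: "(complex \<Rightarrow> complex) \<Rightarrow> (nat \<Rightarrow> complex) \<Rightarrow> real" where
  "eventual_hyp_dim f c = Lim at_top (\<lambda>R. hausdorff_dim
      {z \<in> radial_julia f c. \<forall>n\<ge>1. R < norm (Fcomp f c n z)})"

end

theory Submission
  imports Defs "HOL-Probability.Probability"
begin

text \<open>
  Since infinity is not an asymptotic value, Iversen's argument shows that large values of \<open>f0\<close> are taken only
  close to poles. Near a pole \<open>a\<close> of multiplicity \<open>m\<close> the function is \<open>\<psi>\<^sup>-\<^sup>m\<close> for a chart \<open>\<psi>\<close> that is
  bi-Lipschitz up to the factor \<open>|a| powr (\<beta> / m)\<close>, so every inverse branch with values near \<open>a\<close>
  contracts near \<open>w\<close> by about \<open>|a| powr (- \<beta> / m) * |w| powr (- 1 - 1 / m)\<close>.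

  Along an orbit that stays close to large poles each pole \<open>b\<close> therefore contributes at most
  \<open>|b| powr (- (\<beta> + M + 1) / M)\<close> to the diameters of the natural covers. The order \<open>\<rho>\<close> makes
  \<open>\<Sum>b. |b| powr (- t)\<close> converge for \<open>t > \<rho>\<close>, which gives the upper bound. For the lower bound, the poles of
  multiplicity \<open>M\<^sup>*\<close> in suitable annuli \<open>W \<le> |a| < 2 W\<close> serve as alphabets of a Cantor set of escaping points;
  the radii \<open>W\<close> grow so slowly along the itinerary that the mass distribution principle applies with the
  separation of cylinders alone.

  An orbit staying near large poles is automatically in the radial Julia set: the inverse branches along it
  contract balls of a fixed radius, and these balls contain poles.
\<close>

section \<open>Hausdorff content\<close>

text \<open>All inequalities come from one chain: lower bound, HD of the escaping set, HD of
  \<open>large_orbits f R c\<close>, HD of the sets behind \<open>eventual_hyp_dim\<close>, HD of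
  the sets behind \<open>escaping_dim\<close>, upper bound. Only the two ends need estimates. The
  obstacle is that the system is non-autonomous: the tail of an orbit belongs to a shifted sequence,
  and an escaping orbit becomes large only after some time. So the estimates hold with the same
  constants for every small \<open>c\<close>, and nullity is carried from \<open>c\<close> to its
  shifts by forward images, and back to the starting points by preimages under maps with countably
  many critical points. The critical exponents arise by collecting powers of one pole
  \<open>b\<close> of multiplicity \<open>m\<close> along an orbit: arriving near \<open>b\<close>
  contributes \<open>1 + 1 / m\<close>, leaving it contributes \<open>\<beta> / m\<close>. With
  exponent \<open>s\<close> the total \<open>s * (1 + 1 / m + \<beta> / m)\<close> equals
  \<open>\<rho>\<close> exactly for \<open>s = \<rho> * m / (\<beta> + m + 1)\<close>. Above,
  \<open>m\<close> is replaced by \<open>M\<close>, the weakest contraction; below, a single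
  multiplicity is used.\<close>

text \<open>This is \<open>hausdorff_pre\<close> without the bound on the diameters. For positive
  exponents it has the same null sets as \<open>hausdorff_measure\<close>, which is all that a
  dimension needs, and it is finite on bounded sets.\<close>

definition hausdorff_content :: "real \<Rightarrow> complex set \<Rightarrow> ennreal" where
  "hausdorff_content s S = (INF U \<in> {U :: nat \<Rightarrow> complex set. S \<subseteq> (\<Union>i. U i) \<and>
       (\<forall>i. bounded (U i))}. (\<Sum>i. ennreal (diameter (U i) powr s)))"

lemma hausdorff_content_le_cover:
  assumes "S \<subseteq> (\<Union>i. U i)" "\<And>i. bounded (U i)"
  shows "hausdorff_content s S \<le> (\<Sum>i. ennreal (diameter (U i) powr s))"
  unfolding hausdorff_content_def by (rule INF_lower) (use assms in auto)

lemma hausdorff_content_less_cover: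
  assumes "hausdorff_content s S < e"
  shows "\<exists>U. S \<subseteq> (\<Union>i. U i) \<and> (\<forall>i. bounded (U i)) \<and>
    (\<Sum>i. ennreal (diameter (U i :: complex set) powr s)) < e"
  using assms unfolding hausdorff_content_def INF_less_iff by auto

lemma hausdorff_content_mono: "S \<subseteq> T \<Longrightarrow> hausdorff_content s S \<le> hausdorff_content s T"
  unfolding hausdorff_content_def by (rule INF_superset_mono) auto

lemma hausdorff_content_zero_subset:
  "hausdorff_content s T = 0 \<Longrightarrow> S \<subseteq> T \<Longrightarrow> hausdorff_content s S = 0"
  using hausdorff_content_mono[of S T s] by auto

lemma hausdorff_content_le_diameter:
  assumes "bounded T" "S \<subseteq> T"
  shows "hausdorff_content s S \<le> ennreal (diameter T powr s)"
proof -
  let ?U = "\<lambda>i::nat. if i = 0 then T else {}"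
  have "hausdorff_content s S \<le> (\<Sum>i. ennreal (diameter (?U i) powr s))"
    by (rule hausdorff_content_le_cover) (use assms in auto)
  also have "\<dots> = (\<Sum>i\<in>{0}. ennreal (diameter (?U i) powr s))"
    by (rule suminf_finite) auto
  finally show ?thesis by simp
qed

lemma hausdorff_content_UN_nat:
  "hausdorff_content s (\<Union>n::nat. S n) \<le> (\<Sum>n. hausdorff_content s (S n))"
proof (rule ennreal_le_epsilon)
  fix e :: real
  assume fin: "(\<Sum>n. hausdorff_content s (S n)) < top" and e: "0 < e"
  define d where "d n = ennreal (e * (1 / 2) ^ Suc n)" for n
  have "\<exists>U. S n \<subseteq> (\<Union>i. U i) \<and> (\<forall>i. bounded (U i)) \<and>
      (\<Sum>i. ennreal (diameter (U i :: complex set) powr s)) \<le> hausdorff_content s (S n) + d n" for n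
  proof -
    have "hausdorff_content s (S n) \<noteq> top"
      using fin ennreal_suminf_lessD less_top by blast
    moreover have "0 < d n"
      using e by (simp add: d_def)
    ultimately have "hausdorff_content s (S n) < hausdorff_content s (S n) + d n"
      using ennreal_add_left_cancel_less[of "hausdorff_content s (S n)" 0 "d n"] by simp
    then obtain U where "S n \<subseteq> (\<Union>i. U i)" "\<And>i. bounded (U i)"
      "(\<Sum>i. ennreal (diameter (U i) powr s)) < hausdorff_content s (S n) + d n"
      using hausdorff_content_less_cover by blast
    then show ?thesis by (intro exI[of _ U]) auto
  qed
  then obtain U where U: "\<And>n. S n \<subseteq> (\<Union>i. U n i)" "\<And>n i. bounded (U n i)"
    "\<And>n. (\<Sum>i. ennreal (diameter (U n i :: complex set) powr s)) \<le> hausdorff_content s (S n) + d n"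
    by metis
  have "hausdorff_content s (\<Union>n. S n) \<le> (\<Sum>k. ennreal (diameter (case_prod U (prod_decode k)) powr s))"
  proof (rule hausdorff_content_le_cover)
    show "(\<Union>n. S n) \<subseteq> (\<Union>k. case_prod U (prod_decode k))"
    proof
      fix x assume "x \<in> (\<Union>n. S n)"
      then obtain n i where "x \<in> U n i" using U(1) by blast
      then show "x \<in> (\<Union>k. case_prod U (prod_decode k))"
        by (intro UN_I[of "prod_encode (n, i)"]) auto
    qed
    show "bounded (case_prod U (prod_decode k))" for k
      using U(2) by (simp split: prod.split)
  qed
  also have "\<dots> = (\<Sum>n. \<Sum>i. ennreal (diameter (U n i) powr s))"
    by (rule suminf_ennreal_2dimen[where f = "\<lambda>p. ennreal (diameter (case_prod U p) powr s)"]) auto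
  also have "\<dots> \<le> (\<Sum>n. hausdorff_content s (S n) + d n)"
    by (intro suminf_le U(3)) auto
  also have "\<dots> = (\<Sum>n. hausdorff_content s (S n)) + (\<Sum>n. d n)"
    by (rule suminf_add[symmetric]) auto
  also have "(\<Sum>n. d n) = ennreal e"
    unfolding d_def using sums_mult[OF power_half_series, of e] e
    by (intro suminf_ennreal_eq) auto
  finally show "hausdorff_content s (\<Union>n. S n) \<le> (\<Sum>n. hausdorff_content s (S n)) + ennreal e" .
qed

text \<open>Subadditivity in the form used for sums over poles and over inverse branches: a common
  bound for the finite partial sums suffices, so no infinite sum over the index set has to be
  formed.\<close>

lemma hausdorff_content_UN_countable:
  assumes I: "countable I" and le: "\<And>i. i \<in> I \<Longrightarrow> hausdorff_content s (S i) \<le> ennreal (e i)"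
    and e: "\<And>i. i \<in> I \<Longrightarrow> 0 \<le> e i" and B: "\<And>F. finite F \<Longrightarrow> F \<subseteq> I \<Longrightarrow> sum e F \<le> B"
  shows "hausdorff_content s (\<Union>i\<in>I. S i) \<le> ennreal B"
proof -
  define N where "N = to_nat_on I ` I"
  define T where "T n = (if n \<in> N then S (from_nat_into I n) else {})" for n
  define d where "d n = (if n \<in> N then e (from_nat_into I n) else 0)" for n
  have inI: "from_nat_into I n \<in> I" if "n \<in> N" for n
    using that I by (auto simp: N_def)
  have inj: "inj_on (from_nat_into I) N"
    using I by (auto simp: N_def inj_on_def)
  have "(\<Union>i\<in>I. S i) \<subseteq> (\<Union>n. T n)"
  proof
    fix x assume "x \<in> (\<Union>i\<in>I. S i)"
    then obtain i where "i \<in> I" "x \<in> S i" by auto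
    then show "x \<in> (\<Union>n. T n)"
      using I by (intro UN_I[of "to_nat_on I i"]) (auto simp: T_def N_def)
  qed
  then have "hausdorff_content s (\<Union>i\<in>I. S i) \<le> hausdorff_content s (\<Union>n. T n)"
    by (rule hausdorff_content_mono)
  also have "\<dots> \<le> (\<Sum>n. hausdorff_content s (T n))"
    by (rule hausdorff_content_UN_nat)
  also have "\<dots> \<le> (\<Sum>n. ennreal (d n))"
  proof (intro suminf_le allI)
    fix n
    have "hausdorff_content s {} = 0"
      using hausdorff_content_le_diameter[of "{}" "{}" s] by simp
    then show "hausdorff_content s (T n) \<le> ennreal (d n)"
      using le[OF inI] by (auto simp: T_def d_def)
  qed auto
  also have "\<dots> \<le> ennreal B"
  proof (rule suminf_le_const)
    fix n
    have "(\<Sum>k<n. ennreal (d k)) = ennreal (\<Sum>k<n. d k)"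
      using e inI by (intro sum_ennreal) (auto simp: d_def)
    also have "(\<Sum>k<n. d k) = (\<Sum>k\<in>{..<n} \<inter> N. e (from_nat_into I k))"
      by (simp add: d_def sum.If_cases)
    also have "\<dots> = sum e (from_nat_into I ` ({..<n} \<inter> N))"
      using inj by (subst sum.reindex) (auto intro: inj_on_subset)
    also have "ennreal \<dots> \<le> ennreal B"
      using inI by (intro ennreal_leI B) auto
    finally show "(\<Sum>k<n. ennreal (d k)) \<le> ennreal B" .
  qed auto
  finally show ?thesis .
qed

lemma hausdorff_content_zero_UN:
  assumes "countable I" "\<And>i. i \<in> I \<Longrightarrow> hausdorff_content s (S i) = 0"
  shows "hausdorff_content s (\<Union>i\<in>I. S i) = 0"
  using hausdorff_content_UN_countable[of I s S "\<lambda>_. 0" 0] assms by auto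

lemma hausdorff_content_lipschitz_image:
  assumes s: "0 < s" and L: "0 < L"
    and lip: "\<And>x y. x \<in> T \<Longrightarrow> y \<in> T \<Longrightarrow> dist (g x) (g y) \<le> L * dist x y"
  shows "hausdorff_content s (g ` T) \<le> ennreal (L powr s) * hausdorff_content s T"
proof -
  have *: "hausdorff_content s (g ` T) \<le> ennreal (L powr s) * e"
    if less: "hausdorff_content s T < e" for e
  proof -
    obtain U where U: "T \<subseteq> (\<Union>i. U i)" "\<And>i. bounded (U i)"
      "(\<Sum>i. ennreal (diameter (U i) powr s)) < e"
      using hausdorff_content_less_cover[OF less] by blast
    have dg: "dist (g x) (g y) \<le> L * diameter (U i)" if "x \<in> U i \<inter> T" "y \<in> U i \<inter> T" for x y i
    proof -
      have "dist (g x) (g y) \<le> L * dist x y" using lip that by auto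
      also have "\<dots> \<le> L * diameter (U i)"
        using that U(2) L by (intro mult_left_mono diameter_bounded_bound) auto
      finally show ?thesis .
    qed
    have bd: "bounded (g ` (U i \<inter> T))" for i
      using dg unfolding bounded_two_points by (intro exI[of _ "L * diameter (U i)"]) blast
    have di: "diameter (g ` (U i \<inter> T)) \<le> L * diameter (U i)" for i
    proof (rule diameter_le)
      show "g ` (U i \<inter> T) \<noteq> {} \<or> 0 \<le> L * diameter (U i)"
        using L diameter_ge_0[OF U(2)] by simp
    qed (use dg in \<open>auto simp: dist_norm\<close>)
    have "hausdorff_content s (g ` T) \<le> (\<Sum>i. ennreal (diameter (g ` (U i \<inter> T)) powr s))"
    proof (rule hausdorff_content_le_cover)
      show "g ` T \<subseteq> (\<Union>i. g ` (U i \<inter> T))" using U(1) by blast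
    qed (rule bd)
    also have "\<dots> \<le> (\<Sum>i. ennreal (L powr s) * ennreal (diameter (U i) powr s))"
    proof (intro suminf_le allI)
      fix i
      have "diameter (g ` (U i \<inter> T)) powr s \<le> (L * diameter (U i)) powr s"
        using di s bd by (intro powr_mono2) (auto simp: diameter_ge_0)
      also have "\<dots> = L powr s * diameter (U i) powr s"
        using L diameter_ge_0[OF U(2)] by (simp add: powr_mult)
      finally show "ennreal (diameter (g ` (U i \<inter> T)) powr s)
          \<le> ennreal (L powr s) * ennreal (diameter (U i) powr s)"
        by (simp add: ennreal_mult[symmetric] ennreal_leI)
    qed auto
    also have "\<dots> = ennreal (L powr s) * (\<Sum>i. ennreal (diameter (U i) powr s))"
      by (rule ennreal_suminf_cmult)
    also have "\<dots> \<le> ennreal (L powr s) * e"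
      using U(3) by (intro mult_left_mono) auto
    finally show ?thesis .
  qed
  show ?thesis
  proof (cases "hausdorff_content s T = top")
    case True
    then show ?thesis using L by (simp add: ennreal_mult_top)
  next
    case False
    show ?thesis
    proof (rule ennreal_le_epsilon)
      fix e :: real assume e: "0 < e"
      let ?d = "e / L powr s"
      have "0 < ?d" using e L by simp
      then have "hausdorff_content s T < hausdorff_content s T + ennreal ?d"
        using False ennreal_add_left_cancel_less[of "hausdorff_content s T" 0 "ennreal ?d"]
        by simp
      from *[OF this] have "hausdorff_content s (g ` T)
          \<le> ennreal (L powr s) * hausdorff_content s T + ennreal (L powr s) * ennreal ?d"
        by (simp add: distrib_left)
      also have "ennreal (L powr s) * ennreal ?d = ennreal e"
        using e L by (simp add: ennreal_mult[symmetric])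
      finally show "hausdorff_content s (g ` T)
          \<le> ennreal (L powr s) * hausdorff_content s T + ennreal e" .
    qed
  qed
qed

lemma hausdorff_content_zero_lipschitz_image:
  assumes "0 < s" "hausdorff_content s T = 0"
    and lip: "\<And>x y. x \<in> T \<Longrightarrow> y \<in> T \<Longrightarrow> dist (g x) (g y) \<le> L * dist x y"
  shows "hausdorff_content s (g ` T) = 0"
proof -
  have "dist (g x) (g y) \<le> max 1 L * dist x y" if "x \<in> T" "y \<in> T" for x y
    using lip[OF that] mult_right_mono[of L "max 1 L" "dist x y"] by auto
  then show ?thesis
    using hausdorff_content_lipschitz_image[of s "max 1 L" T g] assms by auto
qed

text \<open>A cover whose sum is below \<open>d powr s\<close> has all diameters below
  \<open>d\<close>, so efficient covers are automatically fine.\<close>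

lemma hausdorff_measure_zero_iff:
  assumes s: "0 < s"
  shows "hausdorff_measure s S = 0 \<longleftrightarrow> hausdorff_content s S = 0"
proof
  assume "hausdorff_measure s S = 0"
  then have "hausdorff_pre s 1 S = 0"
    unfolding hausdorff_measure_def by (simp add: SUP_eq_iff bot_ennreal[symmetric])
  moreover have "hausdorff_content s S \<le> hausdorff_pre s 1 S"
    unfolding hausdorff_content_def hausdorff_pre_def by (rule INF_superset_mono) auto
  ultimately show "hausdorff_content s S = 0" by simp
next
  assume 0: "hausdorff_content s S = 0"
  have "hausdorff_pre s d S \<le> ennreal e" if d: "0 < d" and e: "0 < e" for d e
  proof -
    have "hausdorff_content s S < ennreal (min e (d powr s))"
      using 0 d e by simp
    then obtain U where U: "S \<subseteq> (\<Union>i. U i)" "\<And>i. bounded (U i)"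
      "(\<Sum>i. ennreal (diameter (U i) powr s)) < ennreal (min e (d powr s))"
      using hausdorff_content_less_cover by blast
    have "diameter (U i) \<le> d" for i
    proof -
      have "diameter (U i) powr s < d powr s"
        using ennreal_suminf_lessD[OF U(3), of i] by (simp add: ennreal_less_iff)
      then show ?thesis
        using s d powr_mono2[of s d "diameter (U i)"] by linarith
    qed
    then have "hausdorff_pre s d S \<le> (\<Sum>i. ennreal (diameter (U i) powr s))"
      unfolding hausdorff_pre_def using U by (intro INF_lower) auto
    also have "\<dots> \<le> ennreal e"
      using less_imp_le[OF U(3)] by (rule order_trans) (simp add: ennreal_leI)
    finally show ?thesis .
  qed
  then have "hausdorff_pre s d S = 0" if "0 < d" for d
    using that ennreal_le_epsilon[of 0 "hausdorff_pre s d S"] by auto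
  then show "hausdorff_measure s S = 0"
    unfolding hausdorff_measure_def by (auto simp: SUP_eq_iff bot_ennreal)
qed

section \<open>Hausdorff dimension through null contents\<close>

lemma bdd_below_null_exponents: "bdd_below {s. 0 \<le> s \<and> hausdorff_measure s S = 0}"
  by (rule bdd_belowI[of _ 0]) auto

lemma hausdorff_measure_mono_exponent:
  assumes s: "0 \<le> s" "s \<le> t" and 0: "hausdorff_measure s S = 0"
  shows "hausdorff_measure t S = 0"
proof -
  have pre: "hausdorff_pre s d S = 0" if "0 < d" for d
    using 0 that unfolding hausdorff_measure_def by (simp add: SUP_eq_iff bot_ennreal[symmetric])
  \<comment> \<open>The mesh \<open>min d 1\<close> keeps all diameters at most 1, where raising the
    exponent decreases each term.\<close>
  have small: "hausdorff_pre t d S \<le> hausdorff_pre s (min d 1) S" if "0 < d" for d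
    unfolding hausdorff_pre_def
  proof (rule INF_mono)
    fix U assume U: "U \<in> {U :: nat \<Rightarrow> complex set. S \<subseteq> (\<Union>i. U i) \<and>
       (\<forall>i. bounded (U i) \<and> diameter (U i) \<le> min d 1)}"
    have "diameter (U i) powr t \<le> diameter (U i) powr s" for i
      using U s diameter_ge_0[of "U i"] by (cases "diameter (U i) = 0") (auto intro!: powr_mono')
    then show "\<exists>V\<in>{U. S \<subseteq> (\<Union>i. U i) \<and> (\<forall>i. bounded (U i) \<and> diameter (U i) \<le> d)}.
       (\<Sum>i. ennreal (diameter (V i) powr t)) \<le> (\<Sum>i. ennreal (diameter (U i) powr s))"
      using U by (intro bexI[of _ U] suminf_le) (auto intro: ennreal_leI)
  qed
  have "hausdorff_pre t d S = 0" if "0 < d" for d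
    using small[OF that] pre[of "min d 1"] that by simp
  then show ?thesis
    unfolding hausdorff_measure_def by (auto simp: SUP_eq_iff bot_ennreal)
qed

text \<open>Needed so that the infimum in \<open>hausdorff_dim\<close> runs over a nonempty set. The
  unit square is the union of four copies of itself scaled by 1/2, so its finite content
  \<open>q\<close> satisfies \<open>q \<le> 4 * (q / 8)\<close> and vanishes; integer translates of
  the square cover the plane.\<close>

lemma hausdorff_measure_3_zero: "hausdorff_measure 3 S = 0"
proof -
  define Q where "Q = {z. 0 \<le> Re z \<and> Re z \<le> 1 \<and> 0 \<le> Im z \<and> Im z \<le> 1}"
  define g where "g v z = (v + z) / 2" for v z :: complex
  have bQ: "bounded Q"
    unfolding Q_def bounded_iff
  proof (intro exI[of _ 2] ballI)
    fix z assume "z \<in> {z. 0 \<le> Re z \<and> Re z \<le> 1 \<and> 0 \<le> Im z \<and> Im z \<le> 1}"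
    then show "norm z \<le> 2" using cmod_le[of z] by auto
  qed
  have half: "hausdorff_content 3 (g v ` Q) \<le> ennreal (1 / 8) * hausdorff_content 3 Q" for v
  proof -
    have "dist (g v x) (g v y) \<le> 1 / 2 * dist x y" for x y
      by (simp add: g_def dist_norm diff_divide_distrib[symmetric] norm_divide)
    from hausdorff_content_lipschitz_image[of 3 "1/2" Q "g v", OF _ _ this]
    show ?thesis by (simp add: powr_numeral power3_eq_cube)
  qed
  obtain q where q: "hausdorff_content 3 Q = ennreal q" "0 \<le> q"
    using hausdorff_content_le_diameter[OF bQ order_refl, of 3]
    by (cases "hausdorff_content 3 Q" rule: ennreal_cases) (auto simp: top_unique)
  have cov: "Q \<subseteq> (\<Union>v\<in>{0, 1, \<i>, 1 + \<i>}. g v ` Q)"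
  proof
    fix z assume z: "z \<in> Q"
    define v where "v = Complex (if Re z \<le> 1/2 then 0 else 1) (if Im z \<le> 1/2 then 0 else 1)"
    have "v \<in> {0, 1, \<i>, 1 + \<i>}" by (auto simp: v_def complex_eq_iff)
    moreover have "2 * z - v \<in> Q" using z by (auto simp: Q_def v_def)
    moreover have "z = g v (2 * z - v)" by (simp add: g_def)
    ultimately show "z \<in> (\<Union>v\<in>{0, 1, \<i>, 1 + \<i>}. g v ` Q)" by blast
  qed
  have "hausdorff_content 3 Q \<le> hausdorff_content 3 (\<Union>v\<in>{0, 1, \<i>, 1 + \<i>}. g v ` Q)"
    by (rule hausdorff_content_mono[OF cov])
  also have "\<dots> \<le> ennreal (4 * (q / 8))"
  proof (rule hausdorff_content_UN_countable)
    show "hausdorff_content 3 (g v ` Q) \<le> ennreal (q / 8)" for v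
      using half[of v] q by (simp add: ennreal_mult[symmetric])
    fix F assume "finite F" "F \<subseteq> {0, 1, \<i>, 1 + \<i>}"
    then have "card F \<le> card {0, 1, \<i>, 1 + \<i>}" by (intro card_mono) auto
    also have "\<dots> \<le> 4" by (simp add: card_insert_if)
    finally show "(\<Sum>v\<in>F. q / 8) \<le> 4 * (q / 8)"
      using q mult_left_mono[of "real (card F)" 4 q] by (simp add: mult.commute)
  qed (use q in auto)
  finally have "q = 0" using q by (simp add: ennreal_le_iff)
  then have Q0: "hausdorff_content 3 Q = 0" using q by simp
  have "hausdorff_content 3 ((\<lambda>z. of_int (fst p) + \<i> * of_int (snd p) + z) ` Q) = 0" for p :: "int \<times> int"
    by (rule hausdorff_content_zero_lipschitz_image[OF _ Q0, of _ 1]) auto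
  then have "hausdorff_content 3 (\<Union>p\<in>UNIV. (\<lambda>z. of_int (fst p) + \<i> * of_int (snd p) + z) ` Q) = 0"
    by (intro hausdorff_content_zero_UN) auto
  moreover have "S \<subseteq> (\<Union>p\<in>UNIV. (\<lambda>z. of_int (fst p) + \<i> * of_int (snd p) + z) ` Q)"
  proof
    fix z :: complex
    have "Complex (frac (Re z)) (frac (Im z)) \<in> Q"
      by (auto simp: Q_def frac_lt_1 less_imp_le)
    moreover have "z = of_int \<lfloor>Re z\<rfloor> + \<i> * of_int \<lfloor>Im z\<rfloor> + Complex (frac (Re z)) (frac (Im z))"
      by (simp add: complex_eq_iff frac_def)
    ultimately show "z \<in> (\<Union>p\<in>UNIV. (\<lambda>z. of_int (fst p) + \<i> * of_int (snd p) + z) ` Q)"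
      by (intro UN_I[of "(\<lfloor>Re z\<rfloor>, \<lfloor>Im z\<rfloor>)"]) auto
  qed
  ultimately show ?thesis
    by (simp add: hausdorff_measure_zero_iff hausdorff_content_zero_subset)
qed

lemma null_exponents_nonempty: "{s. 0 \<le> s \<and> hausdorff_measure s S = 0} \<noteq> {}"
proof -
  have "3 \<in> {s. 0 \<le> s \<and> hausdorff_measure s S = 0}"
    using hausdorff_measure_3_zero by simp
  then show ?thesis by blast
qed

lemma hausdorff_dim_nonneg: "0 \<le> hausdorff_dim S"
  unfolding hausdorff_dim_def using null_exponents_nonempty by (intro cInf_greatest) auto

lemma hausdorff_content_zero_above_dim:
  assumes "hausdorff_dim S < s"
  shows "hausdorff_content s S = 0"
proof -
  obtain t where "t < s" "0 \<le> t" "hausdorff_measure t S = 0"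
    using assms null_exponents_nonempty[of S] cInf_less_iff[OF _ bdd_below_null_exponents] unfolding hausdorff_dim_def by blast
  then show ?thesis
    using hausdorff_measure_mono_exponent[of t s S] hausdorff_measure_zero_iff[of s S] by auto
qed

lemma hausdorff_dim_le_of_content_zero:
  assumes "0 < s" "hausdorff_content s S = 0"
  shows "hausdorff_dim S \<le> s"
  unfolding hausdorff_dim_def using assms hausdorff_measure_zero_iff[of s S]
  by (intro cInf_lower bdd_below_null_exponents) auto

lemma hausdorff_dim_le:
  assumes "0 \<le> x" "\<And>s. x < s \<Longrightarrow> hausdorff_content s S = 0"
  shows "hausdorff_dim S \<le> x"
  by (rule dense_ge) (use assms in \<open>auto intro: hausdorff_dim_le_of_content_zero\<close>)

lemma hausdorff_dim_ge:
  assumes "\<And>s. 0 < s \<Longrightarrow> s < x \<Longrightarrow> hausdorff_content s S \<noteq> 0"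
  shows "x \<le> hausdorff_dim S"
proof (rule ccontr)
  assume "\<not> x \<le> hausdorff_dim S"
  then obtain s where "hausdorff_dim S < s" "s < x" using dense[of "hausdorff_dim S" x] by auto
  then show False
    using assms[of s] hausdorff_content_zero_above_dim[of S s] hausdorff_dim_nonneg[of S] by auto
qed

text \<open>Compares dimensions of sets that are not nested: it is enough that nullity passes from
  \<open>T\<close> to \<open>S\<close>. This is how escaping points, which are large only
  eventually, are compared with large orbits.\<close>

lemma hausdorff_dim_mono_null:
  assumes "\<And>s. 0 < s \<Longrightarrow> hausdorff_content s T = 0 \<Longrightarrow> hausdorff_content s S = 0"
  shows "hausdorff_dim S \<le> hausdorff_dim T"
  using assms hausdorff_content_zero_above_dim[of T] hausdorff_dim_nonneg[of T]
  by (intro hausdorff_dim_le) auto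

lemma hausdorff_dim_mono: "S \<subseteq> T \<Longrightarrow> hausdorff_dim S \<le> hausdorff_dim T"
  by (intro hausdorff_dim_mono_null) (rule hausdorff_content_zero_subset)

section \<open>Cantor sets and mass distribution\<close>

text \<open>Under the product of the uniform measures on the alphabets, a cylinder of length
  \<open>k i\<close> has at most the mass in the sum, and countably many cylinders covering a
  probability space have total mass at least 1.\<close>

lemma cylinder_cover_mass_ge_1:
  fixes A :: "nat \<Rightarrow> 'a set" and v :: "nat \<Rightarrow> nat \<Rightarrow> 'a" and k :: "nat \<Rightarrow> nat"
  assumes fin: "\<And>j. finite (A j)" and ne: "\<And>j. A j \<noteq> {}"
    and cover: "\<And>\<omega>. (\<And>j. \<omega> j \<in> A j) \<Longrightarrow> \<exists>i. \<forall>j<k i. \<omega> j = v i j"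
  shows "1 \<le> (\<Sum>i. ennreal (1 / (\<Prod>j<k i. real (card (A j)))))"
proof -
  define M where "M j = uniform_count_measure (A j)" for j
  have pM: "prob_space (M j)" for j
    unfolding M_def by (rule prob_space_uniform_count_measure[OF fin ne])
  have sp: "space (M j) = A j" "sets (M j) = Pow (A j)" for j
    by (simp_all add: M_def space_uniform_count_measure sets_uniform_count_measure)
  \<comment> \<open>The letters \<open>v i j\<close> need not belong to the alphabets; a cylinder
    with a foreign letter gets mass 0 by the intersection with \<open>A j\<close>.\<close>
  define C where "C i = prod_emb UNIV M {..<k i} (PiE {..<k i} (\<lambda>j. {v i j} \<inter> A j))" for i
  interpret P: prob_space "PiM UNIV M" by (rule prob_space_PiM) (rule pM)
  have meas: "C i \<in> sets (PiM UNIV M)" for i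
    unfolding C_def by (rule sets_PiM_I) (auto simp: sp)
  have mC: "emeasure (PiM UNIV M) (C i) \<le> ennreal (1 / (\<Prod>j<k i. real (card (A j))))" for i
  proof -
    have "emeasure (PiM UNIV M) (C i) = (\<Prod>j<k i. emeasure (M j) ({v i j} \<inter> A j))"
      unfolding C_def by (rule emeasure_PiM_emb) (auto simp: pM sp)
    also have "\<dots> \<le> (\<Prod>j<k i. ennreal (1 / real (card (A j))))"
    proof (rule prod_mono_ennreal)
      fix j
      have "real (card ({v i j} \<inter> A j)) \<le> 1"
        using card_mono[of "{v i j}" "{v i j} \<inter> A j"] by simp
      then show "emeasure (M j) ({v i j} \<inter> A j) \<le> ennreal (1 / real (card (A j)))"
        unfolding M_def by (simp add: emeasure_uniform_count_measure fin ennreal_leI divide_right_mono)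
    qed
    also have "\<dots> = ennreal (\<Prod>j<k i. 1 / real (card (A j)))"
      by (rule prod_ennreal) auto
    finally show ?thesis by (simp add: prod_dividef)
  qed
  have "space (PiM UNIV M) \<subseteq> (\<Union>i. C i)"
  proof
    fix \<omega> assume w: "\<omega> \<in> space (PiM UNIV M)"
    then have wA: "\<omega> j \<in> A j" for j by (auto simp: space_PiM sp)
    then obtain i where "\<forall>j<k i. \<omega> j = v i j" using cover by blast
    then have "\<omega> \<in> C i"
      using wA w by (auto simp: C_def prod_emb_def sp space_PiM)
    then show "\<omega> \<in> (\<Union>i. C i)" by blast
  qed
  then have "emeasure (PiM UNIV M) (space (PiM UNIV M)) \<le> emeasure (PiM UNIV M) (\<Union>i. C i)"
    using meas by (intro emeasure_mono) auto
  also have "\<dots> \<le> (\<Sum>i. emeasure (PiM UNIV M) (C i))"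
    using meas by (intro emeasure_subadditive_countably) auto
  also have "\<dots> \<le> (\<Sum>i. ennreal (1 / (\<Prod>j<k i. real (card (A j)))))"
    by (intro suminf_le mC) auto
  finally show ?thesis by (simp add: P.emeasure_space_1)
qed

text \<open>Mass distribution with separation only. If \<open>k\<close> is least with
  \<open>gap k \<le> diameter U\<close>, then points of \<open>U\<close> cannot have itineraries
  that first differ before \<open>k\<close>, so \<open>U\<close> meets only one cylinder of length
  \<open>k\<close>; \<open>mass\<close> bounds the weight of that cylinder by
  \<open>K * diameter U powr t\<close>. A cover with small sum would then carry total weight below
  1.\<close>

lemma cantor_set_content_nonzero:
  fixes A :: "nat \<Rightarrow> 'a set" and z :: "(nat \<Rightarrow> 'a) \<Rightarrow> complex" and gap :: "nat \<Rightarrow> real"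
  assumes card2: "\<And>j. 2 \<le> card (A j)" and t: "0 < t" and K: "0 < K"
    and gap: "\<And>k. 0 < gap k"
    and sep: "\<And>\<omega> \<omega>' k. \<lbrakk>\<And>j. \<omega> j \<in> A j; \<And>j. \<omega>' j \<in> A j; \<And>j. j < k \<Longrightarrow> \<omega> j = \<omega>' j; \<omega> k \<noteq> \<omega>' k\<rbrakk>
        \<Longrightarrow> gap k \<le> dist (z \<omega>) (z \<omega>')"
    and mass: "\<And>k. 1 \<le> K * gap k powr t * (\<Prod>j<k. real (card (A j)))"
  shows "hausdorff_content t (z ` {\<omega>. \<forall>j. \<omega> j \<in> A j}) \<noteq> 0"
proof
  let ?N = "\<lambda>k. \<Prod>j<k. real (card (A j))"
  assume "hausdorff_content t (z ` {\<omega>. \<forall>j. \<omega> j \<in> A j}) = 0"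
  \<comment> \<open>With this threshold the covering sets carry weight at most 1/2, and the
    corrections for sets of very small diameter add 1/4.\<close>
  then have "hausdorff_content t (z ` {\<omega>. \<forall>j. \<omega> j \<in> A j}) < ennreal (1 / (2 * K))"
    using K by simp
  then obtain U where U: "z ` {\<omega>. \<forall>j. \<omega> j \<in> A j} \<subseteq> (\<Union>i. U i)" "\<And>i. bounded (U i)"
    "(\<Sum>i. ennreal (diameter (U i) powr t)) < ennreal (1 / (2 * K))"
    using hausdorff_content_less_cover by blast
  have fin: "finite (A j)" and ne: "A j \<noteq> {}" for j
    using card2[of j] by (auto intro: card_ge_0_finite)
  have Npos: "0 < ?N k" for k
    using card2 by (intro prod_pos) (simp add: less_le_trans[of 0 2])
  have N2: "2 ^ k \<le> ?N k" for k
  proof -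
    have "(\<Prod>j<k. 2) \<le> ?N k" using card2 by (intro prod_mono) auto
    then show ?thesis by simp
  qed
  have "\<exists>k v. (\<forall>\<omega>. (\<forall>j. \<omega> j \<in> A j) \<and> z \<omega> \<in> U i \<longrightarrow> (\<forall>j<k. \<omega> j = v j)) \<and>
      1 / ?N k \<le> K * diameter (U i) powr t + 1/4 * (1/2) ^ Suc i" for i
  proof -
    have "\<exists>k. (\<forall>j<k. diameter (U i) < gap j) \<and>
        1 / ?N k \<le> K * diameter (U i) powr t + 1/4 * (1/2) ^ Suc i"
    proof (cases "\<exists>k. gap k \<le> diameter (U i)")
      case True
      define k where "k = (LEAST k. gap k \<le> diameter (U i))"
      have k: "gap k \<le> diameter (U i)" unfolding k_def using True by (rule LeastI_ex)
      have "diameter (U i) < gap j" if "j < k" for j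
        using not_less_Least[of j "\<lambda>k. gap k \<le> diameter (U i)"] that by (auto simp: k_def)
      moreover have "1 / ?N k \<le> K * gap k powr t"
        using mass[of k] Npos[of k] by (simp add: divide_simps)
      moreover have "K * gap k powr t \<le> K * diameter (U i) powr t"
        using k gap[of k] t K by (intro mult_left_mono powr_mono2) auto
      moreover have "0 \<le> (1/4::real) * (1/2) ^ Suc i" by simp
      ultimately show ?thesis by (intro exI[of _ k] conjI allI impI) (blast, linarith)
    next
      case False
      \<comment> \<open>The diameter is below every gap, so any length is allowed. As each alphabet
        has at least two letters, length \<open>i + 3\<close> brings the weight below the summable
        correction \<open>1/4 * (1/2) ^ Suc i\<close>.\<close>
      let ?k = "i + 3"
      have "1 / ?N ?k \<le> 1 / 2 ^ ?k" using N2[of ?k] by (intro divide_left_mono) (auto simp: Npos)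
      also have "\<dots> = 1/4 * (1/2) ^ Suc i" by (simp add: power_add field_simps)
      also have "\<dots> \<le> K * diameter (U i) powr t + 1/4 * (1/2) ^ Suc i" using K by simp
      finally show ?thesis using False by (intro exI[of _ ?k]) (auto simp: not_le)
    qed
    then obtain k where k: "\<And>j. j < k \<Longrightarrow> diameter (U i) < gap j"
      "1 / ?N k \<le> K * diameter (U i) powr t + 1/4 * (1/2) ^ Suc i" by blast
    show ?thesis
    proof (cases "\<exists>\<omega>. (\<forall>j. \<omega> j \<in> A j) \<and> z \<omega> \<in> U i")
      case True
      then obtain v where v: "\<And>j. v j \<in> A j" "z v \<in> U i" by blast
      have "\<omega> j = v j" if w: "\<forall>j. \<omega> j \<in> A j" "z \<omega> \<in> U i" "j < k" for \<omega> j
      proof (rule ccontr)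
        assume "\<omega> j \<noteq> v j"
        define l where "l = (LEAST l. \<omega> l \<noteq> v l)"
        have l: "\<omega> l \<noteq> v l" unfolding l_def using \<open>\<omega> j \<noteq> v j\<close> by (rule LeastI)
        have "l \<le> j" unfolding l_def using \<open>\<omega> j \<noteq> v j\<close> by (rule Least_le)
        have "\<omega> m = v m" if "m < l" for m
          using not_less_Least[of m "\<lambda>l. \<omega> l \<noteq> v l"] that by (auto simp: l_def)
        then have "gap l \<le> dist (z \<omega>) (z v)" using w v l by (intro sep) auto
        also have "\<dots> \<le> diameter (U i)"
          using w v U(2) by (intro diameter_bounded_bound) auto
        finally show False using k(1)[of l] \<open>l \<le> j\<close> w by auto
      qed
      then show ?thesis using k(2) by blast
    next
      case False
      then show ?thesis using k(2) by blast
    qed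
  qed
  then obtain k v where kv: "\<And>i \<omega> j. (\<forall>j. \<omega> j \<in> A j) \<Longrightarrow> z \<omega> \<in> U i \<Longrightarrow> j < k i \<Longrightarrow> \<omega> j = v i j"
    "\<And>i. 1 / ?N (k i) \<le> K * diameter (U i) powr t + 1/4 * (1/2) ^ Suc i"
    by metis
  have "1 \<le> (\<Sum>i. ennreal (1 / ?N (k i)))"
  proof (rule cylinder_cover_mass_ge_1[OF fin ne])
    fix \<omega> assume w: "\<And>j. \<omega> j \<in> A j"
    then obtain i where "z \<omega> \<in> U i" using U(1) by blast
    then show "\<exists>i. \<forall>j<k i. \<omega> j = v i j" using kv(1) w by blast
  qed
  also have "\<dots> \<le> (\<Sum>i. ennreal K * ennreal (diameter (U i) powr t) + ennreal (1/4 * (1/2) ^ Suc i))"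
  proof (intro suminf_le allI)
    fix i
    have "ennreal (1 / ?N (k i)) \<le> ennreal (K * diameter (U i) powr t + 1/4 * (1/2) ^ Suc i)"
      by (rule ennreal_leI[OF kv(2)])
    also have "\<dots> = ennreal K * ennreal (diameter (U i) powr t) + ennreal (1/4 * (1/2) ^ Suc i)"
      using K by (subst ennreal_plus) (auto simp: ennreal_mult)
    finally show "ennreal (1 / ?N (k i)) \<le> ennreal K * ennreal (diameter (U i) powr t) + ennreal (1/4 * (1/2) ^ Suc i)" .
  qed auto
  also have "\<dots> = (\<Sum>i. ennreal K * ennreal (diameter (U i) powr t)) + (\<Sum>i. ennreal (1/4 * (1/2) ^ Suc i))"
    by (rule suminf_add[symmetric]) auto
  also have "(\<Sum>i. ennreal (1/4 * (1/2) ^ Suc i)) = ennreal (1/4)"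
    using sums_mult[OF power_half_series, of "1/4"] by (intro suminf_ennreal_eq) auto
  also have "(\<Sum>i. ennreal K * ennreal (diameter (U i) powr t)) = ennreal K * (\<Sum>i. ennreal (diameter (U i) powr t))"
    by (rule ennreal_suminf_cmult)
  also have "\<dots> + ennreal (1/4) \<le> ennreal K * ennreal (1 / (2 * K)) + ennreal (1/4)"
    using U(3) by (intro add_mono mult_left_mono) auto
  also have "ennreal K * ennreal (1 / (2 * K)) = ennreal (1/2)"
    using K by (subst ennreal_mult[symmetric]) auto
  also have "ennreal (1/2) + ennreal (1/4) = ennreal (1/2 + 1/4)"
    by (rule ennreal_plus[symmetric]) auto
  finally have "ennreal 1 \<le> ennreal (1/2 + 1/4)" by simp
  then show False by (subst (asm) ennreal_le_iff) auto
qed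

section \<open>Counting poles\<close>

text \<open>The shell with inner radius \<open>V = 2 ^ k * W\<close> contributes at most
  \<open>Q * V powr (t - t')\<close>, a geometric sequence in \<open>k\<close> with ratio
  \<open>2 powr (t - t')\<close>. The explicit power of \<open>W\<close> makes tails over large
  poles small; read contrapositively, divergence yields well-populated annuli.\<close>

lemma sum_powr_dyadic_bound:
  fixes P :: "complex set"
  assumes Q: "0 \<le> Q" and t: "t < t'" "0 \<le> t'" and W0: "0 < W"
    and card: "\<And>V. W \<le> V \<Longrightarrow> real (card {a\<in>P. V \<le> norm a \<and> norm a < 2 * V}) \<le> Q * V powr t"
    and fin: "\<And>V. W \<le> V \<Longrightarrow> finite {a\<in>P. V \<le> norm a \<and> norm a < 2 * V}"
    and F: "finite F" "F \<subseteq> {a\<in>P. W \<le> norm a}"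
  shows "(\<Sum>a\<in>F. norm a powr (-t')) \<le> Q * W powr (t - t') / (1 - 2 powr (t - t'))"
proof -
  define x where "x = (2::real) powr (t - t')"
  have x: "0 < x" "x < 1"
    using t powr_less_one[of 2 "t - t'"] by (auto simp: x_def)
  define A where "A k = {a\<in>P. 2 ^ k * W \<le> norm a \<and> norm a < 2 * (2 ^ k * W)}" for k :: nat
  have cov: "\<exists>k. a \<in> A k" if a: "a \<in> F" for a
  proof -
    have Wa: "W \<le> norm a" "a \<in> P" using a F by auto
    obtain n where n: "norm a / W < 2 ^ n" using real_arch_pow[of 2 "norm a / W"] by auto
    define k where "k = (LEAST k. norm a < 2 ^ k * W)"
    have ex: "norm a < 2 ^ n * W" using n W0 by (simp add: field_simps)
    then have k: "norm a < 2 ^ k * W" unfolding k_def by (rule LeastI)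
    have "k \<noteq> 0" using k Wa by (cases k) auto
    then obtain j where j: "k = Suc j" by (cases k) auto
    then have "\<not> norm a < 2 ^ j * W"
      using not_less_Least[of j "\<lambda>k. norm a < 2 ^ k * W"] by (auto simp: k_def)
    then show ?thesis using k j Wa by (auto simp: A_def intro!: exI[of _ j])
  qed
  then obtain \<kappa> where kap: "\<And>a. a \<in> F \<Longrightarrow> a \<in> A (\<kappa> a)" by metis
  have W2: "W \<le> 2 ^ k * W" for k :: nat using W0 by (simp add: mult_le_cancel_right1)
  have "(\<Sum>a\<in>F. norm a powr (-t')) = (\<Sum>k\<in>\<kappa> ` F. \<Sum>a\<in>{a\<in>F. \<kappa> a = k}. norm a powr (-t'))"
    by (rule sum.image_gen[OF F(1)])
  also have "\<dots> \<le> (\<Sum>k\<in>\<kappa> ` F. Q * W powr (t - t') * x ^ k)"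
  proof (rule sum_mono)
    fix k
    let ?V = "2 ^ k * W"
    have V: "0 < ?V" using W0 by simp
    have "(\<Sum>a\<in>{a\<in>F. \<kappa> a = k}. norm a powr (-t')) \<le> (\<Sum>a\<in>{a\<in>F. \<kappa> a = k}. ?V powr (-t'))"
    proof (rule sum_mono)
      fix a assume "a \<in> {a \<in> F. \<kappa> a = k}"
      then have "?V \<le> norm a" using kap[of a] by (auto simp: A_def)
      then show "norm a powr (-t') \<le> ?V powr (-t')"
        using t V by (intro powr_mono2') auto
    qed
    also have "\<dots> = real (card {a\<in>F. \<kappa> a = k}) * ?V powr (-t')" by simp
    also have "\<dots> \<le> real (card (A k)) * ?V powr (-t')"
    proof -
      have "card {a\<in>F. \<kappa> a = k} \<le> card (A k)"
        using kap fin[OF W2, of k] by (intro card_mono) (auto simp: A_def)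
      then show ?thesis by (intro mult_right_mono) auto
    qed
    also have "\<dots> \<le> (Q * ?V powr t) * ?V powr (-t')"
      using card[OF W2, of k] by (intro mult_right_mono) (auto simp: A_def)
    also have "\<dots> = Q * ?V powr (t - t')" by (simp add: powr_add[symmetric])
    also have "\<dots> = Q * W powr (t - t') * x ^ k"
      using W0 by (simp add: powr_mult x_def powr_realpow[symmetric] powr_powr mult.commute)
    finally show "(\<Sum>a\<in>{a\<in>F. \<kappa> a = k}. norm a powr (-t')) \<le> Q * W powr (t - t') * x ^ k" .
  qed
  also have "\<dots> = Q * W powr (t - t') * (\<Sum>k\<in>\<kappa> ` F. x ^ k)" by (simp add: sum_distrib_left)
  also have "\<dots> \<le> Q * W powr (t - t') * (1 / (1 - x))"
  proof (rule mult_left_mono)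
    have "(\<Sum>k\<in>\<kappa> ` F. x ^ k) \<le> (\<Sum>k. x ^ k)"
      using x F by (intro sum_le_suminf summable_geometric) auto
    also have "\<dots> = 1 / (1 - x)" using x by (intro suminf_geometric) auto
    finally show "(\<Sum>k\<in>\<kappa> ` F. x ^ k) \<le> 1 / (1 - x)" .
  qed (use Q in simp)
  finally show ?thesis by (simp add: x_def)
qed

text \<open>The counting function is a finite sum of indicators of \<open>norm a \<le> t\<close>, so
  each nonzero pole contributes its multiplicity times the integral of \<open>1 / t\<close> from
  \<open>norm a\<close> to \<open>r\<close>.\<close>

lemma nev_N_eq:
  assumes fin: "finite (poles f \<inter> cball 0 r)" and r: "0 < r"
  shows "nev_N f r = (\<Sum>a\<in>poles f \<inter> cball 0 r - {0}. real (pole_mult f a) * (ln r - ln (norm a))) + nev_n f 0 * ln r"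
proof -
  let ?P = "poles f \<inter> cball 0 r - {0}"
  let ?m = "\<lambda>a. real (pole_mult f a)"
  have one: "((\<lambda>t. if t \<in> {norm a..r} then ?m a / t else 0) has_integral (?m a * (ln r - ln (norm a)))) {0..r}"
    if "a \<in> ?P" for a
  proof -
    have a: "0 < norm a" "norm a \<le> r" using that by auto
    have pos: "0 < x" if "norm a \<le> x" for x using a(1) that by linarith
    have "((\<lambda>t. ?m a / t) has_integral (?m a * ln r - ?m a * ln (norm a))) {norm a..r}"
      using a by (intro fundamental_theorem_of_calculus)
        (auto intro!: derivative_eq_intros pos simp: has_real_derivative_iff_has_vector_derivative[symmetric])
    then show ?thesis
      using a by (subst has_integral_restrict) (auto simp: right_diff_distrib)
  qed
  have "((\<lambda>t. \<Sum>a\<in>?P. if t \<in> {norm a..r} then ?m a / t else 0) has_integral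
      (\<Sum>a\<in>?P. ?m a * (ln r - ln (norm a)))) {0..r}"
    using fin one by (intro has_integral_sum) auto
  then have "((\<lambda>t. (nev_n f t - nev_n f 0) / t) has_integral
      (\<Sum>a\<in>?P. ?m a * (ln r - ln (norm a)))) {0..r}"
  proof (rule has_integral_eq[rotated])
    fix t assume t: "t \<in> {0..r}"
    have fint: "finite (poles f \<inter> cball 0 t)"
      using t by (intro finite_subset[OF _ fin]) auto
    have "nev_n f t = sum ?m ((poles f \<inter> cball 0 t - {0}) \<union> (poles f \<inter> cball 0 0))"
      unfolding nev_n_def using t by (intro sum.cong) auto
    also have "\<dots> = sum ?m (poles f \<inter> cball 0 t - {0}) + nev_n f 0"
      unfolding nev_n_def using fint by (intro sum.union_disjoint) auto
    also have "poles f \<inter> cball 0 t - {0} = {a \<in> ?P. t \<in> {norm a..r}}"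
      using t by auto
    finally have "nev_n f t - nev_n f 0 = sum ?m {a \<in> ?P. t \<in> {norm a..r}}" by simp
    then have "(nev_n f t - nev_n f 0) / t = (\<Sum>a\<in>{a \<in> ?P. t \<in> {norm a..r}}. ?m a / t)"
      by (simp add: sum_divide_distrib)
    also have "\<dots> = (\<Sum>a\<in>?P. if t \<in> {norm a..r} then ?m a / t else 0)"
      using fin by (intro sum.inter_filter) auto
    finally show "(\<Sum>a\<in>?P. if t \<in> {norm a..r} then ?m a / t else 0) = (nev_n f t - nev_n f 0) / t" ..
  qed
  then show ?thesis unfolding nev_N_def by (simp add: integral_unique)
qed

lemma nev_m_nonneg: "0 \<le> nev_m f r"
proof -
  \<comment> \<open>If the integrand is not integrable, \<open>integral\<close> has the default
    value 0, so both cases give the inequality.\<close>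
  have "0 \<le> integral {0..2*pi} (\<lambda>\<theta>. log_plus (norm (f (of_real r * cis \<theta>))))"
    by (cases "(\<lambda>\<theta>. log_plus (norm (f (of_real r * cis \<theta>)))) integrable_on {0..2*pi}")
      (auto intro: integral_nonneg simp: log_plus_def not_integrable_integral)
  then show ?thesis unfolding nev_m_def by simp
qed

text \<open>The radius \<open>2 * exp 1 * V\<close> makes \<open>ln r - ln (norm a) \<ge> 1\<close>
  for every pole with \<open>norm a < 2 * V\<close>, so each counted pole adds at least 1 to
  \<open>nev_N\<close>.\<close>

lemma card_poles_le_nev_T:
  assumes fin: "finite (poles f \<inter> cball 0 (2 * exp 1 * V))" and V: "1 \<le> V"
    and P: "P \<subseteq> poles f" "\<And>a. a \<in> P \<Longrightarrow> 1 \<le> pole_mult f a"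
  shows "real (card {a\<in>P. V \<le> norm a \<and> norm a < 2 * V}) \<le> nev_T f (2 * exp 1 * V)"
proof -
  let ?r = "2 * exp 1 * V"
  let ?A = "{a\<in>P. V \<le> norm a \<and> norm a < 2 * V}"
  let ?g = "\<lambda>a. real (pole_mult f a) * (ln ?r - ln (norm a))"
  have e1: "(1::real) \<le> exp 1" by simp
  have r: "2 * V \<le> ?r" using V e1 mult_right_mono[OF e1, of "2 * V"] by (simp add: mult_ac)
  have sub: "?A \<subseteq> poles f \<inter> cball 0 ?r - {0}"
  proof
    fix x assume x: "x \<in> ?A"
    then have "norm x < 2 * V" by simp
    then have "norm x \<le> ?r" using r by linarith
    then show "x \<in> poles f \<inter> cball 0 ?r - {0}" using x V P by auto
  qed
  have "real (card ?A) = (\<Sum>a\<in>?A. 1)" by simp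
  also have "\<dots> \<le> (\<Sum>a\<in>?A. ?g a)"
  proof (rule sum_mono)
    fix a assume a: "a \<in> ?A"
    then have "ln (norm a) \<le> ln (2 * V)" using V by (subst ln_le_cancel_iff) auto
    then have "1 \<le> ln ?r - ln (norm a)" using V by (simp add: ln_mult)
    moreover have "1 \<le> real (pole_mult f a)" using a P(2)[of a] by simp
    ultimately show "1 \<le> ?g a" using mult_mono[of 1 "real (pole_mult f a)" 1 "ln ?r - ln (norm a)"] by simp
  qed
  also have "\<dots> \<le> (\<Sum>a\<in>poles f \<inter> cball 0 ?r - {0}. ?g a)"
  proof (rule sum_mono2)
    show "0 \<le> ?g b" if "b \<in> poles f \<inter> cball 0 ?r - {0} - ?A" for b
    proof -
      have "ln (norm b) \<le> ln ?r" using that V by (subst ln_le_cancel_iff) auto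
      then show ?thesis by simp
    qed
  qed (use fin sub in auto)
  also have "\<dots> \<le> nev_N f ?r"
  proof -
    have "1 \<le> ?r" using V r by linarith
    then have "0 \<le> nev_n f 0 * ln ?r"
      unfolding nev_n_def by (intro mult_nonneg_nonneg sum_nonneg ln_ge_zero) auto
    moreover have "0 < ?r" using V by simp
    ultimately show ?thesis using nev_N_eq[OF fin] by simp
  qed
  also have "\<dots> \<le> nev_T f ?r" unfolding nev_T_def using nev_m_nonneg by simp
  finally show ?thesis .
qed

lemma card_poles_annulus_le_powr:
  assumes fin: "\<And>r. finite (poles f \<inter> cball 0 r)"
    and P: "P \<subseteq> poles f" "\<And>a. a \<in> P \<Longrightarrow> 1 \<le> pole_mult f a"
    and order: "mero_order f = ereal \<rho>" and t: "\<rho> < t"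
  shows "\<exists>W\<ge>1. \<forall>V\<ge>W. real (card {a\<in>P. V \<le> norm a \<and> norm a < 2 * V}) \<le> (2 * exp 1) powr t * V powr t"
proof -
  have "Limsup at_top (\<lambda>r. ereal (ln (nev_T f r) / ln r)) < ereal t"
    using order t unfolding mero_order_def by simp
  then have "eventually (\<lambda>r. ereal (ln (nev_T f r) / ln r) < ereal t) at_top"
    by (rule Limsup_lessD)
  then obtain R where R: "\<And>r. R \<le> r \<Longrightarrow> ln (nev_T f r) / ln r < t"
    by (auto simp: eventually_at_top_linorder)
  have "real (card {a\<in>P. V \<le> norm a \<and> norm a < 2 * V}) \<le> (2 * exp 1) powr t * V powr t" if V: "max 1 R \<le> V" for V
  proof -
    let ?r = "2 * exp 1 * V"
    have e1: "(1::real) \<le> exp 1" by simp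
    have r: "2 * V \<le> ?r" using V e1 mult_right_mono[OF e1, of "2 * V"] by (simp add: mult_ac)
    have c: "real (card {a\<in>P. V \<le> norm a \<and> norm a < 2 * V}) \<le> nev_T f ?r"
      using V by (intro card_poles_le_nev_T[OF fin _ P]) auto
    show ?thesis
    \<comment> \<open>The logarithm controls the characteristic only where it is positive; where it
      is not, the count is at most 0 anyway.\<close>
    proof (cases "nev_T f ?r \<le> 0")
      case True
      then show ?thesis using c by (smt (verit) mult_nonneg_nonneg powr_ge_zero)
    next
      case False
      have "ln (nev_T f ?r) / ln ?r < t" by (rule R) (use V r in linarith)
      moreover have "0 < ln ?r" by (rule ln_gt_zero) (use V r in linarith)
      ultimately have "ln (nev_T f ?r) < t * ln ?r" by (simp add: field_simps)
      also have "t * ln ?r = ln (?r powr t)" using V by (simp add: ln_powr)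
      finally have "nev_T f ?r < ?r powr t" using False V by (subst (asm) ln_less_cancel_iff) auto
      then show ?thesis using c V by (simp add: powr_mult)
    qed
  qed
  then show ?thesis by (intro exI[of _ "max 1 R"]) auto
qed

section \<open>Large values are taken near poles\<close>

text \<open>Phragmen--Lindelof: apply the maximum principle to \<open>f\<^sup>n / (z - z1)\<close> and let n tend to infinity.\<close>
lemma maximum_modulus_unbounded:
  fixes f :: "complex \<Rightarrow> complex"
  assumes U: "open U" and hol: "f holomorphic_on U" and cont: "continuous_on (closure U) f"
    and K: "\<And>z. z \<in> U \<Longrightarrow> norm (f z) \<le> K"
    and L: "0 < L" "\<And>z. z \<in> frontier U \<Longrightarrow> norm (f z) \<le> L"
    and d: "0 < d" "ball z1 d \<inter> U = {}" and w: "w \<in> U"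
  shows "norm (f w) \<le> L"
proof (rule ccontr)
  assume "\<not> norm (f w) \<le> L"
  then have gt: "1 < norm (f w) / L" using L by simp
  have Kpos: "0 < K" using K[OF w] gt L by (smt (verit) divide_nonpos_nonneg norm_ge_zero)
  have dU: "d \<le> norm (z - z1)" if "z \<in> closure U" for z
  proof -
    have "z1 \<notin> ball z d" if "z \<in> U" for z
      using d that by (auto simp: disjoint_iff dist_commute)
    then have "U \<subseteq> - ball z1 d" using d by auto
    then have "closure U \<subseteq> - ball z1 d" by (intro closure_minimal) auto
    then show ?thesis using that by (auto simp: dist_norm norm_minus_commute not_less)
  qed
  have Kcl: "norm (f z) \<le> K" if "z \<in> closure U" for z
    using continuous_on_closure_norm_le[OF cont _ that] K by blast
  have bound: "norm (f w) ^ n \<le> L ^ n * norm (w - z1) / d" for n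
  proof -
    \<comment> \<open>The truncation radius puts \<open>w\<close> inside the disc and is so large
      that on the outer circle the crude bound \<open>K ^ n / r\<close> drops below
      \<open>L ^ n / d\<close>.\<close>
    define r where "r = norm (w - z1) + K ^ n * d / L ^ n + 1"
    have r: "norm (w - z1) < r" "K ^ n * d / L ^ n \<le> r" "0 < r"
    proof -
      have "0 \<le> K ^ n * d / L ^ n" using Kpos d L by simp
      then show "norm (w - z1) < r" "K ^ n * d / L ^ n \<le> r" "0 < r"
        unfolding r_def by (simp_all add: add_nonneg_pos)
    qed
    have Kr: "K ^ n / r \<le> L ^ n / d" using r d L by (simp add: field_simps)
    let ?S = "U \<inter> ball z1 r"
    have opS: "open ?S" using U by auto
    have clS: "closure ?S \<subseteq> closure U" by (intro closure_mono) auto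
    have ne: "z - z1 \<noteq> 0" if "z \<in> closure U" for z using dU[OF that] d by auto
    have "norm (f w ^ n / (w - z1)) \<le> L ^ n / d"
    proof (rule maximum_modulus_frontier[where S = ?S and f = "\<lambda>z. f z ^ n / (z - z1)"])
      show "(\<lambda>z. f z ^ n / (z - z1)) holomorphic_on interior ?S"
        unfolding interior_open[OF opS] using ne closure_subset[of U]
        by (intro holomorphic_intros holomorphic_on_subset[OF hol]) auto
      show "continuous_on (closure ?S) (\<lambda>z. f z ^ n / (z - z1))"
        using clS ne by (intro continuous_intros continuous_on_subset[OF cont]) auto
      show "bounded ?S" by (simp add: bounded_Int)
      show "w \<in> ?S" using w r by (auto simp: dist_norm norm_minus_commute)
      fix z assume z: "z \<in> frontier ?S"
      then have zcl: "z \<in> closure U" "z \<notin> ?S"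
        using clS unfolding frontier_def interior_open[OF opS] by auto
      show "norm (f z ^ n / (z - z1)) \<le> L ^ n / d"
      proof (cases "z \<in> U")
        case True
        then have "r \<le> norm (z - z1)" using zcl by (auto simp: dist_norm norm_minus_commute)
        moreover have "norm (f z) ^ n \<le> K ^ n" using Kcl[OF zcl(1)] by (intro power_mono) auto
        ultimately have "norm (f z) ^ n / norm (z - z1) \<le> K ^ n / r"
          using r Kpos by (intro frac_le) auto
        then show ?thesis using Kr by (simp add: norm_divide norm_power)
      next
        case False
        then have "z \<in> frontier U" using zcl U by (simp add: frontier_def interior_open)
        then have "norm (f z) ^ n \<le> L ^ n" using L by (intro power_mono) auto
        then have "norm (f z) ^ n / norm (z - z1) \<le> L ^ n / d"
          using dU[OF zcl(1)] d L by (intro frac_le) auto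
        then show ?thesis by (simp add: norm_divide norm_power)
      qed
    qed
    moreover have "0 < norm (w - z1)" using ne[of w] w closure_subset[of U] by auto
    ultimately show ?thesis by (simp add: norm_divide norm_power field_simps)
  qed
  \<comment> \<open>The factor \<open>norm (w - z1) / d\<close> does not depend on \<open>n\<close>,
    so powers of a ratio above 1 eventually violate \<open>bound\<close>.\<close>
  obtain n where n: "norm (w - z1) / d < (norm (f w) / L) ^ n"
    using real_arch_pow[OF gt] by blast
  then show False using bound[of n] L d by (simp add: power_divide field_simps)
qed

text \<open>Joins countably many arcs into one ray, the form that asymptotic paths must have. Near
  any \<open>t\<close> only finitely many pieces matter, and consecutive ones agree at integers by
  \<open>join\<close>.\<close>

lemma continuous_on_nat_pieces:
  fixes g :: "nat \<Rightarrow> real \<Rightarrow> 'a::real_normed_vector"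
  assumes path: "\<And>k. path (g k)" and join: "\<And>k. g k 1 = g (Suc k) 0"
  shows "continuous_on {0..} (\<lambda>t. g (nat \<lfloor>t\<rfloor>) (t - of_int \<lfloor>t\<rfloor>))" (is "continuous_on _ ?h")
proof -
  have h: "?h t = g k (t - real k)" if "real k \<le> t" "t \<le> real (Suc k)" for t k
  proof (cases "t = real (Suc k)")
    case True
    then have "\<lfloor>t\<rfloor> = int (Suc k)" by linarith
    then show ?thesis using True join[of k] by (simp add: nat_add_distrib)
  next
    case False
    then have "\<lfloor>t\<rfloor> = int k" using that by linarith
    then show ?thesis by simp
  qed
  have piece: "continuous_on {real k..real (Suc k)} ?h" for k
  proof -
    have "continuous_on {real k..real (Suc k)} (\<lambda>t. t - real k)" by (intro continuous_intros)
    then have "continuous_on {real k..real (Suc k)} (\<lambda>t. g k (t - real k))"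
      by (rule continuous_on_compose2[OF path[unfolded path_def]]) auto
    then show ?thesis by (rule continuous_on_eq) (rule h[symmetric]; simp)
  qed
  have upto: "continuous_on {0..real n} ?h" for n
  proof (induction n)
    case (Suc n)
    have "{0..real (Suc n)} = {0..real n} \<union> {real n..real (Suc n)}" by auto
    then show ?case using continuous_on_closed_Un[OF _ _ Suc piece[of n]] by simp
  qed auto
  show ?thesis
    unfolding continuous_on_eq_continuous_within
  proof
    fix t :: real assume t: "t \<in> {0..}"
    obtain n where n: "t < real n" using reals_Archimedean2 by blast
    have "continuous (at t within {0..real n}) ?h"
      using upto[of n] t n by (auto simp: continuous_on_eq_continuous_within)
    moreover have "at t within {0..real n} = at t within {0..}"
      using n by (intro at_within_nhd[of _ "{..<real n}"]) auto
    ultimately show "continuous (at t within {0..}) ?h" by simp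
  qed
qed

text \<open>Iversen's argument: otherwise nested components of \<open>{z \<in> S. L < norm (f z)}\<close> with L tending to infinity
  contain an asymptotic path for the value infinity.\<close>
lemma bounded_outside_pole_discs:
  fixes f :: "complex \<Rightarrow> complex"
  assumes noasym: "\<not> infinity_asymptotic_value f"
    and S: "open S" and cl: "closure S \<inter> poles f = {}" and hol: "f holomorphic_on - poles f"
    and opP: "open (- poles f)"
    and R: "0 < R" "\<And>z. z \<in> frontier S \<Longrightarrow> norm (f z) \<le> R"
    and z1: "0 < d" "\<And>z. z \<in> ball z1 d \<Longrightarrow> z \<in> S \<Longrightarrow> norm (f z) \<le> R"
    and z: "z \<in> S"
  shows "norm (f z) \<le> R"
proof (rule ccontr)
  assume gt: "\<not> norm (f z) \<le> R"
  define Om where "Om L = {z\<in>S. L < norm (f z)}" for L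
  have clP: "closure S \<subseteq> - poles f" using cl by auto
  have contcl: "continuous_on (closure S) f"
    using holomorphic_on_imp_continuous_on[OF hol] clP by (rule continuous_on_subset)
  have contS: "continuous_on S f" using contcl closure_subset by (rule continuous_on_subset)
  have opOm: "open (Om L)" for L
  proof -
    have "open (S \<inter> f -` (- cball 0 L))"
      using contS S by (intro continuous_open_preimage) auto
    moreover have "S \<inter> f -` (- cball 0 L) = Om L" by (auto simp: Om_def)
    ultimately show ?thesis by simp
  qed
  \<comment> \<open>On a component of \<open>Om L\<close> the function is unbounded: otherwise
    \<open>maximum_modulus_unbounded\<close>, with boundary values at most \<open>L\<close>, would
    give \<open>norm (f u) \<le> L\<close> at a point of \<open>Om L\<close>. The disc about
    \<open>z1\<close> lies off the component because \<open>norm (f z) \<le> R \<le> L\<close> on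
    its part in \<open>S\<close>.\<close>
  have unb: "\<exists>v\<in>connected_component_set (Om L) u. B < norm (f v)"
    if u: "u \<in> Om L" and L: "R \<le> L" for u L B
  proof (rule ccontr)
    let ?U = "connected_component_set (Om L) u"
    assume "\<not> (\<exists>v\<in>?U. B < norm (f v))"
    then have B: "norm (f v) \<le> B" if "v \<in> ?U" for v using that by (auto simp: not_less)
    have opU: "open ?U" using opOm by (rule open_connected_component)
    have sub: "?U \<subseteq> Om L" by (rule connected_component_subset)
    have subS: "?U \<subseteq> S" using sub by (auto simp: Om_def)
    have "norm (f u) \<le> L"
    proof (rule maximum_modulus_unbounded[OF opU, where f = f and w = u and K = B and d = d and ?z1.0 = z1])
      show "f holomorphic_on ?U"
        using subS clP closure_subset[of S] by (intro holomorphic_on_subset[OF hol]) auto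
      show "continuous_on (closure ?U) f"
        using closure_mono[OF subS] by (rule continuous_on_subset[OF contcl])
      show "ball z1 d \<inter> ?U = {}" using sub z1(2) L by (force simp: Om_def)
      show "u \<in> ?U" using u by (simp add: connected_component_refl)
      fix v assume v: "v \<in> frontier ?U"
      then have vcl: "v \<in> closure ?U" "v \<notin> ?U" unfolding frontier_def interior_open[OF opU] by auto
      have vS: "v \<in> closure S" using vcl closure_mono[OF subS] by auto
      show "norm (f v) \<le> L"
      proof (cases "v \<in> S")
        case True
        show ?thesis
        proof (rule ccontr)
          assume "\<not> norm (f v) \<le> L"
          then have vO: "v \<in> Om L" using True by (simp add: Om_def)
          \<comment> \<open>A boundary point of the component inside \<open>Om L\<close> would have
            an open component of its own that meets it, hence would belong to it.\<close>
          have "open (connected_component_set (Om L) v)" using opOm by (rule open_connected_component)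
          note open_Int_closure_eq_empty[OF this, of ?U]
          moreover have vv: "v \<in> connected_component_set (Om L) v"
            using vO by (simp add: connected_component_refl)
          ultimately have "connected_component_set (Om L) v \<inter> ?U \<noteq> {}"
            using vcl(1) by blast
          then have "connected_component_set (Om L) v = ?U"
            using connected_component_nonoverlap[of "Om L" v u] by auto
          then show False using vv vcl by blast
        qed
      next
        case False
        then have "v \<in> frontier S" using vS S by (simp add: frontier_def interior_open)
        then show ?thesis using R L by force
      qed
    qed (use B R L z1(1) in auto)
    then show False using u by (simp add: Om_def)
  qed
  define next_pt where "next_pt k u = (SOME v. v \<in> connected_component_set (Om (R + real k)) u \<and>
      v \<in> Om (R + real (Suc k)))" for k u
  have nx: "next_pt k u \<in> connected_component_set (Om (R + real k)) u \<and> next_pt k u \<in> Om (R + real (Suc k))"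
    if u: "u \<in> Om (R + real k)" for k u
  proof -
    obtain v where v: "v \<in> connected_component_set (Om (R + real k)) u" "R + real (Suc k) < norm (f v)"
      using unb[OF u, of "R + real (Suc k)"] by auto
    then have "v \<in> Om (R + real (Suc k))"
      using connected_component_subset[of "Om (R + real k)" u] by (auto simp: Om_def)
    then have "\<exists>v. v \<in> connected_component_set (Om (R + real k)) u \<and> v \<in> Om (R + real (Suc k))"
      using v(1) by blast
    from someI_ex[OF this] show ?thesis unfolding next_pt_def .
  qed
  define p where "p = rec_nat z next_pt"
  have p: "p k \<in> Om (R + real k)" for k
  proof (induction k)
    case 0 then show ?case using z gt by (simp add: p_def Om_def)
  next
    case (Suc k) then show ?case using nx[of "p k" k] by (simp add: p_def)
  qed
  have "\<exists>g. path g \<and> path_image g \<subseteq> Om (R + real k) \<and> pathstart g = p k \<and> pathfinish g = p (Suc k)" for k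
  proof -
    let ?U = "connected_component_set (Om (R + real k)) (p k)"
    have "path_connected ?U"
      using opOm by (intro connected_open_path_connected open_connected_component) auto
    moreover have "p k \<in> ?U" using p by (simp add: connected_component_refl)
    moreover have "p (Suc k) \<in> ?U" using nx[OF p] by (simp add: p_def)
    ultimately obtain g where "path g" "path_image g \<subseteq> ?U" "pathstart g = p k" "pathfinish g = p (Suc k)"
      unfolding path_connected_def by blast
    then show ?thesis using connected_component_subset[of "Om (R + real k)" "p k"] by blast
  qed
  then obtain g where g: "\<And>k. path (g k)" "\<And>k. path_image (g k) \<subseteq> Om (R + real k)"
    "\<And>k. pathstart (g k) = p k" "\<And>k. pathfinish (g k) = p (Suc k)"
    by metis
  define h where "h t = g (nat \<lfloor>t\<rfloor>) (t - of_int \<lfloor>t\<rfloor>)" for t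
  have hc: "continuous_on {0..} h"
    unfolding h_def using g by (intro continuous_on_nat_pieces) (auto simp: pathstart_def pathfinish_def)
  have hO: "h t \<in> Om (R + real (nat \<lfloor>t\<rfloor>))" for t
  proof -
    have "t - of_int \<lfloor>t\<rfloor> \<in> {0..1}" by (auto; linarith)
    then have "h t \<in> path_image (g (nat \<lfloor>t\<rfloor>))" unfolding h_def path_image_def by blast
    then show ?thesis using g(2) by blast
  qed
  have big: "t - 1 \<le> norm (f (h t))" for t
  proof -
    have "R + real (nat \<lfloor>t\<rfloor>) < norm (f (h t))" using hO[of t] by (simp add: Om_def)
    moreover have "t - 1 \<le> real (nat \<lfloor>t\<rfloor>)" by linarith
    ultimately show ?thesis using R by linarith
  qed
  have hS: "h t \<in> S" for t using hO[of t] by (simp add: Om_def)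
  have "infinity_asymptotic_value f"
    unfolding infinity_asymptotic_value_def
  proof (intro exI[of _ h] conjI allI impI hc)
    show "h t \<notin> poles f" for t using hS[of t] closure_subset[of S] clP by auto
    show "filterlim (\<lambda>t. f (h t)) at_infinity at_top"
      unfolding filterlim_at_infinity[OF order_refl]
    proof (intro allI impI)
      fix r :: real
      show "\<forall>\<^sub>F t in at_top. r \<le> norm (f (h t))"
        using eventually_ge_at_top[of "r + 1"] by eventually_elim (use big in \<open>smt (verit)\<close>)
    qed
    \<comment> \<open>The closure of \<open>S\<close> avoids the poles, so \<open>f\<close> is
      bounded on its compact parts; since \<open>f\<close> tends to infinity along \<open>h\<close>,
      the path must leave each of them.\<close>
    show "filterlim h at_infinity at_top"
      unfolding filterlim_at_infinity[OF order_refl]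
    proof (intro allI impI)
      fix r :: real
      have "compact (closure S \<inter> cball 0 r)" by (intro closed_Int_compact) auto
      then have "compact (f ` (closure S \<inter> cball 0 r))"
        using contcl by (intro compact_continuous_image continuous_on_subset[OF contcl]) auto
      then have "bounded (f ` (closure S \<inter> cball 0 r))" by (rule compact_imp_bounded)
      then obtain B where B: "\<And>v. v \<in> closure S \<inter> cball 0 r \<Longrightarrow> norm (f v) \<le> B"
        unfolding bounded_iff by blast
      show "\<forall>\<^sub>F t in at_top. r \<le> norm (h t)"
        using eventually_ge_at_top[of "B + 2"]
      proof eventually_elim
        case (elim t)
        have "B < norm (f (h t))" using big[of t] elim by linarith
        then have "h t \<notin> closure S \<inter> cball 0 r" using B by force
        then show ?case using hS[of t] closure_subset[of S] by auto
      qed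
    qed
  qed
  then show False using noasym by blast
qed

section \<open>Charts and inverse branches at a pole\<close>

text \<open>The function \<open>1 / (f z * (z - a) ^ m)\<close> is bounded and bounded away from 0,
  so it extends over \<open>a\<close> without zeros and has a holomorphic \<open>m\<close>-th root;
  \<open>\<psi>\<close> is \<open>z - a\<close> times the normalised root \<open>q\<close>. Since
  \<open>q\<close> has modulus between \<open>1 / C\<close> and \<open>C\<close> and varies slowly
  on a small disc, \<open>\<psi>\<close> is a perturbation of a linear map.\<close>

lemma pole_chart:
  fixes f :: "complex \<Rightarrow> complex" and m :: nat
  assumes hol: "f holomorphic_on (ball a D - {a})" and D: "0 < D" and C: "1 \<le> C" and A: "0 < A" and m: "1 \<le> m"
    and lo: "\<And>z. z \<in> ball a D - {a} \<Longrightarrow> A / norm (z - a) ^ m / C \<le> norm (f z)"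
    and up: "\<And>z. z \<in> ball a D - {a} \<Longrightarrow> norm (f z) \<le> C * (A / norm (z - a) ^ m)"
    and r: "0 < r" "r \<le> D / (4 * C\<^sup>2)"
  shows "\<exists>\<psi>. (\<forall>z\<in>ball a r - {a}. f z * (of_real (A powr (- 1 / real m)) * \<psi> z) ^ m = 1) \<and> \<psi> a = 0 \<and>
    (\<forall>z\<in>ball a r. \<forall>z'\<in>ball a r. norm (z - z') \<le> 2 * C * norm (\<psi> z - \<psi> z') \<and>
       norm (\<psi> z - \<psi> z') \<le> 2 * C * norm (z - z')) \<and> ball 0 (r / C) \<subseteq> \<psi> ` ball a r"
proof -
  define \<sigma> where "\<sigma> = A powr (- 1 / real m)"
  have \<sigma>: "0 < \<sigma>" using A by (simp add: \<sigma>_def)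
  have \<sigma>m: "\<sigma> ^ m = 1 / A"
    using A m powr_realpow[OF \<sigma>, of m] by (simp add: \<sigma>_def powr_powr powr_neg_one)
  have C0: "0 < C" using C by simp
  have fne: "f z \<noteq> 0" if "z \<in> ball a D - {a}" for z
  proof -
    have "0 < A / norm (z - a) ^ m / C" using that A C0 by simp
    then show ?thesis using lo[OF that] by auto
  qed
  let ?h = "\<lambda>z. 1 / (f z * (z - a) ^ m)"
  have hn: "norm (?h z) \<le> C / A \<and> 1 / (C * A) \<le> norm (?h z)" if z: "z \<in> ball a D - {a}" for z
  proof -
    have p: "0 < norm (z - a) ^ m" using z by simp
    have f0: "0 < norm (f z)" using fne[OF z] by simp
    have 1: "A / C \<le> norm (f z) * norm (z - a) ^ m" "norm (f z) * norm (z - a) ^ m \<le> C * A"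
      using lo[OF z] up[OF z] p C0 by (simp_all add: field_simps)
    have q: "0 < norm (f z) * norm (z - a) ^ m" using p f0 by simp
    have "1 / (norm (f z) * norm (z - a) ^ m) \<le> 1 / (A / C)"
      using 1 A C0 q by (intro divide_left_mono) auto
    moreover have "1 / (C * A) \<le> 1 / (norm (f z) * norm (z - a) ^ m)"
      using 1 A C0 q by (intro divide_left_mono) auto
    ultimately show ?thesis by (simp add: norm_divide norm_mult norm_power)
  qed
  have hhol: "?h holomorphic_on ball a D - {a}"
    using fne by (intro holomorphic_intros hol) auto
  have ev: "eventually (\<lambda>z. z \<in> ball a D - {a}) (at a)"
    using D by (intro eventually_at_in_open) auto
  have "\<exists>B. eventually (\<lambda>z. norm (?h z) \<le> B) (at a)"
    using ev hn by (intro exI[of _ "C / A"]) (auto elim!: eventually_mono)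
  then have "\<exists>H. H holomorphic_on ball a D \<and> (\<forall>z\<in>ball a D - {a}. H z = ?h z)"
    using holomorphic_on_extend_bounded[OF hhol] D by simp
  then obtain H where H: "H holomorphic_on ball a D" "\<And>z. z \<in> ball a D - {a} \<Longrightarrow> H z = ?h z" by blast
  have "isCont H a"
    using holomorphic_on_imp_continuous_on[OF H(1)] D by (simp add: continuous_on_eq_continuous_at)
  then have lim: "((\<lambda>z. norm (H z)) \<longlongrightarrow> norm (H a)) (at a)"
    by (intro tendsto_norm) (simp add: isCont_def)
  have Hn: "norm (H z) \<le> C / A \<and> 1 / (C * A) \<le> norm (H z)" if "z \<in> ball a D" for z
  proof (cases "z = a")
    case True
    have "norm (H a) \<le> C / A"
    proof (rule tendsto_upperbound[OF lim])
      show "\<forall>\<^sub>F z in at a. norm (H z) \<le> C / A" using ev by eventually_elim (use hn H(2) in auto)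
    qed simp
    moreover have "1 / (C * A) \<le> norm (H a)"
    proof (rule tendsto_lowerbound[OF lim])
      show "\<forall>\<^sub>F z in at a. 1 / (C * A) \<le> norm (H z)" using ev by eventually_elim (use hn H(2) in auto)
    qed simp
    ultimately show ?thesis using True by simp
  next
    case False
    then show ?thesis using hn[of z] H(2)[of z] that by auto
  qed
  have Hne: "H z \<noteq> 0" if "z \<in> ball a D" for z
  proof -
    have "0 < 1 / (C * A)" using C0 A by simp
    then show ?thesis using Hn[OF that] by auto
  qed
  obtain l where l: "l holomorphic_on ball a D" "\<And>z. z \<in> ball a D \<Longrightarrow> exp (l z) = H z"
    using holomorphic_logarithm_exists[of "ball a D" H a] H(1) Hne D by auto
  \<comment> \<open>Dividing by \<open>\<sigma> = A powr (- 1 / real m)\<close> removes the size of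
    \<open>f\<close>, so that the bounds on \<open>q\<close> depend on \<open>C\<close> alone and
    not on the pole.\<close>
  define q where "q z = exp (l z / of_nat m) / of_real \<sigma>" for z
  have qhol: "q holomorphic_on ball a D"
    unfolding q_def using l(1) m \<sigma> by (intro holomorphic_intros) auto
  have qm: "(of_real \<sigma> * q z) ^ m = H z" if "z \<in> ball a D" for z
    using l(2)[OF that] m \<sigma> by (simp add: q_def exp_of_nat_mult[symmetric])
  \<comment> \<open>The power \<open>norm (q z) ^ m\<close> lies between \<open>1 / C\<close> and
    \<open>C\<close>; as \<open>1 \<le> C\<close> and \<open>1 \<le> m\<close>, its
    \<open>m\<close>-th root stays in the same interval.\<close>
  have qn: "norm (q z) \<le> C \<and> 1 / C \<le> norm (q z)" if z: "z \<in> ball a D" for z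
  proof -
    have "norm (H z) = (\<sigma> * norm (q z)) ^ m"
      using qm[OF z] \<sigma> by (metis norm_mult norm_of_real norm_power abs_of_pos)
    then have e: "norm (q z) ^ m = A * norm (H z)"
      using \<sigma>m A by (simp add: power_mult_distrib)
    have u: "norm (q z) ^ m \<le> C" and v: "1 / C \<le> norm (q z) ^ m"
      using Hn[OF z] A C0 unfolding e by (simp_all add: field_simps)
    have "norm (q z) \<le> C"
    proof (rule ccontr)
      assume n: "\<not> norm (q z) \<le> C"
      then have "norm (q z) ^ 1 \<le> norm (q z) ^ m" using C m by (intro power_increasing) auto
      then show False using n u by simp
    qed
    moreover have "1 / C \<le> norm (q z)"
    proof (rule ccontr)
      assume n: "\<not> 1 / C \<le> norm (q z)"
      have "1 / C \<le> 1" using C by simp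
      then have "norm (q z) ^ m \<le> norm (q z) ^ 1" using n m by (intro power_decreasing) auto
      then show False using n v by simp
    qed
    ultimately show ?thesis ..
  qed
  have rD: "r \<le> D / 4"
  proof -
    have "1 \<le> C\<^sup>2" using C by (simp add: one_le_power)
    then have "D / (4 * C\<^sup>2) \<le> D / (4 * 1)" using D by (intro divide_left_mono mult_left_mono) auto
    then show ?thesis using r by simp
  qed
  have qlip: "norm (q z - q z') \<le> 2 * C / D * norm (z - z')" if "z \<in> ball a (D/2)" "z' \<in> ball a (D/2)" for z z'
  proof (rule field_differentiable_bound[OF _ _ _ that])
    show "convex (ball a (D/2))" by simp
    fix x assume x: "x \<in> ball a (D/2)"
    have sub: "cball x (D/2) \<subseteq> ball a D"
    proof
      fix y assume "y \<in> cball x (D/2)"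
      then show "y \<in> ball a D" using x dist_triangle[of a y x] by auto
    qed
    have xin: "x \<in> ball a D" using x D by auto
    show "(q has_field_derivative deriv q x) (at x within ball a (D/2))"
      by (rule has_field_derivative_at_within[OF holomorphic_derivI[OF qhol open_ball xin]])
    have "norm ((deriv ^^ 1) q x) \<le> fact 1 * C / (D/2) ^ 1"
    proof (rule Cauchy_inequality)
      show "q holomorphic_on ball x (D/2)"
        using sub by (intro holomorphic_on_subset[OF qhol]) auto
      show "continuous_on (cball x (D/2)) q"
        using sub by (intro continuous_on_subset[OF holomorphic_on_imp_continuous_on[OF qhol]])
      show "norm (q y) \<le> C" if "norm (x - y) = D / 2" for y
        using qn[of y] sub that by (auto simp: subset_iff dist_norm)
    qed (use D in auto)
    then show "norm (deriv q x) \<le> 2 * C / D" by (simp add: field_simps)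
  qed
  define \<psi> where "\<psi> z = (z - a) * q z" for z
  have sub: "ball a r \<subseteq> ball a (D/2)" "ball a r \<subseteq> ball a D" "cball a r \<subseteq> ball a D" using rD D r by auto
  have chi: "norm (z - z') \<le> 2 * C * norm (\<psi> z - \<psi> z') \<and> norm (\<psi> z - \<psi> z') \<le> 2 * C * norm (z - z')"
    if z: "z \<in> ball a r" "z' \<in> ball a r" for z z'
  proof -
    have eq: "\<psi> z - \<psi> z' = q z * (z - z') + (z' - a) * (q z - q z')" by (simp add: \<psi>_def algebra_simps)
    have ql: "norm (q z - q z') \<le> 2 * C / D * norm (z - z')"
      by (rule qlip) (use z sub(1) in blast)+
    have za: "norm (z' - a) \<le> r" using z by (simp add: dist_norm norm_minus_commute)
    \<comment> \<open>This is where \<open>r \<le> D / (4 * C\<^sup>2)\<close> comes from: the error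
      caused by the variation of \<open>q\<close> becomes at most half of the lower bound
      \<open>norm (z - z') / C\<close> of the main term.\<close>
    have "norm ((z' - a) * (q z - q z')) \<le> r * (2 * C / D * norm (z - z'))"
      unfolding norm_mult by (rule mult_mono[OF za ql]) (use r in auto)
    also have "\<dots> \<le> D / (4 * C\<^sup>2) * (2 * C / D * norm (z - z'))"
      using r D C0 by (intro mult_right_mono) auto
    also have "\<dots> = norm (z - z') / (2 * C)"
      using D C0 by (simp add: field_simps power2_eq_square)
    finally have small: "norm ((z' - a) * (q z - q z')) \<le> norm (z - z') / (2 * C)" .
    have qz: "norm (q z) \<le> C" "1 / C \<le> norm (q z)" using qn[of z] z sub by auto
    have "norm (z - z') / C \<le> norm (q z * (z - z'))"
      unfolding norm_mult using mult_right_mono[OF qz(2), of "norm (z - z')"] by simp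
    moreover have "norm (q z * (z - z')) \<le> C * norm (z - z')"
      unfolding norm_mult using qz by (intro mult_right_mono) auto
    moreover have "norm (q z * (z - z')) \<le> norm (\<psi> z - \<psi> z') + norm ((z' - a) * (q z - q z'))"
      unfolding eq using norm_triangle_ineq4[of "q z * (z - z') + (z' - a) * (q z - q z')" "(z' - a) * (q z - q z')"] by simp
    moreover have "norm (\<psi> z - \<psi> z') \<le> norm (q z * (z - z')) + norm ((z' - a) * (q z - q z'))"
      unfolding eq by (rule norm_triangle_ineq)
    ultimately have 1: "norm (z - z') / C - norm (z - z') / (2 * C) \<le> norm (\<psi> z - \<psi> z')"
      and 2: "norm (\<psi> z - \<psi> z') \<le> C * norm (z - z') + norm (z - z') / (2 * C)"
      using small by linarith+
    have "norm (z - z') / (2 * C) \<le> C * norm (z - z')"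
    proof -
      have "1 / (2 * C) \<le> C"
        using C mult_mono[OF C C] by (simp add: divide_le_eq)
      from mult_right_mono[OF this, of "norm (z - z')"] show ?thesis by simp
    qed
    then have "norm (\<psi> z - \<psi> z') \<le> 2 * C * norm (z - z')" using 2 by linarith
    moreover have "norm (z - z') / (2 * C) \<le> norm (\<psi> z - \<psi> z')" using 1 C0 by (simp add: field_simps)
    then have "norm (z - z') \<le> 2 * C * norm (\<psi> z - \<psi> z')" using C0 by (simp add: field_simps)
    ultimately show ?thesis by simp
  qed
  have chihol: "\<psi> holomorphic_on ball a D" unfolding \<psi>_def by (intro holomorphic_intros qhol)
  have inj: "inj_on \<psi> (ball a r)"
  proof (rule inj_onI)
    fix z z' assume "z \<in> ball a r" "z' \<in> ball a r" "\<psi> z = \<psi> z'"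
    then show "z = z'" using chi[of z z'] by simp
  qed
  have "ball (\<psi> a) (r / C) \<subseteq> \<psi> ` ball a r"
  proof (rule ball_subset_open_map_image)
    show "continuous_on (closure (ball a r)) \<psi>"
      using holomorphic_on_imp_continuous_on[OF chihol] sub r by (auto intro: continuous_on_subset)
    show "open (\<psi> ` interior (ball a r))"
      using open_mapping_thm3[OF holomorphic_on_subset[OF chihol sub(2)] _ inj] by (simp add: interior_open)
    fix z assume "z \<in> frontier (ball a r)"
    then have z: "norm (z - a) = r" using r by (simp add: frontier_ball dist_norm norm_minus_commute)
    then have "z \<in> ball a D" using sub(3) by (auto simp: subset_iff dist_norm norm_minus_commute)
    then have "r * (1 / C) \<le> norm (z - a) * norm (q z)" unfolding z using qn[of z] r by (intro mult_left_mono) auto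
    then show "r / C \<le> norm (\<psi> z - \<psi> a)" by (simp add: \<psi>_def norm_mult)
  qed (use r C0 in auto)
  moreover have "f z * (of_real \<sigma> * \<psi> z) ^ m = 1" if z: "z \<in> ball a r - {a}" for z
  proof -
    have zD: "z \<in> ball a D - {a}" using z sub by auto
    have "(of_real \<sigma> * \<psi> z) ^ m = (z - a) ^ m * (of_real \<sigma> * q z) ^ m"
      unfolding \<psi>_def by (simp add: power_mult_distrib mult_ac)
    also have "\<dots> = (z - a) ^ m * ?h z" using qm[of z] H(2)[OF zD] zD by simp
    finally show ?thesis using fne[OF zD] zD by simp
  qed
  moreover have "\<psi> a = 0" by (simp add: \<psi>_def)
  ultimately show ?thesis
    unfolding \<sigma>_def[symmetric] using chi by (intro exI[of _ \<psi>]) auto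
qed

section \<open>Roots and inverse branches near a pole\<close>

lemma norm_power_diff_le:
  fixes x y :: complex
  assumes "norm x \<le> B" "norm y \<le> B"
  shows "norm (x ^ m - y ^ m) \<le> real m * B ^ (m - 1) * norm (x - y)"
proof (rule field_differentiable_bound[where S = "cball 0 B" and f' = "\<lambda>z. of_nat m * z ^ (m - 1)"])
  show "((\<lambda>x. x ^ m) has_field_derivative of_nat m * z ^ (m - 1)) (at z within cball 0 B)" for z :: complex
    by (auto intro!: derivative_eq_intros)
  show "norm (of_nat m * z ^ (m - 1)) \<le> real m * B ^ (m - 1)" if "z \<in> cball 0 B" for z :: complex
    using that by (auto simp: norm_mult norm_power intro!: mult_left_mono power_mono)
qed (use assms in auto)

lemma norm_root_of_unity:
  fixes \<xi> :: complex
  assumes "1 \<le> m" "\<xi> ^ m = 1"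
  shows "norm \<xi> = 1"
proof -
  have "norm \<xi> ^ m = 1 ^ m" using assms(2) by (simp add: norm_power[symmetric])
  then show ?thesis using assms(1) by (intro power_eq_imp_eq_base[of "norm \<xi>" m 1]) auto
qed

text \<open>For \<open>w\<close> near \<open>b\<close> the quotient \<open>w / b\<close> avoids the
  negative real axis, so the principal logarithm gives a branch of the \<open>m\<close>-th root of
  \<open>1 / w\<close>. Its derivative has modulus at most
  \<open>norm w powr (- 1 - 1 / real m)\<close>, and passing from \<open>w\<close> to
  \<open>b\<close> costs \<open>2 powr (1 + 1 / real m) \<le> 4\<close>.\<close>

lemma root_branch:
  fixes b :: complex and m :: nat
  assumes m: "1 \<le> m" and b: "2 * \<delta> \<le> norm b" "b \<noteq> 0"
  shows "\<exists>h. \<forall>w\<in>ball b \<delta>. h w ^ m = 1 / w \<and>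
    (\<forall>w'\<in>ball b \<delta>. norm (h w - h w') \<le> 4 * norm b powr (- 1 - 1 / real m) * norm (w - w'))"
proof -
  obtain e where e: "e ^ m = 1 / b"
  proof -
    have "exp (Ln (1 / b) / of_nat m) ^ m = 1 / b"
      using m b by (simp add: exp_of_nat_mult[symmetric])
    then show ?thesis using that by blast
  qed
  define h where "h w = e * exp (- Ln (w / b) / of_nat m)" for w
  have half: "norm b / 2 < norm w" if "w \<in> ball b \<delta>" for w
    using that b norm_triangle_ineq2[of b w] by (auto simp: dist_norm)
  have wne: "w \<noteq> 0" if "w \<in> ball b \<delta>" for w using half[OF that] by auto
  have nonpos: "w / b \<notin> \<real>\<^sub>\<le>\<^sub>0" if "w \<in> ball b \<delta>" for w
  proof
    assume "w / b \<in> \<real>\<^sub>\<le>\<^sub>0"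
    then obtain s where s: "w / b = of_real s" "s \<le> 0" by (auto elim: nonpos_Reals_cases)
    have "norm (b - w) = norm b * norm (1 - w / b)"
      using b by (simp add: norm_mult[symmetric] right_diff_distrib)
    also have "1 - w / b = of_real (1 - s)" using s by simp
    also have "norm (of_real (1 - s) :: complex) = 1 - s" using s by (simp only: norm_of_real)
    also have "norm b * (1 - s) \<ge> norm b * 1" using s by (intro mult_left_mono) auto
    finally have "norm b \<le> norm (b - w)" by simp
    then show False using that b norm_ge_zero[of b] unfolding mem_ball dist_norm by linarith
  qed
  have hm: "h w ^ m = 1 / w" if "w \<in> ball b \<delta>" for w
  proof -
    have "h w ^ m = e ^ m * exp (- Ln (w / b))"
      using m by (simp add: h_def power_mult_distrib exp_of_nat_mult[symmetric])
    also have "exp (- Ln (w / b)) = b / w"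
      using wne[OF that] b by (simp add: exp_minus)
    finally show ?thesis using e b by simp
  qed
  have hn: "norm (h w) = norm w powr (- 1 / real m)" if w: "w \<in> ball b \<delta>" for w
  proof -
    have n: "norm (h w) ^ m = 1 / norm w" using hm[OF w] by (metis norm_power norm_divide norm_one)
    have "norm (h w) \<noteq> 0" using hm[OF w] wne[OF w] m by (cases m) auto
    then have "norm (h w) = (norm (h w) powr real m) powr (1 / real m)"
      using m by (simp add: powr_powr)
    also have "norm (h w) powr real m = norm (h w) ^ m" using \<open>norm (h w) \<noteq> 0\<close> by (simp add: powr_realpow)
    also have "(norm (h w) ^ m) powr (1 / real m) = norm w powr (- 1 / real m)"
      unfolding n using wne[OF w] by (simp add: powr_divide powr_minus_divide)
    finally show ?thesis .
  qed
  have "norm (h w - h w') \<le> 4 * norm b powr (- 1 - 1 / real m) * norm (w - w')"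
    if "w \<in> ball b \<delta>" "w' \<in> ball b \<delta>" for w w'
  proof (rule field_differentiable_bound[OF _ _ _ that, where f' = "\<lambda>w. - h w / (of_nat m * w)"])
    fix x assume x: "x \<in> ball b \<delta>"
    show "(h has_field_derivative - h x / (of_nat m * x)) (at x within ball b \<delta>)"
      unfolding h_def using nonpos[OF x] wne[OF x] b m
      by (auto intro!: derivative_eq_intros simp: field_simps)
    have xpos: "0 < norm x" using wne[OF x] by simp
    have "norm (- h x / (of_nat m * x)) = norm x powr (- 1 / real m) / (real m * norm x)"
      using hn[OF x] by (simp add: norm_divide norm_mult)
    also have "\<dots> \<le> norm x powr (- 1 / real m) / (1 * norm x)"
      using m xpos by (intro divide_left_mono mult_right_mono) auto
    also have "\<dots> = norm x powr (- 1 - 1 / real m)"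
      using xpos by (simp add: powr_diff powr_minus_divide divide_inverse powr_neg_one mult.commute)
    also have "\<dots> \<le> (norm b / 2) powr (- 1 - 1 / real m)"
    proof (rule powr_mono2')
      have "0 \<le> 1 / real m" by simp
      then show "- 1 - 1 / real m \<le> 0" by linarith
    qed (use half[OF x] b in auto)
    also have "\<dots> = norm b powr (- 1 - 1 / real m) * 2 powr (1 + 1 / real m)"
      using b by (simp add: powr_divide powr_minus_divide field_simps powr_diff powr_add)
    also have "\<dots> \<le> norm b powr (- 1 - 1 / real m) * 2 powr 2"
      using m by (intro mult_left_mono powr_mono) auto
    finally show "norm (- h x / (of_nat m * x)) \<le> 4 * norm b powr (- 1 - 1 / real m)"
      by (simp add: powr_numeral)
  qed simp
  then show ?thesis using hm by (intro exI[of _ h]) auto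
qed

text \<open>The branches are indexed by \<open>m\<close>-th roots of unity because in the chart the
  preimages of \<open>w\<close> are the multiples of one root by these numbers; the last clause says
  that the family is complete. The radius \<open>2 * r\<close> leaves room for a whole closed disc
  of radius \<open>r\<close> about a pole and, if \<open>b\<close> is an orbit point within
  \<open>r\<close> of a pole, for that pole.\<close>

definition inverse_branches ::
  "(complex \<Rightarrow> complex) \<Rightarrow> nat \<Rightarrow> complex \<Rightarrow> complex \<Rightarrow> real \<Rightarrow> real \<Rightarrow> (complex \<Rightarrow> complex \<Rightarrow> complex) \<Rightarrow> bool" where
  "inverse_branches f m a b r k g \<longleftrightarrow>
     (\<forall>\<xi>. \<xi> ^ m = 1 \<longrightarrow> (\<forall>w\<in>ball b (2 * r). g \<xi> w \<in> ball a r - {a} \<and> f (g \<xi> w) = w \<and>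
        (\<forall>w'\<in>ball b (2 * r). dist (g \<xi> w) (g \<xi> w') \<le> k * dist w w'))) \<and>
     (\<forall>z\<in>ball a r - {a}. f z \<in> ball b (2 * r) \<longrightarrow> (\<exists>\<zeta>. \<zeta> ^ m = 1 \<and> z = g \<zeta> (f z)))"

lemma
  assumes "inverse_branches f m a b r k g"
  shows inverse_branches_right_inverse: "\<And>\<xi> w. \<xi> ^ m = 1 \<Longrightarrow> w \<in> ball b (2 * r) \<Longrightarrow>
      g \<xi> w \<in> ball a r - {a} \<and> f (g \<xi> w) = w"
    and inverse_branches_lipschitz: "\<And>\<xi> w w'. \<xi> ^ m = 1 \<Longrightarrow> w \<in> ball b (2 * r) \<Longrightarrow> w' \<in> ball b (2 * r) \<Longrightarrow>
      dist (g \<xi> w) (g \<xi> w') \<le> k * dist w w'"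
    and inverse_branches_exhaust: "\<And>z. z \<in> ball a r - {a} \<Longrightarrow> f z \<in> ball b (2 * r) \<Longrightarrow>
      \<exists>\<zeta>. \<zeta> ^ m = 1 \<and> z = g \<zeta> (f z)"
  using assms unfolding inverse_branches_def by blast+

lemma inverse_branches_mono:
  assumes g: "inverse_branches f m a b r k g" and le: "k \<le> k'"
  shows "inverse_branches f m a b r k' g"
  unfolding inverse_branches_def
proof (intro conjI allI impI ballI)
  fix \<xi> w w' :: complex assume "\<xi> ^ m = 1" "w \<in> ball b (2 * r)" "w' \<in> ball b (2 * r)"
  from inverse_branches_lipschitz[OF g this]
  show "dist (g \<xi> w) (g \<xi> w') \<le> k' * dist w w'" using mult_right_mono[OF le, of "dist w w'"] by simp
qed (use inverse_branches_right_inverse[OF g] inverse_branches_exhaust[OF g] in blast)+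

text \<open>The output of \<open>pole_chart\<close>, with \<open>\<sigma>\<close> later equal to
  \<open>norm a powr (\<beta> / real m)\<close>. For poles outside the unit disc it is at least 1,
  so it only helps the contraction.\<close>

locale pole_chart_at =
  fixes f :: "complex \<Rightarrow> complex" and a :: complex and \<psi> :: "complex \<Rightarrow> complex"
    and \<sigma> C r :: real and m :: nat
  assumes m: "1 \<le> m" and C: "1 \<le> C" and \<sigma>: "1 \<le> \<sigma>" and r: "0 < r" "r \<le> 1"
    and psi_f: "\<And>z. z \<in> ball a r - {a} \<Longrightarrow> f z * (of_real \<sigma> * \<psi> z) ^ m = 1" and psi_a: "\<psi> a = 0"
    and psi_lo: "\<And>z z'. z \<in> ball a r \<Longrightarrow> z' \<in> ball a r \<Longrightarrow> norm (z - z') \<le> 2 * C * norm (\<psi> z - \<psi> z')"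
    and psi_up: "\<And>z z'. z \<in> ball a r \<Longrightarrow> z' \<in> ball a r \<Longrightarrow> norm (\<psi> z - \<psi> z') \<le> 2 * C * norm (z - z')"
    and psi_onto: "ball 0 (r / C) \<subseteq> \<psi> ` ball a r"
begin

lemma norm_f_eq: "z \<in> ball a r - {a} \<Longrightarrow> norm (f z) * (\<sigma> * norm (\<psi> z)) ^ m = 1"
  using psi_f[of z] \<sigma> by (metis norm_mult norm_one norm_power norm_of_real abs_of_nonneg order_trans zero_le_one)

lemma inj: "inj_on \<psi> (ball a r)"
  by (rule inj_onI) (use psi_lo in fastforce)

lemma dist_pole_le:
  assumes z: "z \<in> ball a r - {a}" and "1 \<le> norm (f z)"
  shows "norm (z - a) \<le> 2 * C / \<sigma>"
proof -
  have "(\<sigma> * norm (\<psi> z)) ^ m \<le> 1"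
    using norm_f_eq[OF z] assms(2) \<sigma> mult_right_mono[OF assms(2), of "(\<sigma> * norm (\<psi> z)) ^ m"] by simp
  then have "\<sigma> * norm (\<psi> z) \<le> 1"
    using m \<sigma> power_le_one_iff[of "\<sigma> * norm (\<psi> z)" m] by auto
  then have "norm (\<psi> z) \<le> 1 / \<sigma>" using \<sigma> by (simp add: field_simps)
  moreover have "norm (z - a) \<le> 2 * C * norm (\<psi> z)" using psi_lo[of z a] z r psi_a by simp
  ultimately have "norm (z - a) \<le> 2 * C * (1 / \<sigma>)" using C by (smt (verit) mult_left_mono)
  then show ?thesis by simp
qed

text \<open>With \<open>u = \<sigma> * \<psi>\<close> the chart equation is
  \<open>f * u ^ m = 1\<close>, hence \<open>f z - f z' = f z * f z' * (u z' ^ m - u z ^ m)\<close>.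
  The two values of \<open>f\<close> give \<open>W\<^sup>2\<close> and the difference of powers
  gives \<open>W powr (- 1 + 1 / real m)\<close>, up to constants.\<close>

lemma expand:
  assumes z: "z \<in> ball a r - {a}" "z' \<in> ball a r - {a}" and W: "0 < W"
    and fz: "W / 2 \<le> norm (f z)" "norm (f z) \<le> 4 * W" "W / 2 \<le> norm (f z')" "norm (f z') \<le> 4 * W"
  shows "norm (f z - f z') \<le> 64 * real m * C * \<sigma> * W powr (1 + 1 / real m) * norm (z - z')"
proof -
  define u where "u z = of_real \<sigma> * \<psi> z" for z
  have uf: "f z * u z ^ m = 1" if "z \<in> ball a r - {a}" for z using psi_f[OF that] by (simp add: u_def)
  define B where "B = (W / 2) powr (- 1 / real m)"
  have ub: "norm (u x) \<le> B" if x: "x \<in> ball a r - {a}" "W / 2 \<le> norm (f x)" for x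
  proof -
    have "norm (f x) * norm (u x) ^ m = 1" using uf[OF x(1)] by (metis norm_mult norm_one norm_power)
    then have "W / 2 * norm (u x) ^ m \<le> 1"
      using mult_right_mono[OF x(2), of "norm (u x) ^ m"] by simp
    then have "norm (u x) ^ m \<le> 2 / W" using W by (simp add: field_simps)
    also have "2 / W = B ^ m"
    proof -
      have "B ^ m = B powr real m" using W by (intro powr_realpow[symmetric]) (simp add: B_def)
      also have "\<dots> = (W / 2) powr (- 1)" using m by (simp add: B_def powr_powr)
      finally show ?thesis using W by (simp add: powr_neg_one)
    qed
    finally show ?thesis using m by (subst (asm) power_mono_iff) (auto simp: B_def)
  qed
  have "norm (f z - f z') = norm (f z * f z' * (u z' ^ m - u z ^ m))"
  proof -
    have "f z * f z' * (u z' ^ m - u z ^ m) = f z * (f z' * u z' ^ m) - f z' * (f z * u z ^ m)"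
      by (simp add: algebra_simps)
    then show ?thesis using uf z by simp
  qed
  also have "\<dots> = norm (f z) * norm (f z') * norm (u z' ^ m - u z ^ m)" by (simp add: norm_mult)
  also have "\<dots> \<le> (4 * W) * (4 * W) * (real m * B ^ (m - 1) * norm (u z' - u z))"
    using fz W ub z by (intro mult_mono norm_power_diff_le) auto
  also have "\<dots> \<le> (4 * W) * (4 * W) * (real m * B ^ (m - 1) * (\<sigma> * (2 * C * norm (z - z'))))"
  proof -
    have "norm (u z' - u z) = \<sigma> * norm (\<psi> z' - \<psi> z)"
      using \<sigma> by (simp add: u_def right_diff_distrib[symmetric] norm_mult)
    also have "\<dots> \<le> \<sigma> * (2 * C * norm (z - z'))"
      using psi_up[of z' z] z \<sigma> by (intro mult_left_mono) (auto simp: norm_minus_commute)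
    finally show ?thesis using W by (intro mult_left_mono) (auto simp: B_def)
  qed
  also have "B ^ (m - 1) = (W / 2) powr (- 1 + 1 / real m)"
  proof -
    have "B ^ (m - 1) = B powr real (m - 1)" using W by (intro powr_realpow[symmetric]) (simp add: B_def)
    also have "\<dots> = (W / 2) powr ((- 1 / real m) * real (m - 1))" by (simp only: B_def powr_powr)
    also have "(- 1 / real m) * real (m - 1) = - 1 + 1 / real m" using m by (simp add: of_nat_diff field_simps)
    finally show ?thesis .
  qed
  also have "(4 * W) * (4 * W) * (real m * (W / 2) powr (- 1 + 1 / real m) * (\<sigma> * (2 * C * norm (z - z'))))
      = 16 * (2 * real m * C * \<sigma> * norm (z - z')) * (W * W * (W / 2) powr (- 1 + 1 / real m))"
    by (simp add: algebra_simps)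
  also have "\<dots> \<le> 16 * (2 * real m * C * \<sigma> * norm (z - z')) * (2 * W powr (1 + 1 / real m))"
  proof (intro mult_left_mono)
    have "(W / 2) powr (- 1 + 1 / real m) = W powr (- 1 + 1 / real m) * 2 powr (1 - 1 / real m)"
      using W by (simp add: powr_divide powr_minus_divide powr_diff powr_add field_simps)
    also have "\<dots> \<le> W powr (- 1 + 1 / real m) * 2 powr 1"
      using m by (intro mult_left_mono powr_mono) auto
    finally have "W * W * (W / 2) powr (- 1 + 1 / real m) \<le> W * W * (W powr (- 1 + 1 / real m) * 2)"
      using W by (intro mult_left_mono) auto
    also have "\<dots> = 2 * (W powr 2 * W powr (- 1 + 1 / real m))"
      using W by (simp add: powr_numeral power2_eq_square)
    also have "W powr 2 * W powr (- 1 + 1 / real m) = W powr (1 + 1 / real m)"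
      by (simp add: powr_add[symmetric])
    finally show "W * W * (W / 2) powr (- 1 + 1 / real m) \<le> 2 * W powr (1 + 1 / real m)" .
  qed (use \<sigma> C in auto)
  finally show ?thesis by (simp add: algebra_simps)
qed

text \<open>For large \<open>b\<close> the root \<open>h w\<close> has modulus below
  \<open>r / C\<close>, so its multiples by roots of unity, divided by \<open>\<sigma>\<close>, lie
  in the image of the chart and can be pulled back. The exponent \<open>M\<close> makes the
  threshold for \<open>norm b\<close> independent of the multiplicity.\<close>

lemma branches:
  assumes mM: "m \<le> M" and b: "8 * (C / r) ^ M \<le> norm b"
  shows "\<exists>g. inverse_branches f m a b r (8 * C / \<sigma> * norm b powr (- 1 - 1 / real m)) g"
proof -
  have Cr: "1 \<le> C / r" using C r by simp
  have Cr1: "1 \<le> (C / r) ^ M" using Cr by (rule one_le_power)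
  have b4: "2 * (2 * r) \<le> norm b" "b \<noteq> 0"
    using b Cr1 r by auto
  obtain h where h: "\<And>w. w \<in> ball b (2 * r) \<Longrightarrow> h w ^ m = 1 / w"
    "\<And>w w'. w \<in> ball b (2 * r) \<Longrightarrow> w' \<in> ball b (2 * r) \<Longrightarrow>
        norm (h w - h w') \<le> 4 * norm b powr (- 1 - 1 / real m) * norm (w - w')"
    using root_branch[OF m b4] by blast
  have half: "norm b / 2 < norm w" if "w \<in> ball b (2 * r)" for w
    using that b4 norm_triangle_ineq2[of b w] by (auto simp: dist_norm)
  have hsmall: "norm (h w) < r / C" if w: "w \<in> ball b (2 * r)" for w
  proof -
    have w0: "0 < norm w" using half[OF w] b4 by (smt (verit) divide_nonneg_nonneg norm_ge_zero)
    have "norm (h w) ^ m = 1 / norm w" using h(1)[OF w] by (metis norm_power norm_divide norm_one)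
    also have "\<dots> < 1 / (C / r) ^ M"
    proof -
      have "(C / r) ^ M < norm w" using half[OF w] b Cr1 by linarith
      moreover have "0 < (C / r) ^ M" using Cr1 by linarith
      ultimately show ?thesis using w0 by (intro divide_strict_left_mono mult_pos_pos) auto
    qed
    also have "\<dots> \<le> 1 / (C / r) ^ m"
      using Cr mM by (intro divide_left_mono power_increasing) auto
    also have "\<dots> = (r / C) ^ m" by (simp add: power_divide)
    finally show ?thesis by (rule power_less_imp_less_base) (use r C in auto)
  qed
  define g where "g \<xi> w = inv_into (ball a r) \<psi> (\<xi> * h w / of_real \<sigma>)" for \<xi> w
  have \<sigma>0: "0 < \<sigma>" using \<sigma> by simp
  have gin: "g \<xi> w \<in> ball a r" "\<psi> (g \<xi> w) = \<xi> * h w / of_real \<sigma>"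
    if \<xi>: "\<xi> ^ m = 1" and w: "w \<in> ball b (2 * r)" for \<xi> w
  proof -
    have "norm \<xi> = 1" by (rule norm_root_of_unity[OF m \<xi>])
    then have "norm (\<xi> * h w / of_real \<sigma>) = norm (h w) / \<sigma>"
      using \<sigma>0 by (simp add: norm_mult norm_divide)
    also have "\<dots> \<le> norm (h w) / 1" using \<sigma> by (intro divide_left_mono) auto
    also have "\<dots> < r / C" using hsmall[OF w] by simp
    finally have "\<xi> * h w / of_real \<sigma> \<in> \<psi> ` ball a r" using psi_onto by (auto simp: subset_iff)
    then show "g \<xi> w \<in> ball a r" "\<psi> (g \<xi> w) = \<xi> * h w / of_real \<sigma>"
      unfolding g_def by (rule inv_into_into, rule f_inv_into_f)
  qed
  show ?thesis
    unfolding inverse_branches_def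
  proof (intro exI[of _ g] allI impI conjI ballI)
    fix \<xi> w :: complex assume \<xi>: "\<xi> ^ m = 1" and w: "w \<in> ball b (2 * r)"
    have w0: "w \<noteq> 0" using half[OF w] by auto
    have h0: "h w \<noteq> 0" using h(1)[OF w] w0 m by (cases m) auto
    have \<xi>0: "\<xi> \<noteq> 0" using \<xi> m by (cases m) auto
    show ga: "g \<xi> w \<in> ball a r - {a}"
      using gin[OF \<xi> w] psi_a h0 \<xi>0 \<sigma>0 by auto
    have "f (g \<xi> w) * (\<xi> * h w) ^ m = 1" using psi_f[OF ga] gin(2)[OF \<xi> w] \<sigma>0 by simp
    then show "f (g \<xi> w) = w" using h(1)[OF w] \<xi> w0 by (simp add: power_mult_distrib)
    fix w' assume w': "w' \<in> ball b (2 * r)"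
    have n1: "norm \<xi> = 1" by (rule norm_root_of_unity[OF m \<xi>])
    have "dist (g \<xi> w) (g \<xi> w') \<le> 2 * C * norm (\<psi> (g \<xi> w) - \<psi> (g \<xi> w'))"
      unfolding dist_norm by (rule psi_lo[OF gin(1)[OF \<xi> w] gin(1)[OF \<xi> w']])
    also have "\<psi> (g \<xi> w) - \<psi> (g \<xi> w') = \<xi> * (h w - h w') / of_real \<sigma>"
      using gin(2)[OF \<xi> w] gin(2)[OF \<xi> w'] by (simp add: diff_divide_distrib right_diff_distrib)
    also have "norm \<dots> = norm (h w - h w') / \<sigma>" using n1 \<sigma>0 by (simp add: norm_mult norm_divide)
    also have "2 * C * (norm (h w - h w') / \<sigma>) \<le> 2 * C * (4 * norm b powr (- 1 - 1 / real m) * norm (w - w') / \<sigma>)"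
      using h(2)[OF w w'] \<sigma>0 C by (intro mult_left_mono divide_right_mono) auto
    finally show "dist (g \<xi> w) (g \<xi> w') \<le> 8 * C / \<sigma> * norm b powr (- 1 - 1 / real m) * dist w w'"
      by (simp add: dist_norm field_simps)
  next
    fix z assume z: "z \<in> ball a r - {a}" and fz: "f z \<in> ball b (2 * r)"
    have w0: "f z \<noteq> 0" using half[OF fz] by auto
    have h0: "h (f z) \<noteq> 0" using h(1)[OF fz] w0 m by (cases m) auto
    \<comment> \<open>The scaled chart value and the chosen root branch have the same
      \<open>m\<close>-th power \<open>1 / f z\<close>, so their quotient is the index of the branch
      through \<open>z\<close>.\<close>
    define \<zeta> where "\<zeta> = of_real \<sigma> * \<psi> z / h (f z)"
    have "\<zeta> ^ m = 1"
      using psi_f[OF z] h(1)[OF fz] w0 by (simp add: \<zeta>_def power_divide mult.commute)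
    moreover have "z = g \<zeta> (f z)"
      unfolding g_def \<zeta>_def using h0 \<sigma>0 z inv_into_f_f[OF inj, of z] by simp
    ultimately show "\<exists>\<zeta>. \<zeta> ^ m = 1 \<and> z = g \<zeta> (f z)" by blast
  qed
qed

end

section \<open>Null sets under holomorphic maps\<close>

lemma hausdorff_content_zero_local:
  assumes "\<And>x. x \<in> A \<Longrightarrow> \<exists>N. open N \<and> x \<in> N \<and> hausdorff_content s (A \<inter> N) = 0"
  shows "hausdorff_content s A = 0"
proof -
  let ?F = "{N. open N \<and> hausdorff_content s (A \<inter> N) = 0}"
  obtain F' where F': "F' \<subseteq> ?F" "countable F'" "\<Union>F' = \<Union>?F"
    using Lindelof[of ?F] by auto
  have "hausdorff_content s (\<Union>N\<in>F'. A \<inter> N) = 0"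
    using F' by (intro hausdorff_content_zero_UN) auto
  moreover have "A \<subseteq> (\<Union>N\<in>F'. A \<inter> N)"
  proof
    fix x assume x: "x \<in> A"
    then have "x \<in> \<Union>?F" using assms by blast
    then show "x \<in> (\<Union>N\<in>F'. A \<inter> N)" using x F'(3) by auto
  qed
  ultimately show ?thesis by (rule hausdorff_content_zero_subset)
qed

lemma hausdorff_content_countable_zero:
  assumes "countable A"
  shows "hausdorff_content s A = 0"
proof -
  have "hausdorff_content s {x} = 0" for x
    using hausdorff_content_le_diameter[of "{x}" "{x}" s] by simp
  then have "hausdorff_content s (\<Union>x\<in>A. {x}) = 0"
    using assms by (intro hausdorff_content_zero_UN) auto
  then show ?thesis by simp
qed

lemma holomorphic_locally_lipschitz:
  fixes g :: "complex \<Rightarrow> complex"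
  assumes hol: "g holomorphic_on S" and S: "open S" and x: "x \<in> S"
  shows "\<exists>e>0. \<exists>L. ball x e \<subseteq> S \<and> (\<forall>y\<in>ball x e. \<forall>z\<in>ball x e. dist (g y) (g z) \<le> L * dist y z)"
proof -
  obtain e where e: "0 < e" "cball x e \<subseteq> S" using S x open_contains_cball by blast
  have "continuous_on (cball x e) (deriv g)"
    by (rule holomorphic_on_imp_continuous_on[OF holomorphic_on_subset[OF holomorphic_deriv[OF hol S] e(2)]])
  then have "bounded (deriv g ` cball x e)"
    by (intro compact_imp_bounded compact_continuous_image) auto
  then obtain L where L: "\<And>y. y \<in> cball x e \<Longrightarrow> norm (deriv g y) \<le> L"
    unfolding bounded_iff by blast
  have "dist (g y) (g z) \<le> L * dist y z" if yz: "y \<in> ball x e" "z \<in> ball x e" for y z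
    unfolding dist_norm
  proof (rule field_differentiable_bound[OF convex_ball _ _ yz])
    fix u assume u: "u \<in> ball x e"
    then have "u \<in> S" using e by auto
    then show "(g has_field_derivative deriv g u) (at u within ball x e)"
      by (rule has_field_derivative_at_within[OF holomorphic_derivI[OF hol S]])
    show "norm (deriv g u) \<le> L" using L u by auto
  qed
  then show ?thesis using e ball_subset_cball[of x e] by blast
qed

lemma hausdorff_content_zero_holomorphic_image:
  assumes s: "0 < s" and hol: "g holomorphic_on S" and S: "open S"
    and T: "hausdorff_content s T = 0" "T \<subseteq> S"
  shows "hausdorff_content s (g ` T) = 0"
proof -
  obtain e L where eL: "\<And>x. x \<in> S \<Longrightarrow> 0 < e x"
    "\<And>x y z. x \<in> S \<Longrightarrow> y \<in> ball x (e x) \<Longrightarrow> z \<in> ball x (e x) \<Longrightarrow> dist (g y) (g z) \<le> L x * dist y z"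
    using holomorphic_locally_lipschitz[OF hol S] by metis
  obtain F' where F': "F' \<subseteq> (\<lambda>x. ball x (e x)) ` S" "countable F'" "\<Union>F' = (\<Union>x\<in>S. ball x (e x))"
    using Lindelof[of "(\<lambda>x. ball x (e x)) ` S"] by auto
  have "hausdorff_content s (g ` (T \<inter> N)) = 0" if N: "N \<in> F'" for N
  proof -
    obtain x where x: "x \<in> S" "N = ball x (e x)" using F'(1) N by auto
    show ?thesis
    proof (rule hausdorff_content_zero_lipschitz_image[OF s])
      show "hausdorff_content s (T \<inter> N) = 0" using T(1) by (rule hausdorff_content_zero_subset) auto
      show "dist (g y) (g z) \<le> L x * dist y z" if "y \<in> T \<inter> N" "z \<in> T \<inter> N" for y z
        using eL(2)[OF x(1)] that x(2) by auto
    qed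
  qed
  then have "hausdorff_content s (\<Union>N\<in>F'. g ` (T \<inter> N)) = 0"
    by (intro hausdorff_content_zero_UN F'(2))
  moreover have "g ` T \<subseteq> (\<Union>N\<in>F'. g ` (T \<inter> N))"
  proof
    fix y assume "y \<in> g ` T"
    then obtain x where x: "x \<in> T" "y = g x" by auto
    then have "x \<in> \<Union>F'" unfolding F'(3) using T(2) eL(1) by (intro UN_I[of x]) auto
    then show "y \<in> (\<Union>N\<in>F'. g ` (T \<inter> N))" using x by auto
  qed
  ultimately show ?thesis by (rule hausdorff_content_zero_subset)
qed

text \<open>Off the critical points \<open>f\<close> is locally invertible with holomorphic, hence
  locally Lipschitz, inverse; the critical points are countable and so have content 0
  themselves.\<close>

lemma hausdorff_content_zero_holomorphic_preimage:
  assumes s: "0 < s" and hol: "f holomorphic_on S" and S: "open S"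
    and crit: "countable {z\<in>S. deriv f z = 0}" and T: "hausdorff_content s T = 0"
  shows "hausdorff_content s {z\<in>S. f z \<in> T} = 0"
proof -
  let ?A = "{z\<in>S. f z \<in> T \<and> deriv f z \<noteq> 0}"
  have "hausdorff_content s ?A = 0"
  proof (rule hausdorff_content_zero_local)
    fix x assume x: "x \<in> ?A"
    then obtain r where r: "0 < r" "ball x r \<subseteq> S" "inj_on f (ball x r)"
      using has_complex_derivative_locally_injective[OF hol _ S] by blast
    have holb: "f holomorphic_on ball x r" using hol r(2) by (rule holomorphic_on_subset)
    obtain g where g: "g holomorphic_on f ` ball x r" "\<And>z. z \<in> ball x r \<Longrightarrow> g (f z) = z"
      using holomorphic_has_inverse[OF holb open_ball r(3)] by blast
    have op: "open (f ` ball x r)" using open_mapping_thm3[OF holb open_ball r(3)] .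
    have "hausdorff_content s (T \<inter> f ` ball x r) = 0"
      using T by (rule hausdorff_content_zero_subset) auto
    then have "hausdorff_content s (g ` (T \<inter> f ` ball x r)) = 0"
      by (rule hausdorff_content_zero_holomorphic_image[OF s g(1) op]) auto
    moreover have "?A \<inter> ball x r \<subseteq> g ` (T \<inter> f ` ball x r)"
    proof
      fix z assume z: "z \<in> ?A \<inter> ball x r"
      then have "z = g (f z)" using g(2) by auto
      then show "z \<in> g ` (T \<inter> f ` ball x r)" using z by blast
    qed
    ultimately have "hausdorff_content s (?A \<inter> ball x r) = 0"
      by (rule hausdorff_content_zero_subset)
    then show "\<exists>N. open N \<and> x \<in> N \<and> hausdorff_content s (?A \<inter> N) = 0"
      using r by (intro exI[of _ "ball x r"]) auto
  qed
  then have "hausdorff_content s (\<Union>b\<in>{True, False}. if b then ?A else {z\<in>S. deriv f z = 0}) = 0"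
    using hausdorff_content_countable_zero[OF crit] by (intro hausdorff_content_zero_UN) auto
  then show ?thesis by (rule hausdorff_content_zero_subset) auto
qed

lemma closed_locally_finite:
  fixes P :: "complex set"
  assumes fin: "\<And>B. finite (P \<inter> cball 0 B)"
  shows "closed P"
  unfolding closed_limpt
proof (intro allI impI)
  fix x assume x: "x islimpt P"
  have "infinite (ball x 1 \<inter> P)" using x islimpt_eq_infinite_ball[of x P] by (auto simp: Int_commute)
  moreover have "ball x 1 \<inter> P \<subseteq> P \<inter> cball 0 (norm x + 1)"
  proof
    fix y assume "y \<in> ball x 1 \<inter> P"
    then show "y \<in> P \<inter> cball 0 (norm x + 1)"
      using norm_triangle_sub[of y x] by (auto simp: dist_norm norm_minus_commute)
  qed
  ultimately show "x \<in> P" using fin finite_subset by blast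
qed

lemma countable_locally_finite:
  fixes P :: "complex set"
  assumes fin: "\<And>B. finite (P \<inter> cball 0 B)"
  shows "countable P"
proof -
  have "P = (\<Union>n::nat. P \<inter> cball 0 (real n))"
    using real_arch_simple by auto
  then show ?thesis using fin by (metis countable_UN countable_finite countableI_type)
qed

section \<open>Orbits through large poles\<close>

text \<open>After one step the orbit is governed by the sequence without its first translation;
  inductions that peel off the first map therefore run over all sequences at once.\<close>

definition shift_seq :: "(nat \<Rightarrow> complex) \<Rightarrow> nat \<Rightarrow> complex" where
  "shift_seq c = (\<lambda>n. c (Suc n))"

lemma Fcomp_Suc_shift: "Fcomp f c (Suc n) z = Fcomp f (shift_seq c) n (f z + c 1)"
  by (induction n) (auto simp: shift_seq_def)

declare Fcomp.simps(2) [simp del]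

lemma Fcomp_add_shift: "Fcomp f c (n + N) z = Fcomp f ((shift_seq ^^ N) c) n (Fcomp f c N z)"
proof (induction N arbitrary: c z)
  case (Suc N)
  have "Fcomp f c (n + Suc N) z = Fcomp f (shift_seq c) (n + N) (f z + c 1)"
    using Fcomp_Suc_shift[of f c "n + N"] by simp
  also have "\<dots> = Fcomp f ((shift_seq ^^ N) (shift_seq c)) n (Fcomp f (shift_seq c) N (f z + c 1))" by (rule Suc)
  also have "Fcomp f (shift_seq c) N (f z + c 1) = Fcomp f c (Suc N) z" by (simp only: Fcomp_Suc_shift)
  finally show ?case by (simp add: funpow_swap1)
qed simp

lemma continuous_on_Fcomp:
  assumes hol: "f holomorphic_on - poles f"
  shows "continuous_on {w. orbit_defined f c n w} (Fcomp f c n)"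
proof (induction n)
  case (Suc n)
  have "continuous_on {w. orbit_defined f c (Suc n) w} (Fcomp f c n)"
    using Suc by (rule continuous_on_subset) (auto simp: orbit_defined_def)
  then have "continuous_on {w. orbit_defined f c (Suc n) w} (\<lambda>w. f (Fcomp f c n w))"
    by (rule continuous_on_compose2[OF holomorphic_on_imp_continuous_on[OF hol]]) (auto simp: orbit_defined_def)
  then show ?case unfolding Fcomp.simps(2) by (intro continuous_intros)
qed (simp add: continuous_on_id)

text \<open>Time 0 is included, unlike in the sets behind \<open>escaping_dim\<close>, so that the
  set obeys the one-step recursion \<open>large_orbits_iff\<close>. Membership in the Julia set is
  not imposed but follows for large \<open>R\<close>.\<close>

definition large_orbits :: "(complex \<Rightarrow> complex) \<Rightarrow> real \<Rightarrow> (nat \<Rightarrow> complex) \<Rightarrow> complex set" where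
  "large_orbits f R c = {z. \<forall>n. Fcomp f c n z \<notin> poles f \<and> R < norm (Fcomp f c n z)}"

definition small_seq :: "(nat \<Rightarrow> complex) \<Rightarrow> bool" where
  "small_seq c \<longleftrightarrow> (\<forall>n\<ge>1. norm (c n) < 1)"

lemma small_seq_shift: "small_seq c \<Longrightarrow> small_seq (shift_seq c)"
  by (simp add: small_seq_def shift_seq_def)

lemma small_seq_funpow_shift: "small_seq c \<Longrightarrow> small_seq ((shift_seq ^^ N) c)"
  by (induction N) (auto simp: small_seq_shift)

lemma small_seq_1: "small_seq c \<Longrightarrow> norm (c 1) < 1"
  by (simp add: small_seq_def)

lemma large_orbits_iff:
  "z \<in> large_orbits f R c \<longleftrightarrow> z \<notin> poles f \<and> R < norm z \<and> f z + c 1 \<in> large_orbits f R (shift_seq c)"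
proof -
  have "z \<in> large_orbits f R c \<longleftrightarrow> (\<forall>n. Fcomp f c n z \<notin> poles f \<and> R < norm (Fcomp f c n z))"
    by (simp add: large_orbits_def)
  also have "\<dots> \<longleftrightarrow> (Fcomp f c 0 z \<notin> poles f \<and> R < norm (Fcomp f c 0 z)) \<and>
      (\<forall>n. Fcomp f c (Suc n) z \<notin> poles f \<and> R < norm (Fcomp f c (Suc n) z))"
    by (metis not0_implies_Suc)
  also have "\<dots> \<longleftrightarrow> z \<notin> poles f \<and> R < norm z \<and> f z + c 1 \<in> large_orbits f R (shift_seq c)"
    by (simp add: large_orbits_def Fcomp_Suc_shift)
  finally show ?thesis .
qed

lemma large_orbits_Fcomp: "z \<in> large_orbits f R c \<Longrightarrow> Fcomp f c N z \<in> large_orbits f R ((shift_seq ^^ N) c)"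
  by (auto simp: large_orbits_def Fcomp_add_shift[symmetric])

lemma large_orbits_orbit_defined: "z \<in> large_orbits f R c \<Longrightarrow> orbit_defined f c n z"
  by (simp add: large_orbits_def orbit_defined_def)

text \<open>Everything the dimension estimates use about \<open>f\<close>. Poles beyond
  \<open>R1\<close> obey uniform estimates with one constant \<open>K\<close>;
  \<open>2 * K \<le> R1\<close> makes every inverse branch between large poles contract by 1/2, and
  \<open>8 * r\<close> keeps points near different poles well apart.\<close>

locale pole_system =
  fixes f :: "complex \<Rightarrow> complex" and \<beta> :: real and M :: nat and r R1 K :: real
  assumes beta: "0 \<le> \<beta>" and r: "0 < r" "r \<le> 1 / 4" and K: "1 \<le> K" and R1: "8 \<le> R1" "2 * K \<le> R1"
    and hol: "f holomorphic_on - poles f"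
    and crit: "countable {z \<in> - poles f. deriv f z = 0}"
    and finite_poles: "\<And>B. finite (poles f \<inter> cball 0 B)"
    and sep: "\<And>a b. a \<in> poles f \<Longrightarrow> b \<in> poles f \<Longrightarrow> a \<noteq> b \<Longrightarrow> 8 * r \<le> dist a b"
    and near: "\<And>z. z \<notin> poles f \<Longrightarrow> R1 < norm (f z) \<Longrightarrow> \<exists>a\<in>poles f. z \<in> ball a r"
    and mult: "\<And>a. a \<in> poles f \<Longrightarrow> R1 \<le> norm a \<Longrightarrow> 1 \<le> pole_mult f a \<and> pole_mult f a \<le> M"
    and branches: "\<And>a b. a \<in> poles f \<Longrightarrow> R1 \<le> norm a \<Longrightarrow> R1 \<le> norm b \<Longrightarrow>
      \<exists>g. inverse_branches f (pole_mult f a) a b r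
        (K * norm a powr (- \<beta> / real (pole_mult f a)) * norm b powr (- 1 - 1 / real (pole_mult f a))) g"
    and dist_pole_le: "\<And>a z. a \<in> poles f \<Longrightarrow> R1 \<le> norm a \<Longrightarrow> z \<in> ball a r - {a} \<Longrightarrow> R1 \<le> norm (f z) \<Longrightarrow>
      norm (z - a) \<le> K * norm a powr (- \<beta> / real (pole_mult f a))"
    and expand: "\<And>a z z' W. a \<in> poles f \<Longrightarrow> R1 \<le> norm a \<Longrightarrow> z \<in> ball a r - {a} \<Longrightarrow> z' \<in> ball a r - {a} \<Longrightarrow> 0 < W \<Longrightarrow>
      W / 2 \<le> norm (f z) \<Longrightarrow> norm (f z) \<le> 4 * W \<Longrightarrow> W / 2 \<le> norm (f z') \<Longrightarrow> norm (f z') \<le> 4 * W \<Longrightarrow>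
      norm (f z - f z') \<le> K * norm a powr (\<beta> / real (pole_mult f a)) * W powr (1 + 1 / real (pole_mult f a)) * norm (z - z')"
begin

lemma poles_closed: "closed (poles f)"
  by (rule closed_locally_finite[OF finite_poles])

lemma open_nonpoles: "open (- poles f)"
  using poles_closed by (simp add: open_Compl)

lemma countable_poles: "countable (poles f)"
  by (rule countable_locally_finite[OF finite_poles])

lemma ball_pole: "a \<in> poles f \<Longrightarrow> z \<in> ball a r - {a} \<Longrightarrow> z \<notin> poles f"
  using sep[of a z] r by auto

lemma lipschitz_const_le_half:
  fixes b :: complex
  assumes "a \<in> poles f" "R1 \<le> norm a" "R1 \<le> norm b"
  shows "K * norm a powr (- \<beta> / real (pole_mult f a)) * norm b powr (- 1 - 1 / real (pole_mult f a)) \<le> 1 / 2"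
proof -
  let ?m = "real (pole_mult f a)"
  have m: "1 \<le> ?m" using mult[OF assms(1,2)] by simp
  have "norm a powr (- \<beta> / ?m) \<le> 1"
  proof -
    have "norm a powr (- \<beta> / ?m) \<le> norm a powr 0"
      using R1 assms beta m by (intro powr_mono) auto
    also have "\<dots> \<le> 1" by simp
    finally show ?thesis .
  qed
  moreover have "norm b powr (- 1 - 1 / ?m) \<le> 1 / R1"
  proof -
    have "0 \<le> 1 / ?m" by simp
    then have "norm b powr (- 1 - 1 / ?m) \<le> norm b powr (- 1)"
      using R1 assms by (intro powr_mono) auto
    also have "\<dots> = 1 / norm b" using R1 assms(3) by (intro powr_neg_one) auto
    also have "\<dots> \<le> 1 / R1" using R1 assms by (intro divide_left_mono mult_pos_pos) auto
    finally show ?thesis .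
  qed
  ultimately have "K * norm a powr (- \<beta> / ?m) * norm b powr (- 1 - 1 / ?m) \<le> K * 1 * (1 / R1)"
    using K R1 by (intro mult_mono) auto
  also have "\<dots> \<le> 1 / 2" using R1 K by (simp add: field_simps)
  finally show ?thesis .
qed

lemma contracting_branches:
  assumes a: "a \<in> poles f" "R1 \<le> norm a" and b: "R1 \<le> norm b"
  shows "\<exists>g. inverse_branches f (pole_mult f a) a b r (1 / 2) g"
  using branches[OF a b] inverse_branches_mono[OF _ lipschitz_const_le_half[OF a b]] by blast

lemma branch_exists:
  assumes a: "a \<in> poles f" "R1 \<le> norm a" and b: "R1 \<le> norm b"
  shows "\<exists>g. \<forall>w\<in>ball b (2 * r). g w \<in> ball a r - {a} \<and> f (g w) = w \<and>
    (\<forall>w'\<in>ball b (2 * r). dist (g w) (g w') \<le> 1 / 2 * dist w w')"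
proof -
  obtain g where g: "inverse_branches f (pole_mult f a) a b r (1 / 2) g"
    using contracting_branches[OF a b] by blast
  show ?thesis
    using inverse_branches_right_inverse[OF g power_one] inverse_branches_lipschitz[OF g power_one]
    by (intro exI[of _ "g 1"]) blast
qed

text \<open>Completeness of the family of branches, applied at the centre \<open>f z\<close>,
  supplies the member that passes through \<open>z\<close>.\<close>

lemma branch_at:
  assumes a: "a \<in> poles f" "R1 \<le> norm a" and z: "z \<in> ball a r - {a}" and b: "R1 \<le> norm (f z)"
  shows "\<exists>g. g (f z) = z \<and> (\<forall>w\<in>ball (f z) (2 * r). g w \<in> ball a r - {a} \<and> f (g w) = w \<and>
    (\<forall>w'\<in>ball (f z) (2 * r). dist (g w) (g w') \<le> 1 / 2 * dist w w'))"
proof -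
  obtain g where g: "inverse_branches f (pole_mult f a) a (f z) r (1 / 2) g"
    using contracting_branches[OF a b] by blast
  have "f z \<in> ball (f z) (2 * r)" using r by simp
  then obtain \<zeta> where \<zeta>: "\<zeta> ^ pole_mult f a = 1" "z = g \<zeta> (f z)"
    using inverse_branches_exhaust[OF g z] by blast
  show ?thesis
    using inverse_branches_right_inverse[OF g \<zeta>(1)] inverse_branches_lipschitz[OF g \<zeta>(1)] \<zeta>(2)
    by (intro exI[of _ "g \<zeta>"] conjI ballI) auto
qed

section \<open>Univalent pullbacks along large orbits, and the Julia sets\<close>

lemma large_orbits_near_pole:
  assumes c: "small_seq c" and R: "R1 + 2 \<le> R" and z: "z \<in> large_orbits f R c"
  shows "\<exists>a\<in>poles f. z \<in> ball a r - {a} \<and> R - 1 < norm a \<and> R - 1 < norm (f z)"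
proof -
  have zn: "z \<notin> poles f" "R < norm z" "f z + c 1 \<in> large_orbits f R (shift_seq c)"
    using z large_orbits_iff by blast+
  then have "R < norm (f z + c 1)" using large_orbits_iff by blast
  then have fz: "R - 1 < norm (f z)" using small_seq_1[OF c] norm_triangle_ineq[of "f z" "c 1"] by linarith
  then obtain a where a: "a \<in> poles f" "z \<in> ball a r" using near zn(1) R by force
  have "norm z \<le> norm a + norm (a - z)" by (metis norm_minus_commute norm_triangle_sub)
  then have "R - 1 < norm a" using a(2) zn(2) r by (simp add: dist_norm)
  then show ?thesis using a zn(1) fz by blast
qed

text \<open>The disc is first pulled back along the orbit of \<open>f z + c 1\<close> under the
  shifted sequence, then by the branch of \<open>f\<close> through \<open>z\<close>; each of the
  \<open>n\<close> branches contributes a factor 1/2.\<close>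

lemma pullback:
  assumes "small_seq c" "R1 + 2 \<le> R" "z \<in> large_orbits f R c"
  shows "\<exists>\<phi>. \<phi> (Fcomp f c n z) = z \<and> (\<forall>w\<in>ball (Fcomp f c n z) (2 * r).
    orbit_defined f c n (\<phi> w) \<and> Fcomp f c n (\<phi> w) = w \<and>
    (\<forall>w'\<in>ball (Fcomp f c n z) (2 * r). dist (\<phi> w) (\<phi> w') \<le> (1 / 2) ^ n * dist w w'))"
  using assms
proof (induction n arbitrary: c z)
  case 0
  show ?case by (intro exI[of _ "\<lambda>w. w"]) (auto simp: orbit_defined_def)
next
  case (Suc n)
  let ?z1 = "f z + c 1"
  let ?B = "ball (Fcomp f c (Suc n) z) (2 * r)"
  have F: "Fcomp f c (Suc n) z = Fcomp f (shift_seq c) n ?z1" by (rule Fcomp_Suc_shift)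
  have z1: "?z1 \<in> large_orbits f R (shift_seq c)" using Suc.prems(3) large_orbits_iff by blast
  obtain \<phi> where \<phi>: "\<phi> (Fcomp f c (Suc n) z) = ?z1"
    "\<And>w. w \<in> ?B \<Longrightarrow> orbit_defined f (shift_seq c) n (\<phi> w) \<and> Fcomp f (shift_seq c) n (\<phi> w) = w"
    "\<And>w w'. w \<in> ?B \<Longrightarrow> w' \<in> ?B \<Longrightarrow> dist (\<phi> w) (\<phi> w') \<le> (1 / 2) ^ n * dist w w'"
    using Suc.IH[OF small_seq_shift[OF Suc.prems(1)] Suc.prems(2) z1] unfolding F by blast
  obtain a where a: "a \<in> poles f" "z \<in> ball a r - {a}" "R - 1 < norm a" "R - 1 < norm (f z)"
    using large_orbits_near_pole[OF Suc.prems] by blast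
  have "R1 \<le> norm a" "R1 \<le> norm (f z)" using a Suc.prems(2) by auto
  from branch_at[OF a(1) this(1) a(2) this(2)]
  obtain g where g: "g (f z) = z" "\<And>w. w \<in> ball (f z) (2 * r) \<Longrightarrow> g w \<in> ball a r - {a} \<and> f (g w) = w"
    "\<And>w w'. w \<in> ball (f z) (2 * r) \<Longrightarrow> w' \<in> ball (f z) (2 * r) \<Longrightarrow> dist (g w) (g w') \<le> 1 / 2 * dist w w'"
    by blast
  have cent: "Fcomp f c (Suc n) z \<in> ?B" using r by simp
  \<comment> \<open>The contraction already obtained keeps the pulled-back disc within
    \<open>2 * r\<close> of its centre, the domain of the next branch.\<close>
  have in1: "\<phi> w - c 1 \<in> ball (f z) (2 * r)" if w: "w \<in> ?B" for w
  proof -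
    have "dist (f z) (\<phi> w - c 1) = dist (\<phi> (Fcomp f c (Suc n) z)) (\<phi> w)"
      unfolding \<phi>(1) by (simp add: dist_norm algebra_simps)
    also have "\<dots> \<le> (1 / 2) ^ n * dist (Fcomp f c (Suc n) z) w" by (rule \<phi>(3)[OF cent w])
    also have "\<dots> \<le> 1 * dist (Fcomp f c (Suc n) z) w" by (intro mult_right_mono power_le_one) auto
    also have "\<dots> < 2 * r" using w by simp
    finally show ?thesis by simp
  qed
  show ?case
  proof (intro exI[of _ "\<lambda>w. g (\<phi> w - c 1)"] conjI ballI)
    show "g (\<phi> (Fcomp f c (Suc n) z) - c 1) = z" using \<phi>(1) g(1) by simp
    fix w assume w: "w \<in> ?B"
    let ?x = "g (\<phi> w - c 1)"
    have x: "?x \<in> ball a r - {a}" "f ?x = \<phi> w - c 1" using g(2)[OF in1[OF w]] by auto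
    have Fx: "Fcomp f c (Suc k) ?x = Fcomp f (shift_seq c) k (\<phi> w)" for k
      using Fcomp_Suc_shift[of f c k ?x] x(2) by simp
    show "Fcomp f c (Suc n) ?x = w" using Fx \<phi>(2)[OF w] by simp
    show "orbit_defined f c (Suc n) ?x"
      unfolding orbit_defined_def
    proof (intro allI impI)
      fix k assume "k < Suc n"
      then show "Fcomp f c k ?x \<notin> poles f"
        using ball_pole[OF a(1) x(1)] Fx \<phi>(2)[OF w] by (cases k) (auto simp: orbit_defined_def)
    qed
    fix w' assume w': "w' \<in> ?B"
    have "dist ?x (g (\<phi> w' - c 1)) \<le> 1 / 2 * dist (\<phi> w - c 1) (\<phi> w' - c 1)"
      by (rule g(3)[OF in1[OF w] in1[OF w']])
    also have "\<dots> = 1 / 2 * dist (\<phi> w) (\<phi> w')" by (simp add: dist_norm)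
    also have "\<dots> \<le> 1 / 2 * ((1 / 2) ^ n * dist w w')" using \<phi>(3)[OF w w'] by simp
    finally show "dist ?x (g (\<phi> w' - c 1)) \<le> (1 / 2) ^ Suc n * dist w w'" by simp
  qed
qed

text \<open>The disc of radius \<open>2 * r\<close> about the \<open>n\<close>-th orbit point
  contains a pole, and its pullback shrinks to \<open>z\<close>. So points arbitrarily close to
  \<open>z\<close> hit a pole at time \<open>n\<close>, and the definedness clause of
  \<open>fatou_set\<close> fails.\<close>

lemma large_orbits_subset_julia:
  assumes c: "small_seq c" and R: "R1 + 2 \<le> R"
  shows "large_orbits f R c \<subseteq> julia_set f c"
proof
  fix z assume z: "z \<in> large_orbits f R c"
  show "z \<in> julia_set f c"
    unfolding julia_set_def
  proof
    assume "z \<in> fatou_set f c"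
    then obtain U where U: "open U" "z \<in> U" "\<And>n w. w \<in> U \<Longrightarrow> orbit_defined f c n w"
      unfolding fatou_set_def by blast
    obtain e where e: "0 < e" "ball z e \<subseteq> U" using U open_contains_ball by blast
    obtain n where n: "(1 / 2) ^ n < e / (2 * r)"
      using real_arch_pow_inv[of "e / (2 * r)" "1 / 2"] e r by auto
    obtain a where a: "a \<in> poles f" "Fcomp f c n z \<in> ball a r - {a}"
      using large_orbits_near_pole[OF small_seq_funpow_shift[OF c] R large_orbits_Fcomp[OF z]] by blast
    obtain \<phi> where \<phi>: "\<phi> (Fcomp f c n z) = z"
      "\<And>w. w \<in> ball (Fcomp f c n z) (2 * r) \<Longrightarrow> Fcomp f c n (\<phi> w) = w"
      "\<And>w w'. w \<in> ball (Fcomp f c n z) (2 * r) \<Longrightarrow> w' \<in> ball (Fcomp f c n z) (2 * r) \<Longrightarrow>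
        dist (\<phi> w) (\<phi> w') \<le> (1 / 2) ^ n * dist w w'"
      using pullback[OF c R z, of n] by blast
    have aB: "a \<in> ball (Fcomp f c n z) (2 * r)" "Fcomp f c n z \<in> ball (Fcomp f c n z) (2 * r)"
      using a r by (auto simp: dist_commute)
    have "dist z (\<phi> a) \<le> (1 / 2) ^ n * dist (Fcomp f c n z) a"
      using \<phi>(3)[OF aB(2,1)] \<phi>(1) by simp
    also have "\<dots> \<le> (1 / 2) ^ n * (2 * r)" using aB(1) by (intro mult_left_mono) auto
    also have "\<dots> < e" using n r by (simp add: field_simps)
    finally have "\<phi> a \<in> U" using e by auto
    from U(3)[OF this, of "Suc n"] show False
      using \<phi>(2)[OF aB(1)] a(1) by (auto simp: orbit_defined_def)
  qed
qed

text \<open>The image of the disc under the pullback is open by invariance of domain, relatively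
  closed as the set where pulling back the \<open>n\<close>-th iterate gives back the point, and
  connected; hence it is exactly the component required by the definition.\<close>

lemma large_orbits_univalent_pullback:
  assumes c: "small_seq c" and R: "R1 + 2 \<le> R" and z: "z \<in> large_orbits f R c"
  shows "univalent_pullback f c n z (2 * r)"
proof -
  let ?F = "Fcomp f c n"
  let ?B = "ball (?F z) (2 * r)"
  let ?S = "{w. orbit_defined f c n w \<and> ?F w \<in> ?B}"
  let ?V = "connected_component_set ?S z"
  obtain \<phi> where \<phi>: "\<phi> (?F z) = z"
    "\<And>w. w \<in> ?B \<Longrightarrow> orbit_defined f c n (\<phi> w)" "\<And>w. w \<in> ?B \<Longrightarrow> ?F (\<phi> w) = w"
    "\<And>w w'. w \<in> ?B \<Longrightarrow> w' \<in> ?B \<Longrightarrow> dist (\<phi> w) (\<phi> w') \<le> (1 / 2) ^ n * dist w w'"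
    using pullback[OF c R z, of n] by blast
  have zS: "z \<in> ?S" using large_orbits_orbit_defined[OF z] r by simp
  have lip: "((1 / 2) ^ n)-lipschitz_on ?B \<phi>"
    by (rule lipschitz_onI) (use \<phi>(4) in auto)
  have cont: "continuous_on ?B \<phi>" by (rule lipschitz_on_continuous_on[OF lip])
  have inj: "inj_on \<phi> ?B" by (rule inj_on_inverseI[of _ ?F]) (rule \<phi>(3))
  have imS: "\<phi> ` ?B \<subseteq> ?S" using \<phi>(2,3) by auto
  have opE: "open (\<phi> ` ?B)" by (rule invariance_of_domain[OF cont open_ball inj])
  have contF: "continuous_on ?S ?F"
    using continuous_on_Fcomp[OF hol] by (rule continuous_on_subset) auto
  have "continuous_on ?S (\<lambda>w. \<phi> (?F w) - w)"
    by (intro continuous_intros continuous_on_compose2[OF cont contF]) auto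
  then have "closedin (top_of_set ?S) {w \<in> ?S. \<phi> (?F w) - w = 0}"
    by (rule continuous_closedin_preimage_constant)
  also have "{w \<in> ?S. \<phi> (?F w) - w = 0} = \<phi> ` ?B"
  proof (intro set_eqI iffI)
    fix w assume "w \<in> {w \<in> ?S. \<phi> (?F w) - w = 0}"
    then have "w = \<phi> (?F w)" "?F w \<in> ?B" by auto
    then show "w \<in> \<phi> ` ?B" by (rule image_eqI)
  next
    fix w assume "w \<in> \<phi> ` ?B"
    then obtain y where "y \<in> ?B" "w = \<phi> y" by blast
    then show "w \<in> {w \<in> ?S. \<phi> (?F w) - w = 0}" using \<phi>(2,3) by simp
  qed
  finally have clE: "closedin (top_of_set ?S) (\<phi> ` ?B)" .
  have VS: "?V \<subseteq> ?S" by (rule connected_component_subset)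
  have "?V \<inter> \<phi> ` ?B = {} \<or> ?V \<inter> \<phi> ` ?B = ?V"
  proof -
    have "openin (top_of_set ?V) (?V \<inter> \<phi> ` ?B)" using opE by (rule openin_open_Int)
    moreover have "closedin (top_of_set ?V) (?V \<inter> \<phi> ` ?B)"
    proof -
      obtain T where T: "closed T" "\<phi> ` ?B = ?S \<inter> T"
        using clE unfolding closedin_closed by (elim exE conjE) (rule that)
      then have "?V \<inter> \<phi> ` ?B = ?V \<inter> T" using VS by blast
      then show ?thesis using closedin_closed_Int[OF T(1), of ?V] by (simp only:)
    qed
    moreover have "connected ?V" by (rule connected_connected_component)
    ultimately show ?thesis unfolding connected_clopen by blast
  qed
  moreover have "z \<in> ?V" using zS by (simp add: connected_component_refl)
  moreover have zE: "z \<in> \<phi> ` ?B"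
    by (rule image_eqI[of _ _ "?F z"]) (use \<phi>(1) r in auto)
  ultimately have "?V \<subseteq> \<phi> ` ?B" by blast
  moreover have "\<phi> ` ?B \<subseteq> ?V"
    using zE connected_continuous_image[OF cont] imS by (intro connected_component_maximal) auto
  ultimately have V: "?V = \<phi> ` ?B" by blast
  have "inj_on ?F ?V"
    unfolding V by (rule inj_onI) (use \<phi>(3) in auto)
  moreover have "?F ` ?V = ?B"
    unfolding V image_image using \<phi>(3) by (simp add: image_def)
  ultimately show ?thesis unfolding univalent_pullback_def Let_def by blast
qed

lemma large_orbits_subset_radial:
  assumes c: "small_seq c" and R: "R1 + 2 \<le> R"
  shows "large_orbits f R c \<subseteq> radial_julia f c"
proof
  fix z assume z: "z \<in> large_orbits f R c"
  have "{n. univalent_pullback f c n z (2 * r)} = UNIV"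
    using large_orbits_univalent_pullback[OF c R z] by auto
  then have "infinite {n. univalent_pullback f c n z (2 * r)}" by simp
  then show "z \<in> radial_julia f c"
    using large_orbits_subset_julia[OF c R] z large_orbits_orbit_defined[OF z] r
    unfolding radial_julia_def by (auto intro!: exI[of _ "2 * r"])
qed

section \<open>Null sets along orbits and the comparison with escaping points\<close>

lemma null_step_preimage:
  assumes s: "0 < s" and T: "hausdorff_content s T = 0"
  shows "hausdorff_content s {z. z \<notin> poles f \<and> f z + k \<in> T} = 0"
proof -
  have "hausdorff_content s ((\<lambda>t. t - k) ` T) = 0"
    by (rule hausdorff_content_zero_lipschitz_image[OF s T, of _ 1]) (simp add: dist_norm)
  from hausdorff_content_zero_holomorphic_preimage[OF s hol open_nonpoles crit this]
  show ?thesis by (rule hausdorff_content_zero_subset) (force simp: image_iff)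
qed

lemma null_orbit_preimage:
  assumes s: "0 < s" and T: "hausdorff_content s T = 0"
  shows "hausdorff_content s {z. orbit_defined f c n z \<and> Fcomp f c n z \<in> T} = 0"
  using T
proof (induction n arbitrary: T)
  case (Suc n)
  have "{z. orbit_defined f c (Suc n) z \<and> Fcomp f c (Suc n) z \<in> T} \<subseteq>
      {z. orbit_defined f c n z \<and> Fcomp f c n z \<in> {z. z \<notin> poles f \<and> f z + c (Suc n) \<in> T}}"
    by (auto simp: orbit_defined_def Fcomp.simps(2))
  then show ?case
    using Suc.IH[OF null_step_preimage[OF s Suc.prems]] hausdorff_content_zero_subset by blast
qed (auto simp: orbit_defined_def)

text \<open>Every large orbit of the shifted sequence has a preimage near the pole \<open>a\<close>,
  which is itself large because \<open>R + 1 < norm a\<close>. So the shifted set lies in a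
  holomorphic image of the original one.\<close>

lemma null_large_orbits_shift:
  assumes s: "0 < s" and c: "small_seq c" and R: "R1 + 2 \<le> R"
    and a: "a \<in> poles f" "R + 1 < norm a" and null: "hausdorff_content s (large_orbits f R c) = 0"
  shows "hausdorff_content s (large_orbits f R (shift_seq c)) = 0"
proof -
  have "(\<lambda>z. f z + c 1) holomorphic_on - poles f" using hol by (intro holomorphic_intros)
  moreover have "large_orbits f R c \<subseteq> - poles f" using large_orbits_iff by blast
  ultimately have "hausdorff_content s ((\<lambda>z. f z + c 1) ` large_orbits f R c) = 0"
    by (intro hausdorff_content_zero_holomorphic_image[OF s _ open_nonpoles null])
  moreover have "large_orbits f R (shift_seq c) \<subseteq> (\<lambda>z. f z + c 1) ` large_orbits f R c"
  proof
    fix w assume w: "w \<in> large_orbits f R (shift_seq c)"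
    have "R < norm w" using w large_orbits_iff by blast
    then have "R1 \<le> norm (w - c 1)"
      using small_seq_1[OF c] norm_triangle_ineq2[of w "c 1"] R by linarith
    moreover have "R1 \<le> norm a" using a R by simp
    ultimately obtain g where "\<forall>v\<in>ball (w - c 1) (2 * r). g v \<in> ball a r - {a} \<and> f (g v) = v \<and>
        (\<forall>w'\<in>ball (w - c 1) (2 * r). dist (g v) (g w') \<le> 1 / 2 * dist v w')"
      using branch_exists[OF a(1), of "w - c 1"] by blast
    moreover have "w - c 1 \<in> ball (w - c 1) (2 * r)" using r by simp
    ultimately have g: "g (w - c 1) \<in> ball a r - {a}" "f (g (w - c 1)) = w - c 1" by blast+
    let ?z = "g (w - c 1)"
    have "norm a \<le> norm ?z + norm (a - ?z)" by (metis norm_triangle_sub)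
    then have "R < norm ?z" using g(1) a(2) r by (simp add: dist_norm)
    then have "?z \<in> large_orbits f R c"
      using w g(2) ball_pole[OF a(1) g(1)] by (subst large_orbits_iff) simp
    then show "w \<in> (\<lambda>z. f z + c 1) ` large_orbits f R c" using g(2) by (intro image_eqI[of _ _ ?z]) auto
  qed
  ultimately show ?thesis by (rule hausdorff_content_zero_subset)
qed

text \<open>From some time \<open>N\<close> on an escaping orbit is large, but for the
  \<open>N\<close> times shifted sequence. Nullity passes from \<open>c\<close> to all shifts and
  then to the preimages under the first \<open>N\<close> maps, and only countably many
  \<open>N\<close> occur.\<close>

lemma hausdorff_dim_escaping_le:
  assumes c: "small_seq c" and R: "R1 + 2 \<le> R"
  shows "hausdorff_dim (escaping_julia f c) \<le> hausdorff_dim (large_orbits f R c)"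
proof (rule hausdorff_dim_mono_null)
  fix s :: real assume s: "0 < s" and null: "hausdorff_content s (large_orbits f R c) = 0"
  have tail: "\<exists>N. \<forall>n\<ge>N. B < norm (Fcomp f c n z)" if "z \<in> escaping_julia f c" for z B
  proof -
    have "filterlim (\<lambda>n. Fcomp f c n z) at_infinity sequentially" using that by (simp add: escaping_julia_def)
    then have "eventually (\<lambda>n. \<bar>B\<bar> + 1 \<le> norm (Fcomp f c n z)) sequentially"
      unfolding filterlim_at_infinity[OF order_refl] by auto
    then obtain N where "\<And>n. N \<le> n \<Longrightarrow> \<bar>B\<bar> + 1 \<le> norm (Fcomp f c n z)"
      unfolding eventually_sequentially by blast
    then show ?thesis by (intro exI[of _ N]) force
  qed
  have od: "Fcomp f c n z \<notin> poles f" if "z \<in> escaping_julia f c" for z n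
    using that by (auto simp: escaping_julia_def orbit_defined_def)
  show "hausdorff_content s (escaping_julia f c) = 0"
  \<comment> \<open>The forward transport needs a pole beyond \<open>R + 1\<close>. Without such
    poles nothing escapes, since large values are taken only near poles and the next point would
    have to be near a large one.\<close>
  proof (cases "\<exists>a\<in>poles f. R + 1 < norm a")
    case True
    then obtain a where a: "a \<in> poles f" "R + 1 < norm a" by blast
    have "hausdorff_content s (large_orbits f R ((shift_seq ^^ N) c)) = 0" for N
    proof (induction N)
      case (Suc N)
      then show ?case
        using null_large_orbits_shift[OF s small_seq_funpow_shift[OF c] R a] by simp
    qed (simp add: null)
    then have "hausdorff_content s (\<Union>N. {z. orbit_defined f c N z \<and> Fcomp f c N z \<in> large_orbits f R ((shift_seq ^^ N) c)}) = 0"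
      by (intro hausdorff_content_zero_UN null_orbit_preimage s) auto
    moreover have "escaping_julia f c \<subseteq> (\<Union>N. {z. orbit_defined f c N z \<and> Fcomp f c N z \<in> large_orbits f R ((shift_seq ^^ N) c)})"
    proof
      fix z assume z: "z \<in> escaping_julia f c"
      obtain N where N: "\<forall>n\<ge>N. R < norm (Fcomp f c n z)" using tail[OF z] by blast
      have "Fcomp f c N z \<in> large_orbits f R ((shift_seq ^^ N) c)"
        unfolding large_orbits_def using N od[OF z] by (simp add: Fcomp_add_shift[symmetric])
      then show "z \<in> (\<Union>N. {z. orbit_defined f c N z \<and> Fcomp f c N z \<in> large_orbits f R ((shift_seq ^^ N) c)})"
        using z by (auto simp: escaping_julia_def)
    qed
    ultimately show ?thesis by (rule hausdorff_content_zero_subset)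
  next
    case False
    have "escaping_julia f c = {}"
    proof (rule ccontr)
      assume "escaping_julia f c \<noteq> {}"
      then obtain z where z: "z \<in> escaping_julia f c" by blast
      obtain N where N: "\<forall>n\<ge>N. R + 3 < norm (Fcomp f c n z)" using tail[OF z] by blast
      let ?w = "Fcomp f c N z"
      have "R + 3 < norm (f ?w + c (Suc N))" using N[rule_format, of "Suc N"] by (simp add: Fcomp.simps(2))
      then have "R1 < norm (f ?w)"
        using c norm_triangle_ineq[of "f ?w" "c (Suc N)"] R unfolding small_seq_def by (smt (verit) le_add1 plus_1_eq_Suc)
      then obtain b where b: "b \<in> poles f" "?w \<in> ball b r" using near od[OF z] by blast
      have "norm ?w \<le> norm b + norm (b - ?w)" by (metis norm_minus_commute norm_triangle_sub)
      then have "R + 1 < norm b" using N[rule_format, of N] b r by (simp add: dist_norm)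
      then show False using False b by blast
    qed
    then show ?thesis using hausdorff_content_countable_zero by simp
  qed
qed

end

section \<open>Covers and Cantor sets of large orbits\<close>

text \<open>Good scales are repeated until the factor \<open>2 ^ k\<close> has caught up with the
  next one. The Cantor construction gains a factor 2 per level and uses it to pay for the growth of
  the scales.\<close>

lemma slow_good_scales:
  fixes good :: "real \<Rightarrow> bool" and B t :: real
  assumes "\<And>B. \<exists>W\<ge>B. good W" and B: "0 < B"
  shows "\<exists>W :: nat \<Rightarrow> real. (\<forall>k. good (W k) \<and> B \<le> W k \<and> W k powr t \<le> W 0 powr t * 2 ^ k) \<and> filterlim W at_top sequentially"
proof -
  have "\<forall>i::nat. \<exists>v. max B (real i) \<le> v \<and> good v" using assms(1) by blast
  then obtain V where V: "\<And>i::nat. max B (real i) \<le> V i \<and> good (V i)" by metis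
  \<comment> \<open>The indices affordable at level \<open>k\<close>; \<open>i \<le> k\<close> makes
    the set finite, so the largest can be taken, and every fixed index is eventually
    affordable.\<close>
  define I where "I k = {i. i \<le> k \<and> V i powr t \<le> V 0 powr t * 2 ^ k}" for k :: nat
  have fin: "finite (I k)" for k by (simp add: I_def)
  have I0: "0 \<in> I k" for k by (simp add: I_def mult_le_cancel_left1)
  define W where "W k = V (Max (I k))" for k
  have inI: "Max (I k) \<in> I k" for k using Max_in[OF fin] I0 by blast
  have "I 0 = {0}" by (auto simp: I_def)
  then have W0: "W 0 = V 0" by (simp add: W_def)
  have "filterlim W at_top sequentially"
    unfolding filterlim_at_top
  proof
    fix Z :: real
    obtain i :: nat where i: "Z \<le> real i" using real_arch_simple by blast
    have "V 0 \<noteq> 0" using V[of 0] B by auto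
    have "\<exists>k0. \<forall>k\<ge>k0. i \<in> I k"
    proof -
      have p: "0 < V 0 powr t" using \<open>V 0 \<noteq> 0\<close> by simp
      obtain n where n: "V i powr t / V 0 powr t < 2 ^ n" using real_arch_pow[of 2] by auto
      have "i \<in> I k" if "max i n \<le> k" for k
      proof -
        have "(2::real) ^ n \<le> 2 ^ k" using that by (intro power_increasing) auto
        then have "V i powr t / V 0 powr t \<le> 2 ^ k" using n by linarith
        then show ?thesis using that p by (simp add: I_def field_simps)
      qed
      then show ?thesis by blast
    qed
    then obtain k0 where k0: "\<And>k. k0 \<le> k \<Longrightarrow> i \<in> I k" by blast
    have "Z \<le> W k" if "k0 \<le> k" for k
    proof -
      have "i \<le> Max (I k)" using k0[OF that] fin by simp
      then have "real i \<le> real (Max (I k))" by simp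
      also have "\<dots> \<le> W k" unfolding W_def using V[of "Max (I k)"] by simp
      finally show ?thesis using i by linarith
    qed
    then show "\<forall>\<^sub>F k in sequentially. Z \<le> W k" unfolding eventually_sequentially by blast
  qed
  moreover have "good (W k) \<and> B \<le> W k \<and> W k powr t \<le> W 0 powr t * 2 ^ k" for k
    using inI[of k] V[of "Max (I k)"] unfolding W0 by (auto simp: W_def I_def)
  ultimately show ?thesis by blast
qed

section \<open>Upper bound: contents of large orbits\<close>

context pole_system
begin

text \<open>One induction step covers the set near \<open>a\<close> by images of the sets near all
  large poles \<open>b\<close> under at most \<open>M\<close> branches each. The Lipschitz constant
  contributes \<open>norm b powr (- s * (1 + 1 / real M))\<close> and the induction hypothesis
  \<open>norm b powr (- s * \<beta> / real M)\<close>; the assumption on the resulting sum over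
  \<open>b\<close> gains the factor 1/2.\<close>

lemma content_near_pole_le:
  assumes s: "0 < s" and M: "1 \<le> M" and R: "R1 + 2 \<le> R"
    and sum: "\<And>F. finite F \<Longrightarrow> F \<subseteq> {b\<in>poles f. R - 1 \<le> norm b} \<Longrightarrow>
      (\<Sum>b\<in>F. norm b powr (- s * (1 + 1 / real M + \<beta> / real M))) \<le> 1 / (2 * real M * (4 * K) powr s)"
    and c: "small_seq c" and a: "a \<in> poles f" "R - 1 \<le> norm a"
  shows "hausdorff_content s (large_orbits f R c \<inter> ball a r)
    \<le> ennreal ((1 / 2) ^ n * (2 * K) powr s * norm a powr (- s * \<beta> / real M))"
  using c a
proof (induction n arbitrary: c a)
  case (0 c a)
  define m where "m = pole_mult f a"
  have a1: "R1 \<le> norm a" "1 \<le> norm a" using 0 R R1 by auto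
  have m: "1 \<le> m" "m \<le> M" using mult[OF 0(2) a1(1)] by (auto simp: m_def)
  \<comment> \<open>As \<open>norm a \<ge> 1\<close>, replacing the actual multiplicity by
    \<open>M\<close> only weakens the estimate, so all poles can share one exponent.\<close>
  have le: "norm a powr (- \<beta> / real m) \<le> norm a powr (- \<beta> / real M)"
    using a1 m beta by (intro powr_mono) (auto intro!: divide_left_mono)
  have sub: "large_orbits f R c \<inter> ball a r \<subseteq> cball a (K * norm a powr (- \<beta> / real M))"
  proof
    fix z assume z: "z \<in> large_orbits f R c \<inter> ball a r"
    then obtain b where b: "b \<in> poles f" "z \<in> ball b r - {b}" "R - 1 < norm (f z)"
      using large_orbits_near_pole[OF 0(1) R] by blast
    have "z \<notin> poles f" using z large_orbits_iff by blast
    then have za: "z \<in> ball a r - {a}" using z 0(2) by auto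
    have "norm (z - a) \<le> K * norm a powr (- \<beta> / real m)"
      unfolding m_def by (rule dist_pole_le[OF 0(2) a1(1) za]) (use b(3) R in simp)
    also have "\<dots> \<le> K * norm a powr (- \<beta> / real M)" using le K by (intro mult_left_mono) auto
    finally show "z \<in> cball a (K * norm a powr (- \<beta> / real M))"
      by (simp add: dist_norm norm_minus_commute)
  qed
  have "hausdorff_content s (large_orbits f R c \<inter> ball a r) \<le> ennreal (diameter (cball a (K * norm a powr (- \<beta> / real M))) powr s)"
    by (rule hausdorff_content_le_diameter[OF bounded_cball sub])
  also have "diameter (cball a (K * norm a powr (- \<beta> / real M))) = 2 * K * norm a powr (- \<beta> / real M)"
  proof -
    have "0 \<le> K * norm a powr (- \<beta> / real M)" using K by simp
    then show ?thesis unfolding diameter_cball by simp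
  qed
  also have "(2 * K * norm a powr (- \<beta> / real M)) powr s = (1 / 2) ^ 0 * (2 * K) powr s * norm a powr (- s * \<beta> / real M)"
    using K by (simp add: powr_mult powr_powr mult.commute)
  finally show ?case .
next
  case (Suc n c a)
  let ?P = "{b\<in>poles f. R - 1 \<le> norm b}"
  let ?E = "- s * (1 + 1 / real M + \<beta> / real M)"
  let ?X = "large_orbits f R (shift_seq c)"
  define m where "m = pole_mult f a"
  define D where "D = (4 * K) powr s * (1 / 2) ^ n * (2 * K) powr s * norm a powr (- s * \<beta> / real M)"
  have D0: "0 \<le> D" unfolding D_def by simp
  have a1: "R1 \<le> norm a" "1 \<le> norm a" using Suc.prems R R1 by auto
  have m: "1 \<le> m" "m \<le> M" using mult[OF Suc.prems(2) a1(1)] by (auto simp: m_def)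
  have c1: "norm (c 1) < 1" by (rule small_seq_1[OF Suc.prems(1)])
  have bc: "R1 \<le> norm (b - c 1) \<and> norm b / 2 \<le> norm (b - c 1) \<and> 1 \<le> norm b" if "b \<in> ?P" for b
    using that norm_triangle_ineq2[of b "c 1"] c1 R R1 by auto
  let ?k = "\<lambda>b. K * norm a powr (- \<beta> / real m) * norm (b - c 1) powr (- 1 - 1 / real m)"
  have "\<exists>g. inverse_branches f m a (b - c 1) r (?k b) g" if "b \<in> ?P" for b
    unfolding m_def by (rule branches[OF Suc.prems(2) a1(1)]) (use bc[OF that] in blast)
  then obtain g where g: "\<And>b. b \<in> ?P \<Longrightarrow> inverse_branches f m a (b - c 1) r (?k b) (g b)" by metis
  define Z where "Z = {\<xi>::complex. \<xi> ^ m = 1}"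
  have Z: "finite Z" "card Z \<le> M"
    unfolding Z_def by (rule finite_roots_unity[OF m(1)], rule order_trans[OF card_roots_unity[OF m(1)] m(2)])
  define T where "T b = (\<Union>\<xi>\<in>Z. (\<lambda>w. g b \<xi> (w - c 1)) ` (?X \<inter> ball b r))" for b
  have cov: "large_orbits f R c \<inter> ball a r \<subseteq> (\<Union>b\<in>?P. T b)"
  proof
    fix z assume z: "z \<in> large_orbits f R c \<inter> ball a r"
    have zn: "z \<notin> poles f" "f z + c 1 \<in> ?X" using z large_orbits_iff by blast+
    have za: "z \<in> ball a r - {a}" using z zn(1) Suc.prems(2) by auto
    obtain b where b: "b \<in> poles f" "f z + c 1 \<in> ball b r - {b}" "R - 1 < norm b"
      using large_orbits_near_pole[OF small_seq_shift[OF Suc.prems(1)] R zn(2)] by blast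
    have bP: "b \<in> ?P" using b by simp
    have "dist (b - c 1) (f z) = dist b (f z + c 1)" by (simp add: dist_norm algebra_simps)
    then have "f z \<in> ball (b - c 1) (2 * r)" using b(2) r by auto
    then obtain \<zeta> where \<zeta>: "\<zeta> ^ m = 1" "z = g b \<zeta> (f z)" using inverse_branches_exhaust[OF g[OF bP] za] by blast
    have "z = (\<lambda>w. g b \<zeta> (w - c 1)) (f z + c 1)" using \<zeta>(2) by simp
    moreover have "f z + c 1 \<in> ?X \<inter> ball b r" using zn(2) b(2) by blast
    ultimately have "z \<in> (\<lambda>w. g b \<zeta> (w - c 1)) ` (?X \<inter> ball b r)" by (rule image_eqI)
    then have "z \<in> T b" unfolding T_def using \<zeta>(1) by (auto simp: Z_def)
    then show "z \<in> (\<Union>b\<in>?P. T b)" using bP by blast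
  qed
  have Tb: "hausdorff_content s (T b) \<le> ennreal (real M * (D * norm b powr ?E))" if b: "b \<in> ?P" for b
  proof -
    \<comment> \<open>The extra 4 is the price of replacing \<open>b - c 1\<close> by
      \<open>b\<close>: its modulus is at least \<open>norm b / 2\<close> and the exponent is at
      least -2.\<close>
    define L where "L = 4 * K * norm a powr (- \<beta> / real M) * norm b powr (- 1 - 1 / real M)"
    have b1: "R1 \<le> norm (b - c 1)" "norm b / 2 \<le> norm (b - c 1)" "1 \<le> norm b" using bc[OF b] by auto
    have L0: "0 < L" unfolding L_def using K a1 b1 by (intro mult_pos_pos) auto
    have i: "0 \<le> 1 / real m" "1 / real M \<le> 1 / real m" using m by (auto intro!: divide_left_mono)
    have Lle: "K * norm a powr (- \<beta> / real m) * norm (b - c 1) powr (- 1 - 1 / real m) \<le> L"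
    proof -
      have "norm a powr (- \<beta> / real m) \<le> norm a powr (- \<beta> / real M)"
        using a1 m beta by (intro powr_mono) (auto intro!: divide_left_mono)
      moreover have "norm (b - c 1) powr (- 1 - 1 / real m) \<le> 4 * norm b powr (- 1 - 1 / real M)"
      proof -
        have "norm (b - c 1) powr (- 1 - 1 / real m) \<le> (norm b / 2) powr (- 1 - 1 / real m)"
          by (rule powr_mono2') (use i b1 in linarith)+
        also have "\<dots> = norm b powr (- 1 - 1 / real m) * 2 powr (1 + 1 / real m)"
          using b1 by (simp add: powr_divide powr_minus_divide field_simps powr_diff powr_add)
        also have "\<dots> \<le> norm b powr (- 1 - 1 / real M) * 2 powr 2"
          using i m b1 by (intro mult_mono powr_mono) auto
        finally show ?thesis by (simp add: powr_numeral)
      qed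
      ultimately have "K * norm a powr (- \<beta> / real m) * norm (b - c 1) powr (- 1 - 1 / real m)
          \<le> K * norm a powr (- \<beta> / real M) * (4 * norm b powr (- 1 - 1 / real M))"
        using K by (intro mult_mono) auto
      then show ?thesis by (simp add: L_def mult_ac)
    qed
    have one: "hausdorff_content s ((\<lambda>w. g b \<xi> (w - c 1)) ` (?X \<inter> ball b r)) \<le> ennreal (D * norm b powr ?E)"
      if \<xi>: "\<xi> \<in> Z" for \<xi>
    proof -
      have "hausdorff_content s ((\<lambda>w. g b \<xi> (w - c 1)) ` (?X \<inter> ball b r))
          \<le> ennreal (L powr s) * hausdorff_content s (?X \<inter> ball b r)"
      proof (rule hausdorff_content_lipschitz_image[OF s L0])
        fix x y assume xy: "x \<in> ?X \<inter> ball b r" "y \<in> ?X \<inter> ball b r"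
        have inb: "u - c 1 \<in> ball (b - c 1) (2 * r)" if "u \<in> ball b r" for u
        proof -
          have "dist (b - c 1) (u - c 1) = dist b u" by (simp add: dist_norm)
          then show ?thesis using that r by auto
        qed
        have "dist (g b \<xi> (x - c 1)) (g b \<xi> (y - c 1))
          \<le> K * norm a powr (- \<beta> / real m) * norm (b - c 1) powr (- 1 - 1 / real m) * dist (x - c 1) (y - c 1)"
          using xy \<xi> by (intro inverse_branches_lipschitz[OF g[OF b]] inb) (auto simp: Z_def)
        also have "\<dots> \<le> L * dist (x - c 1) (y - c 1)" by (rule mult_right_mono[OF Lle]) simp
        also have "dist (x - c 1) (y - c 1) = dist x y" by (simp add: dist_norm)
        finally show "dist (g b \<xi> (x - c 1)) (g b \<xi> (y - c 1)) \<le> L * dist x y" .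
      qed
      also have "\<dots> \<le> ennreal (L powr s) * ennreal ((1 / 2) ^ n * (2 * K) powr s * norm b powr (- s * \<beta> / real M))"
        using b by (intro mult_left_mono Suc.IH small_seq_shift Suc.prems) auto
      also have "\<dots> = ennreal (L powr s * ((1 / 2) ^ n * (2 * K) powr s * norm b powr (- s * \<beta> / real M)))"
        by (rule ennreal_mult[symmetric]) auto
      also have "L powr s * ((1 / 2) ^ n * (2 * K) powr s * norm b powr (- s * \<beta> / real M)) = D * norm b powr ?E"
      proof -
        have "L powr s = (4 * K) powr s * norm a powr (- s * \<beta> / real M) * norm b powr (- s * (1 + 1 / real M))"
          unfolding L_def using K by (simp add: powr_mult powr_powr algebra_simps)
        moreover have "norm b powr ?E = norm b powr (- s * (1 + 1 / real M)) * norm b powr (- s * \<beta> / real M)"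
          by (simp add: powr_add[symmetric] algebra_simps)
        ultimately show ?thesis by (simp add: D_def mult_ac)
      qed
      finally show ?thesis .
    qed
    show ?thesis
      unfolding T_def
    proof (rule hausdorff_content_UN_countable[OF _ one])
      show "countable Z" using Z by (simp add: countable_finite)
      show "0 \<le> D * norm b powr ?E" for \<xi> using D0 by simp
      fix F assume F: "finite F" "F \<subseteq> Z"
      have "card F \<le> M" using card_mono[OF Z(1) F(2)] Z(2) by simp
      then show "(\<Sum>\<xi>\<in>F. D * norm b powr ?E) \<le> real M * (D * norm b powr ?E)"
        using D0 by (simp add: mult_right_mono)
    qed
  qed
  have "hausdorff_content s (large_orbits f R c \<inter> ball a r) \<le> hausdorff_content s (\<Union>b\<in>?P. T b)"
    by (rule hausdorff_content_mono[OF cov])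
  also have "\<dots> \<le> ennreal (real M * D * (1 / (2 * real M * (4 * K) powr s)))"
  proof (rule hausdorff_content_UN_countable[OF _ Tb])
    show "countable ?P" using countable_poles by (rule countable_subset[rotated]) auto
    show "0 \<le> real M * (D * norm b powr ?E)" for b using D0 by simp
    fix F assume F: "finite F" "F \<subseteq> ?P"
    have "(\<Sum>b\<in>F. real M * (D * norm b powr ?E)) = real M * D * (\<Sum>b\<in>F. norm b powr ?E)"
      by (simp add: sum_distrib_left mult.assoc)
    also have "\<dots> \<le> real M * D * (1 / (2 * real M * (4 * K) powr s))"
      using D0 by (intro mult_left_mono sum[OF F]) auto
    finally show "(\<Sum>b\<in>F. real M * (D * norm b powr ?E)) \<le> real M * D * (1 / (2 * real M * (4 * K) powr s))" .
  qed
  \<comment> \<open>\<open>M\<close> counts the branches and \<open>(4 * K) powr s\<close> sits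
    inside \<open>D\<close>; both cancel against the smallness assumption, leaving the additional
    1/2.\<close>
  also have "real M * D * (1 / (2 * real M * (4 * K) powr s)) =
      (1 / 2) ^ Suc n * (2 * K) powr s * norm a powr (- s * \<beta> / real M)"
    using M K by (simp add: D_def)
  finally show ?case .
qed

lemma null_large_orbits:
  assumes s: "0 < s" and M: "1 \<le> M" and R: "R1 + 2 \<le> R"
    and sum: "\<And>F. finite F \<Longrightarrow> F \<subseteq> {b\<in>poles f. R - 1 \<le> norm b} \<Longrightarrow>
      (\<Sum>b\<in>F. norm b powr (- s * (1 + 1 / real M + \<beta> / real M))) \<le> 1 / (2 * real M * (4 * K) powr s)"
    and c: "small_seq c"
  shows "hausdorff_content s (large_orbits f R c) = 0"
proof -
  let ?P = "{b\<in>poles f. R - 1 \<le> norm b}"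
  have zero: "hausdorff_content s (large_orbits f R c \<inter> ball a r) = 0" if a: "a \<in> ?P" for a
  proof -
    define B where "B = (2 * K) powr s * norm a powr (- s * \<beta> / real M)"
    have "hausdorff_content s (large_orbits f R c \<inter> ball a r) \<le> ennreal ((1 / 2) ^ n * B)" for n
      using content_near_pole_le[OF s M R sum c, of a n] a by (simp add: B_def mult.assoc)
    moreover have "(\<lambda>n. ennreal ((1 / 2) ^ n * B)) \<longlonglongrightarrow> ennreal (0 * B)"
      by (intro tendsto_ennrealI tendsto_intros LIMSEQ_realpow_zero) auto
    ultimately have "hausdorff_content s (large_orbits f R c \<inter> ball a r) \<le> ennreal (0 * B)"
      by (intro LIMSEQ_le_const) auto
    then show ?thesis by simp
  qed
  have "countable ?P" using countable_poles by (rule countable_subset[rotated]) auto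
  then have "hausdorff_content s (\<Union>a\<in>?P. large_orbits f R c \<inter> ball a r) = 0"
    using zero by (rule hausdorff_content_zero_UN)
  moreover have "large_orbits f R c \<subseteq> (\<Union>a\<in>?P. large_orbits f R c \<inter> ball a r)"
  proof
    fix z assume z: "z \<in> large_orbits f R c"
    obtain a where "a \<in> poles f" "z \<in> ball a r - {a}" "R - 1 < norm a"
      using large_orbits_near_pole[OF c R z] by blast
    then show "z \<in> (\<Union>a\<in>?P. large_orbits f R c \<inter> ball a r)" using z by (intro UN_I[of a]) auto
  qed
  ultimately show ?thesis by (rule hausdorff_content_zero_subset)
qed

section \<open>Lower bound: a Cantor set of escaping points\<close>

text \<open>Choosing one inverse branch between consecutive poles and pulling back closed discs
  gives nested compact sets; a common point follows the itinerary.\<close>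

lemma itinerary_realized:
  assumes c: "small_seq c" and \<omega>: "\<And>j. \<omega> j \<in> poles f" "\<And>j. R1 + 1 \<le> norm (\<omega> j)"
  shows "\<exists>z. \<forall>n. Fcomp f c n z \<in> ball (\<omega> n) r - {\<omega> n}"
proof -
  have "\<exists>G. continuous_on (cball (\<omega> (Suc j)) r) G \<and>
      (\<forall>y\<in>cball (\<omega> (Suc j)) r. G y \<in> ball (\<omega> j) r - {\<omega> j} \<and> f (G y) + c (Suc j) = y)" for j
  proof -
    let ?b = "\<omega> (Suc j) - c (Suc j)"
    have "norm (c (Suc j)) < 1" using c by (simp add: small_seq_def)
    then have "R1 \<le> norm ?b" using \<omega>(2)[of "Suc j"] norm_triangle_ineq2[of "\<omega> (Suc j)" "c (Suc j)"] by linarith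
    moreover have "R1 \<le> norm (\<omega> j)" using \<omega>(2)[of j] by simp
    ultimately obtain g where g: "\<And>w. w \<in> ball ?b (2 * r) \<Longrightarrow> g w \<in> ball (\<omega> j) r - {\<omega> j} \<and> f (g w) = w"
      "\<And>w w'. w \<in> ball ?b (2 * r) \<Longrightarrow> w' \<in> ball ?b (2 * r) \<Longrightarrow> dist (g w) (g w') \<le> 1 / 2 * dist w w'"
      using branch_exists[OF \<omega>(1)[of j], of ?b] by blast
    have inb: "y - c (Suc j) \<in> ball ?b (2 * r)" if "y \<in> cball (\<omega> (Suc j)) r" for y
    proof -
      have "dist ?b (y - c (Suc j)) = dist (\<omega> (Suc j)) y" by (simp add: dist_norm)
      then show ?thesis using that r by auto
    qed
    have "(1 / 2)-lipschitz_on (cball (\<omega> (Suc j)) r) (\<lambda>y. g (y - c (Suc j)))"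
    proof (rule lipschitz_onI)
      fix x y assume "x \<in> cball (\<omega> (Suc j)) r" "y \<in> cball (\<omega> (Suc j)) r"
      then have "dist (g (x - c (Suc j))) (g (y - c (Suc j))) \<le> 1 / 2 * dist (x - c (Suc j)) (y - c (Suc j))"
        by (intro g(2) inb)
      then show "dist (g (x - c (Suc j))) (g (y - c (Suc j))) \<le> 1 / 2 * dist x y" by (simp add: dist_norm)
    qed simp
    then have "continuous_on (cball (\<omega> (Suc j)) r) (\<lambda>y. g (y - c (Suc j)))"
      by (rule lipschitz_on_continuous_on)
    moreover have "\<forall>y\<in>cball (\<omega> (Suc j)) r. g (y - c (Suc j)) \<in> ball (\<omega> j) r - {\<omega> j} \<and> f (g (y - c (Suc j))) + c (Suc j) = y"
    proof
      fix y assume "y \<in> cball (\<omega> (Suc j)) r"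
      from g(1)[OF inb[OF this]]
      show "g (y - c (Suc j)) \<in> ball (\<omega> j) r - {\<omega> j} \<and> f (g (y - c (Suc j))) + c (Suc j) = y" by simp
    qed
    ultimately show ?thesis by blast
  qed
  then obtain G where Gc: "\<And>j. continuous_on (cball (\<omega> (Suc j)) r) (G j)"
    and G: "\<And>j y. y \<in> cball (\<omega> (Suc j)) r \<Longrightarrow> G j y \<in> ball (\<omega> j) r - {\<omega> j} \<and> f (G j y) + c (Suc j) = y"
    by metis
  \<comment> \<open>The new map enters innermost, so \<open>\<phi> n\<close> is the composition of
    \<open>G 0\<close>, ..., \<open>G (n - 1)\<close> in this order, and the discs nest.\<close>
  define \<phi> where "\<phi> = rec_nat (\<lambda>y::complex. y) (\<lambda>n h y. h (G n y))"
  have \<phi>0: "\<phi> 0 y = y" and \<phi>S: "\<phi> (Suc n) y = \<phi> n (G n y)" for n y by (simp_all add: \<phi>_def)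
  have Gin: "G j y \<in> cball (\<omega> j) r" if "y \<in> cball (\<omega> (Suc j)) r" for j y using G[OF that] by auto
  have F\<phi>: "Fcomp f c n (\<phi> n y) = y" if "y \<in> cball (\<omega> n) r" for n y
    using that
  proof (induction n arbitrary: y)
    case (Suc n)
    then show ?case using G[OF Suc.prems] Gin[OF Suc.prems] by (simp add: \<phi>S Fcomp.simps(2))
  qed (simp add: \<phi>0)
  have cont\<phi>: "continuous_on (cball (\<omega> n) r) (\<phi> n)" for n
  proof (induction n)
    case 0
    have "\<phi> 0 = (\<lambda>y. y)" using \<phi>0 by auto
    then show ?case by (simp add: continuous_on_id)
  next
    case (Suc n)
    have "\<phi> (Suc n) = (\<lambda>y. \<phi> n (G n y))" using \<phi>S by auto
    then show ?case using continuous_on_compose2[OF Suc Gc[of n]] Gin by (simp add: image_subset_iff)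
  qed
  define D where "D n = \<phi> n ` cball (\<omega> n) r" for n
  have "\<Inter> (range D) \<noteq> {}"
  proof (rule compact_nest)
    show "compact (D n)" for n unfolding D_def by (intro compact_continuous_image cont\<phi>) auto
    show "D n \<noteq> {}" for n using r by (simp add: D_def)
    have "D (Suc n) \<subseteq> D n" for n unfolding D_def using Gin by (auto simp: \<phi>S)
    then show "D n \<subseteq> D k" if "k \<le> n" for k n using lift_Suc_antimono_le[of D] that by blast
  qed
  then obtain z where z: "\<And>n. z \<in> D n" by blast
  have "Fcomp f c n z \<in> ball (\<omega> n) r - {\<omega> n}" for n
  proof -
    \<comment> \<open>Looking one level deeper puts the \<open>n\<close>-th orbit point in the image
      of \<open>G n\<close>, that is, in the open punctured disc instead of just the closed
      disc.\<close>
    obtain y where y: "y \<in> cball (\<omega> (Suc n)) r" "z = \<phi> n (G n y)" using z[of "Suc n"] by (auto simp: D_def \<phi>S)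
    then have "Fcomp f c n z = G n y" using F\<phi>[OF Gin] by simp
    then show ?thesis using G[OF y(1)] by simp
  qed
  then show ?thesis by blast
qed

text \<open>An upper bound for the expansion, to be turned into a lower bound for the distance of
  the starting points. Both itineraries run through the same annuli, so the estimate for step
  \<open>k\<close> holds even if they differ at time \<open>Suc k\<close>. The factor
  \<open>2 powr \<beta>\<close> comes from \<open>norm (\<omega> j) < 2 * W j\<close>.\<close>

lemma itinerary_expansion:
  assumes c: "small_seq c" and W: "\<And>j. R1 \<le> W j"
    and \<omega>: "\<And>j. \<omega> j \<in> poles f \<and> pole_mult f (\<omega> j) = m \<and> W j \<le> norm (\<omega> j) \<and> norm (\<omega> j) < 2 * W j"
    and \<omega>': "\<And>j. \<omega>' j \<in> poles f \<and> pole_mult f (\<omega>' j) = m \<and> W j \<le> norm (\<omega>' j) \<and> norm (\<omega>' j) < 2 * W j"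
    and z: "\<And>n. Fcomp f c n z \<in> ball (\<omega> n) r - {\<omega> n}" and z': "\<And>n. Fcomp f c n z' \<in> ball (\<omega>' n) r - {\<omega>' n}"
    and agree: "\<And>j. j < k \<Longrightarrow> \<omega> j = \<omega>' j"
  shows "norm (Fcomp f c k z - Fcomp f c k z') \<le>
    (\<Prod>j<k. K * 2 powr \<beta> * W j powr (\<beta> / real m) * W (Suc j) powr (1 + 1 / real m)) * norm (z - z')"
  using agree
proof (induction k)
  case (Suc k)
  let ?F = "Fcomp f c"
  let ?L = "\<lambda>j. K * 2 powr \<beta> * W j powr (\<beta> / real m) * W (Suc j) powr (1 + 1 / real m)"
  have Wp: "8 \<le> W j" for j using W[of j] R1 by simp
  have a: "\<omega> k \<in> poles f" "R1 \<le> norm (\<omega> k)" "norm (\<omega> k) \<le> 2 * W k"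
    using \<omega>[of k] W[of k] by auto
  have m: "1 \<le> m" using mult[OF a(1,2)] \<omega>[of k] by auto
  \<comment> \<open>The radius of the disc and the translation together change the modulus by less
    than 2, harmless because \<open>W (Suc k) \<ge> 8\<close>.\<close>
  have mod: "W (Suc k) / 2 \<le> norm (f x) \<and> norm (f x) \<le> 4 * W (Suc k)"
    if "f x + c (Suc k) \<in> ball p r" "W (Suc k) \<le> norm p" "norm p < 2 * W (Suc k)" for x p
  proof -
    let ?y = "f x + c (Suc k)"
    have "norm (c (Suc k)) < 1" using c by (simp add: small_seq_def)
    moreover have "norm (p - ?y) < 1" using that(1) r by (simp add: dist_norm)
    moreover have "norm p \<le> norm ?y + norm (p - ?y)" "norm ?y \<le> norm p + norm (p - ?y)"
      by (metis norm_triangle_sub, metis norm_minus_commute norm_triangle_sub)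
    moreover have "norm ?y \<le> norm (f x) + norm (c (Suc k))" by (rule norm_triangle_ineq)
    moreover have "norm (f x) \<le> norm ?y + norm (c (Suc k))"
      using norm_triangle_ineq4[of ?y "c (Suc k)"] by simp
    ultimately show ?thesis using that(2,3) Wp[of "Suc k"] by linarith
  qed
  have "norm (f (?F k z) - f (?F k z')) \<le>
      K * norm (\<omega> k) powr (\<beta> / real m) * W (Suc k) powr (1 + 1 / real m) * norm (?F k z - ?F k z')"
  proof -
    have F: "?F (Suc k) x = f (?F k x) + c (Suc k)" for x by (simp add: Fcomp.simps(2))
    have "?F (Suc k) z \<in> ball (\<omega> (Suc k)) r" "?F (Suc k) z' \<in> ball (\<omega>' (Suc k)) r"
      using z[of "Suc k"] z'[of "Suc k"] by blast+
    then have mm: "W (Suc k) / 2 \<le> norm (f (?F k z)) \<and> norm (f (?F k z)) \<le> 4 * W (Suc k)"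
      "W (Suc k) / 2 \<le> norm (f (?F k z')) \<and> norm (f (?F k z')) \<le> 4 * W (Suc k)"
      unfolding F using mod \<omega>[of "Suc k"] \<omega>'[of "Suc k"] by blast+
    have zz: "?F k z \<in> ball (\<omega> k) r - {\<omega> k}" "?F k z' \<in> ball (\<omega> k) r - {\<omega> k}"
      using z[of k] z'[of k] Suc.prems[of k] by auto
    have "0 < W (Suc k)" using Wp[of "Suc k"] by simp
    then show ?thesis
      using expand[OF a(1,2) zz, of "W (Suc k)"] mm \<omega>[of k] by auto
  qed
  also have "\<dots> \<le> ?L k * norm (?F k z - ?F k z')"
  proof -
    have "norm (\<omega> k) powr (\<beta> / real m) \<le> (2 * W k) powr (\<beta> / real m)"
      using a beta by (intro powr_mono2) auto
    also have "\<dots> = 2 powr (\<beta> / real m) * W k powr (\<beta> / real m)"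
      using Wp[of k] by (simp add: powr_mult)
    also have "\<dots> \<le> 2 powr \<beta> * W k powr (\<beta> / real m)"
    proof (intro mult_right_mono powr_mono)
      show "\<beta> / real m \<le> \<beta>" using m beta mult_left_mono[of 1 "real m" \<beta>] by (simp add: divide_le_eq)
    qed auto
    finally have "K * norm (\<omega> k) powr (\<beta> / real m) * W (Suc k) powr (1 + 1 / real m)
        \<le> K * (2 powr \<beta> * W k powr (\<beta> / real m)) * W (Suc k) powr (1 + 1 / real m)"
      using K by (intro mult_right_mono mult_left_mono) auto
    then have "K * norm (\<omega> k) powr (\<beta> / real m) * W (Suc k) powr (1 + 1 / real m) \<le> ?L k"
      by (simp only: mult.assoc)
    then show ?thesis by (rule mult_right_mono) simp
  qed
  also have "\<dots> \<le> ?L k * ((\<Prod>j<k. ?L j) * norm (z - z'))"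
    using Suc K by (intro mult_left_mono) auto
  finally show ?case by (simp add: Fcomp.simps(2) mult_ac)
qed simp

text \<open>At the first time \<open>k\<close> where itineraries differ the orbits are at least
  \<open>r\<close> apart, so the starting points differ by \<open>r\<close> over the product of the
  expansion constants. In that product raised to \<open>t\<close>, the power of
  \<open>W (Suc j)\<close> from step \<open>j\<close> joins the power of \<open>W j\<close> from the
  following step, which gives the exponent \<open>t * (\<beta> / real m + (1 + 1 / real m))\<close>
  in \<open>good\<close>.\<close>

lemma escaping_content_nonzero:
  assumes c: "small_seq c" and t: "0 < t" and m: "1 \<le> m"
    and good: "\<And>Q B. \<exists>W\<ge>B. Q * W powr (t * (\<beta> / real m + (1 + 1 / real m)))
      \<le> real (card {a\<in>poles f. pole_mult f a = m \<and> W \<le> norm a \<and> norm a < 2 * W})"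
  shows "hausdorff_content t (escaping_julia f c) \<noteq> 0"
proof
  define e where "e = 1 + 1 / real m"
  define K2 where "K2 = K * 2 powr \<beta>"
  have e: "1 \<le> e" "e \<le> 2" using m by (auto simp: e_def)
  have K2: "1 \<le> K2"
    unfolding K2_def using mult_mono[OF K, of 1 "2 powr \<beta>"] K beta by (simp add: ge_one_powr_ge_zero)
  define A0 where "A0 W = {a\<in>poles f. pole_mult f a = m \<and> W \<le> norm a \<and> norm a < 2 * W}" for W
  \<comment> \<open>\<open>K2 powr t\<close> pays for the constant in each expansion factor; the
    additional 2 is the surplus per level that later offsets the growth of \<open>W\<close>.\<close>
  obtain W :: "nat \<Rightarrow> real" where W: "\<And>k. 2 * K2 powr t * W k powr (t * (\<beta> / real m + e)) \<le> real (card (A0 (W k)))"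
    "\<And>k. R1 + 4 \<le> W k" "\<And>k. W k powr (2 * t) \<le> W 0 powr (2 * t) * 2 ^ k" "filterlim W at_top sequentially"
    using slow_good_scales[of "\<lambda>W. 2 * K2 powr t * W powr (t * (\<beta> / real m + e)) \<le> real (card (A0 W))" "R1 + 4" "2 * t"]
      good R1 unfolding A0_def e_def by auto
  have W1: "1 \<le> W k" "0 < W k" for k using W(2)[of k] R1 by auto
  define A where "A k = A0 (W k)" for k
  have AD: "a \<in> A k \<longleftrightarrow> a \<in> poles f \<and> pole_mult f a = m \<and> W k \<le> norm a \<and> norm a < 2 * W k" for a k
    by (auto simp: A_def A0_def)
  have card2: "2 \<le> card (A k)" for k
  proof -
    have "1 \<le> K2 powr t" using K2 t by (simp add: ge_one_powr_ge_zero)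
    moreover have "1 \<le> W k powr (t * (\<beta> / real m + e))"
      using W1[of k] t e beta by (intro ge_one_powr_ge_zero) auto
    ultimately have "1 * 1 \<le> K2 powr t * W k powr (t * (\<beta> / real m + e))" by (intro mult_mono) auto
    then have "2 \<le> real (card (A k))" using W(1)[of k] by (simp add: A_def)
    then show ?thesis by linarith
  qed
  have "\<exists>z. \<forall>n. Fcomp f c n z \<in> ball (\<omega> n) r - {\<omega> n}" if "\<forall>j. \<omega> j \<in> A j" for \<omega>
  proof (rule itinerary_realized[OF c])
    show "\<omega> j \<in> poles f" "R1 + 1 \<le> norm (\<omega> j)" for j
      using that W(2)[of j] by (auto simp: AD intro: order_trans[of _ "W j"])
  qed
  then obtain z where z: "\<And>\<omega> n. \<forall>j. \<omega> j \<in> A j \<Longrightarrow> Fcomp f c n (z \<omega>) \<in> ball (\<omega> n) r - {\<omega> n}" by metis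
  define L where "L j = K * 2 powr \<beta> * W j powr (\<beta> / real m) * W (Suc j) powr (1 + 1 / real m)" for j
  have L0: "0 < L j" for j unfolding L_def using K W1 by (intro mult_pos_pos) (auto simp: less_imp_neq[symmetric])
  have PL0: "0 < (\<Prod>j<k. L j)" for k by (intro prod_pos) (use L0 in auto)
  define gap where "gap k = r / (\<Prod>j<k. L j)" for k
  \<comment> \<open>After regrouping, the powers of the scales match the alphabets level by level
    except at the ends; the unmatched part is \<open>(W 0 / W k) powr (t * e)\<close>.\<close>
  have mass: "2 ^ k * (W 0 / W k) powr (t * e) * (\<Prod>j<k. L j powr t) \<le> (\<Prod>j<k. real (card (A j)))" for k
  proof (induction k)
    case 0
    show ?case using W1[of 0] by simp
  next
    case (Suc k)
    have Lp: "L k powr t = K2 powr t * W k powr (t * (\<beta> / real m)) * W (Suc k) powr (t * e)"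
      unfolding L_def K2_def[symmetric] e_def[symmetric] using K2 W1
      by (simp add: powr_mult powr_powr mult.commute)
    have "2 ^ Suc k * (W 0 / W (Suc k)) powr (t * e) * (\<Prod>j<Suc k. L j powr t)
        = (2 ^ k * (W 0 / W k) powr (t * e) * (\<Prod>j<k. L j powr t)) *
          (2 * (W k / W (Suc k)) powr (t * e) * L k powr t)"
    proof -
      have "(W 0 / W (Suc k)) powr (t * e) = (W 0 / W k) powr (t * e) * (W k / W (Suc k)) powr (t * e)"
        using W1(2)[of 0] W1(2)[of k] W1(2)[of "Suc k"] by (simp add: powr_mult[symmetric])
      then show ?thesis by (simp add: mult_ac)
    qed
    also have "2 * (W k / W (Suc k)) powr (t * e) * L k powr t = 2 * K2 powr t * W k powr (t * (\<beta> / real m + e))"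
      unfolding Lp using W1(2)[of k] W1(2)[of "Suc k"] by (simp add: powr_divide distrib_left powr_add)
    also have "(2 ^ k * (W 0 / W k) powr (t * e) * (\<Prod>j<k. L j powr t)) * (2 * K2 powr t * W k powr (t * (\<beta> / real m + e)))
        \<le> (\<Prod>j<k. real (card (A j))) * real (card (A k))"
      using Suc W(1)[of k] by (intro mult_mono) (auto simp: A_def intro!: prod_nonneg)
    finally show ?case by simp
  qed
  define K' where "K' = W 0 powr (2 * t) / r powr t"
  have K'0: "0 < K'" using W1(2)[of 0] r by (simp add: K'_def)
  have "hausdorff_content t (z ` {\<omega>. \<forall>j. \<omega> j \<in> A j}) \<noteq> 0"
  proof (rule cantor_set_content_nonzero[OF card2 t K'0])
    show "0 < gap k" for k using PL0 r by (simp add: gap_def)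
    show "1 \<le> K' * gap k powr t * (\<Prod>j<k. real (card (A j)))" for k
    proof -
      \<comment> \<open>Here the slow growth enters: since \<open>e \<le> 2\<close>, the surplus
        \<open>2 ^ k\<close> covers the unmatched power of \<open>W k\<close>.\<close>
      have "W k powr (t * e) \<le> W k powr (2 * t)"
        using W1(1)[of k] e t by (intro powr_mono) (auto simp: mult.commute)
      also have "\<dots> \<le> W 0 powr (2 * t) * 2 ^ k" by (rule W(3))
      also have "\<dots> \<le> W 0 powr (2 * t) * 2 ^ k * W 0 powr (t * e)"
        using ge_one_powr_ge_zero[OF W1(1)[of 0], of "t * e"] t e
          mult_left_mono[of 1 "W 0 powr (t * e)" "W 0 powr (2 * t) * 2 ^ k"] by simp
      finally have 1: "1 \<le> W 0 powr (2 * t) * (2 ^ k * (W 0 / W k) powr (t * e))"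
        using W1(2)[of k] W1(2)[of 0] by (simp add: powr_divide field_simps)
      have "gap k powr t = r powr t / (\<Prod>j<k. L j powr t)"
        unfolding gap_def using r L0 PL0[of k] by (subst powr_divide) (auto simp: prod_powr_distrib less_imp_le)
      then have "K' * gap k powr t * (\<Prod>j<k. real (card (A j))) =
          W 0 powr (2 * t) * ((\<Prod>j<k. real (card (A j))) / (\<Prod>j<k. L j powr t))"
        using r by (simp add: K'_def)
      also have "\<dots> \<ge> W 0 powr (2 * t) * (2 ^ k * (W 0 / W k) powr (t * e))"
      proof (rule mult_left_mono)
        have "0 < (\<Prod>j<k. L j powr t)" using L0 by (intro prod_pos) (auto simp: less_imp_neq[symmetric])
        then show "2 ^ k * (W 0 / W k) powr (t * e) \<le> (\<Prod>j<k. real (card (A j))) / (\<Prod>j<k. L j powr t)"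
          using mass[of k] by (simp add: le_divide_eq)
      qed simp
      finally show ?thesis using 1 by linarith
    qed
    fix \<omega> \<omega>' k
    assume w: "\<And>j. \<omega> j \<in> A j" "\<And>j. \<omega>' j \<in> A j" and agree: "\<And>j. j < k \<Longrightarrow> \<omega> j = \<omega>' j" and ne: "\<omega> k \<noteq> \<omega>' k"
    have zw: "Fcomp f c n (z \<omega>) \<in> ball (\<omega> n) r - {\<omega> n}" "Fcomp f c n (z \<omega>') \<in> ball (\<omega>' n) r - {\<omega>' n}" for n
      using z w by blast+
    have "norm (Fcomp f c k (z \<omega>) - Fcomp f c k (z \<omega>')) \<le> (\<Prod>j<k. L j) * norm (z \<omega> - z \<omega>')"
      unfolding L_def
    proof (rule itinerary_expansion[OF c _ _ _ zw agree])
      show "R1 \<le> W j" for j using W(2)[of j] by simp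
    qed (use w AD in auto)
    moreover have "r \<le> dist (Fcomp f c k (z \<omega>)) (Fcomp f c k (z \<omega>'))"
    proof -
      \<comment> \<open>Different poles are \<open>8 * r\<close> apart and each orbit point is
        within \<open>r\<close> of its pole, which leaves more than \<open>r\<close>.\<close>
      have "8 * r \<le> dist (\<omega> k) (\<omega>' k)" using sep[of "\<omega> k" "\<omega>' k"] w ne AD by auto
      moreover have "dist (\<omega> k) (\<omega>' k) \<le> dist (\<omega> k) (Fcomp f c k (z \<omega>)) +
          dist (Fcomp f c k (z \<omega>)) (Fcomp f c k (z \<omega>')) + dist (\<omega>' k) (Fcomp f c k (z \<omega>'))"
        using dist_triangle[of "\<omega> k" "\<omega>' k" "Fcomp f c k (z \<omega>)"]
          dist_triangle2[of "Fcomp f c k (z \<omega>)" "\<omega>' k" "Fcomp f c k (z \<omega>')"] by linarith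
      ultimately show ?thesis using zw[of k] r by auto
    qed
    ultimately have "r \<le> (\<Prod>j<k. L j) * dist (z \<omega>) (z \<omega>')" by (simp add: dist_norm)
    then show "gap k \<le> dist (z \<omega>) (z \<omega>')" unfolding gap_def using PL0[of k] by (simp add: field_simps)
  qed
  moreover have "z ` {\<omega>. \<forall>j. \<omega> j \<in> A j} \<subseteq> escaping_julia f c"
  proof
    fix x assume "x \<in> z ` {\<omega>. \<forall>j. \<omega> j \<in> A j}"
    then obtain \<omega> where w: "\<forall>j. \<omega> j \<in> A j" "x = z \<omega>" by blast
    have zx: "Fcomp f c n x \<in> ball (\<omega> n) r - {\<omega> n}" for n using z[OF w(1)] w(2) by blast
    have big: "W n - 1 < norm (Fcomp f c n x)" for n
    proof -
      have "norm (\<omega> n) \<le> norm (Fcomp f c n x) + norm (\<omega> n - Fcomp f c n x)" by (metis norm_triangle_sub)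
      moreover have "norm (\<omega> n - Fcomp f c n x) < 1" using zx[of n] r by (simp add: dist_norm)
      moreover have "W n \<le> norm (\<omega> n)" using w(1) AD by blast
      ultimately show ?thesis by linarith
    qed
    have np: "Fcomp f c n x \<notin> poles f" for n using ball_pole[OF _ zx[of n]] w(1) AD by blast
    have "R1 + 2 < norm (Fcomp f c n x)" for n using big[of n] W(2)[of n] by linarith
    then have "x \<in> large_orbits f (R1 + 2) c" using np by (simp add: large_orbits_def)
    then have "x \<in> julia_set f c" using large_orbits_subset_julia[OF c order_refl] by blast
    moreover have "filterlim (\<lambda>n. Fcomp f c n x) at_infinity sequentially"
    proof (rule filterlim_norm_at_top_imp_at_infinity)
      have "filterlim (\<lambda>n. - 1 + W n) at_top sequentially"
        by (rule filterlim_tendsto_add_at_top[OF tendsto_const W(4)])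
      then show "filterlim (\<lambda>n. norm (Fcomp f c n x)) at_top sequentially"
        by (rule filterlim_at_top_mono) (use big in \<open>auto intro!: always_eventually simp: less_imp_le\<close>)
    qed
    ultimately show "x \<in> escaping_julia f c" using np by (simp add: escaping_julia_def orbit_defined_def)
  qed
  moreover assume "hausdorff_content t (escaping_julia f c) = 0"
  ultimately show False using hausdorff_content_zero_subset by blast
qed

end

section \<open>The standing hypotheses\<close>

lemma finite_separated_cball:
  fixes P :: "complex set"
  assumes D: "0 < D" and sep: "\<And>a b. a \<in> P \<Longrightarrow> b \<in> P \<Longrightarrow> a \<noteq> b \<Longrightarrow> D \<le> dist a b"
  shows "finite (P \<inter> cball 0 B)"
proof (rule ccontr)
  assume inf: "infinite (P \<inter> cball 0 B)"
  have "bounded (P \<inter> cball 0 B)" by (simp add: bounded_Int)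
  then obtain x where x: "x islimpt (P \<inter> cball 0 B)"
    using bounded_infinite_imp_islimpt[OF order_refl _ inf] by blast
  obtain a where a: "a \<in> P" "a \<noteq> x" "dist a x < D / 2"
    using x D unfolding islimpt_approachable by (meson IntD1 half_gt_zero)
  obtain b where b: "b \<in> P" "b \<noteq> x" "dist b x < min (D / 2) (dist a x)"
    using x D a unfolding islimpt_approachable by (metis IntD1 half_gt_zero min_less_iff_conj zero_less_dist_iff)
  have "a \<noteq> b" using b by auto
  then show False using sep[OF a(1) b(1)] a(3) b(3) dist_triangle2[of a b x] by auto
qed

text \<open>The complement of the countable closed pole set is open and connected, so a non-constant
  derivative has countably many zeros there. A derivative vanishing identically would make
  \<open>f\<close> constant off the poles, contradicting transcendence.\<close>

lemma countable_critical_points: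
  assumes tr: "transcendental_mero f" and cl: "closed (poles f)" and ct: "countable (poles f)"
  shows "countable {z \<in> - poles f. deriv f z = 0}"
proof -
  have hol: "f holomorphic_on - poles f"
    using tr by (simp add: transcendental_mero_def entire_meromorphic_def)
  have op: "open (- poles f)" using cl by (simp add: open_Compl)
  have con: "connected (- poles f)"
    using connected_open_diff_countable[of "UNIV :: complex set" "poles f"] ct connected_UNIV
    by (simp add: Compl_eq_Diff_UNIV)
  have fsig: "fsigma (- poles f)"
  proof -
    obtain Q :: "nat \<Rightarrow> complex set" where Q: "\<And>n. compact (Q n)" "\<Union>(range Q) = - poles f"
      using open_Union_compact_subsets[OF op] by metis
    have "fsigma (\<Union>(range Q))" by (rule fsigma.intros) (rule compact_imp_closed[OF Q(1)])
    then show ?thesis using Q(2) by simp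
  qed
  show ?thesis
  proof (cases "deriv f constant_on (- poles f)")
    case False
    then show ?thesis
      using holomorphic_countable_zeros[OF holomorphic_deriv[OF hol op] op con] fsig by blast
  next
    case True
    then obtain k where k: "\<And>z. z \<in> - poles f \<Longrightarrow> deriv f z = k" unfolding constant_on_def by blast
    show ?thesis
    proof (cases "k = 0")
      case False
      then have "{z \<in> - poles f. deriv f z = 0} = {}" using k by auto
      then show ?thesis by (metis countable_empty)
    next
      case True
      have "(f has_field_derivative 0) (at z)" if "z \<in> - poles f" for z
        using holomorphic_derivI[OF hol op that] k[OF that] True by simp
      then obtain w where w: "\<And>z. z \<in> - poles f \<Longrightarrow> f z = w"
        using DERIV_zero_connected_constant[OF con op finite.emptyI holomorphic_on_imp_continuous_on[OF hol]] by blast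
      \<comment> \<open>Near a pole \<open>f\<close> exceeds its constant value in modulus, so all
        nearby points would have to be poles, against countability.\<close>
      have "poles f = {}"
      proof (rule ccontr)
        assume "poles f \<noteq> {}"
        then obtain a where a: "a \<in> poles f" by blast
        then have fl: "filterlim f at_infinity (at a)" by (simp add: poles_def is_pole_def)
        have "eventually (\<lambda>z. norm w + 1 \<le> norm (f z)) (at a)"
          using fl unfolding filterlim_at_infinity[OF order_refl] by (simp add: add_nonneg_pos)
        then obtain d where d: "0 < d" "\<And>z. z \<noteq> a \<Longrightarrow> dist z a < d \<Longrightarrow> norm w + 1 \<le> norm (f z)"
          unfolding eventually_at by blast
        have "ball a d \<subseteq> poles f"
        proof
          fix z assume z: "z \<in> ball a d"
          show "z \<in> poles f"
          proof (rule ccontr)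
            assume "z \<notin> poles f"
            moreover from this have "z \<noteq> a" using a by blast
            ultimately show False using d(2)[of z] w[of z] z by (simp add: dist_commute)
          qed
        qed
        then show False using ct countable_subset uncountable_ball[OF d(1)] by blast
      qed
      then have "rational_fun f"
        unfolding rational_fun_def using w by (intro exI[of _ "[:w:]"] exI[of _ 1]) auto
      then show ?thesis using tr by (simp add: transcendental_mero_def)
    qed
  qed
qed

text \<open>\<open>bounded_outside_pole_discs\<close> is applied to the complement \<open>S\<close>
  of the closed discs about the poles: its boundary lies on the circles, where \<open>f\<close> is
  uniformly bounded.\<close>

lemma near_pole_of_large_value:
  assumes noasym: "\<not> infinity_asymptotic_value f" and hol: "f holomorphic_on - poles f"
    and fin: "\<And>B. finite (poles f \<inter> cball 0 B)" and cl: "closed (poles f)" and r: "0 < r"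
    and sph: "\<And>a z. a \<in> poles f \<Longrightarrow> z \<in> sphere a r \<Longrightarrow> norm (f z) \<le> R"
  shows "\<exists>R2. \<forall>z. z \<notin> poles f \<and> R2 < norm (f z) \<longrightarrow> (\<exists>a\<in>poles f. z \<in> ball a r)"
proof -
  have op: "open (- poles f)" using cl by (simp add: open_Compl)
  \<comment> \<open>Any point that is not a pole serves as the centre of the auxiliary disc;
    \<open>R2\<close> is then raised to dominate \<open>f\<close> on a neighbourhood of it.\<close>
  obtain z1 where z1: "z1 \<notin> poles f"
  proof -
    have "\<not> ball (0::complex) 1 \<subseteq> poles f \<inter> cball 0 1"
      using countable_subset[OF _ countable_finite[OF fin[of 1]], of "ball 0 1"]
        uncountable_ball[of 1 "0::complex"] zero_less_one by blast
    then show ?thesis using that by auto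
  qed
  have "isCont f z1"
    using holomorphic_on_imp_continuous_on[OF hol] op z1 by (simp add: continuous_on_eq_continuous_at)
  then obtain d where d: "0 < d" "\<And>z. dist z z1 < d \<Longrightarrow> dist (f z) (f z1) < 1"
    unfolding continuous_at_eps_delta by (metis zero_less_one)
  define R2 where "R2 = max R (norm (f z1) + 1)"
  define S where "S = - (\<Union>a\<in>poles f. cball a r)"
  \<comment> \<open>The union of the discs is the sum of a closed and a compact set, hence closed,
    although there may be infinitely many poles.\<close>
  have "(\<Union>x\<in>poles f. \<Union>y\<in>cball 0 r. {x + y}) = (\<Union>a\<in>poles f. cball a r)"
  proof (intro set_eqI iffI)
    fix z assume "z \<in> (\<Union>a\<in>poles f. cball a r)"
    then obtain a where a: "a \<in> poles f" "dist a z \<le> r" by auto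
    then have "z - a \<in> cball 0 r" "z = a + (z - a)" by (auto simp: dist_norm norm_minus_commute)
    then show "z \<in> (\<Union>x\<in>poles f. \<Union>y\<in>cball 0 r. {x + y})" using a(1) by blast
  next
    fix z assume "z \<in> (\<Union>x\<in>poles f. \<Union>y\<in>cball 0 r. {x + y})"
    then obtain x y where "x \<in> poles f" "norm y \<le> r" "z = x + y" by auto
    then show "z \<in> (\<Union>a\<in>poles f. cball a r)" by (intro UN_I[of x]) (auto simp: dist_norm)
  qed
  then have "closed (\<Union>a\<in>poles f. cball a r)"
    using closed_compact_sums[OF cl compact_cball, of 0 r] by simp
  then have S: "open S" unfolding S_def by (rule open_Compl)
  have clS: "closure S \<inter> ball a r = {}" if "a \<in> poles f" for a
  proof -
    have "S \<subseteq> - ball a r" using that ball_subset_cball[of a r] unfolding S_def by blast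
    then have "closure S \<subseteq> - ball a r" by (intro closure_minimal) auto
    then show ?thesis by blast
  qed
  have "norm (f z) \<le> R2" if z: "z \<in> S" for z
  proof (rule bounded_outside_pole_discs[OF noasym S _ hol op _ _ d(1) _ z, of _ z1])
    have "\<And>a. a \<in> poles f \<Longrightarrow> a \<in> ball a r" using r by simp
    then show "closure S \<inter> poles f = {}" using clS by blast
    show "0 < R2" unfolding R2_def by (simp add: less_max_iff_disj add_nonneg_pos)
    show "norm (f z) \<le> R2" if "z \<in> frontier S" for z
    proof -
      have zf: "z \<in> closure S" "z \<notin> S" using that S by (auto simp: frontier_def interior_open)
      then obtain a where a: "a \<in> poles f" "z \<in> cball a r" by (auto simp: S_def)
      then have "z \<in> sphere a r" using clS[OF a(1)] zf(1) by (auto simp: disjoint_iff)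
      then have "norm (f z) \<le> R" by (rule sph[OF a(1)])
      then show ?thesis by (simp add: R2_def)
    qed
    show "norm (f z) \<le> R2" if "z \<in> ball z1 d" for z
      using d(2)[of z] that norm_triangle_sub[of "f z" "f z1"] by (auto simp: R2_def dist_norm dist_commute norm_minus_commute)
  qed
  then have "\<exists>a\<in>poles f. z \<in> ball a r" if "z \<notin> poles f" "R2 < norm (f z)" for z
  proof -
    have "z \<notin> S" using that \<open>\<And>z. z \<in> S \<Longrightarrow> norm (f z) \<le> R2\<close> by fastforce
    then obtain a where a: "a \<in> poles f" "z \<in> cball a r" by (auto simp: S_def)
    moreover have "z \<notin> sphere a r" using sph[OF a(1), of z] that(2) by (auto simp: R2_def)
    ultimately show ?thesis by (auto intro!: bexI[of _ a] simp: less_le)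
  qed
  then show ?thesis by blast
qed

lemma pole_system_exists:
  fixes f :: "complex \<Rightarrow> complex" and D \<beta> C :: real and M :: nat
  assumes tr: "transcendental_mero f" and noasym: "\<not> infinity_asymptotic_value f"
    and Pstar: "finite (poles f - Pstar)"
    and D: "0 < D" and sepD: "\<And>a b. a \<in> poles f \<Longrightarrow> b \<in> poles f \<Longrightarrow> a \<noteq> b \<Longrightarrow> D \<le> dist a b"
    and beta: "0 \<le> \<beta>" and C: "1 \<le> C"
    and mult: "\<And>a. a \<in> Pstar \<Longrightarrow> 1 \<le> pole_mult f a \<and> pole_mult f a \<le> M"
    and lo: "\<And>a z. a \<in> Pstar \<Longrightarrow> a \<in> poles f \<Longrightarrow> 1 \<le> norm a \<Longrightarrow> z \<in> ball a D - {a} \<Longrightarrow>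
      norm a powr (- \<beta>) / norm (z - a) ^ pole_mult f a / C \<le> norm (f z)"
    and up: "\<And>a z. a \<in> Pstar \<Longrightarrow> a \<in> poles f \<Longrightarrow> 1 \<le> norm a \<Longrightarrow> z \<in> ball a D - {a} \<Longrightarrow>
      norm (f z) \<le> C * (norm a powr (- \<beta>) / norm (z - a) ^ pole_mult f a)"
  shows "\<exists>r R1 K. pole_system f \<beta> M r R1 K \<and> (\<forall>a\<in>poles f. R1 \<le> norm a \<longrightarrow> a \<in> Pstar)"
proof -
  have hol: "f holomorphic_on - poles f"
    using tr by (simp add: transcendental_mero_def entire_meromorphic_def)
  have fin: "finite (poles f \<inter> cball 0 B)" for B by (rule finite_separated_cball[OF D sepD])
  have cl: "closed (poles f)" by (rule closed_locally_finite[OF fin])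
  have ct: "countable (poles f)" by (rule countable_locally_finite[OF fin])
  have C2: "1 \<le> C\<^sup>2" using C by (simp add: one_le_power)
  \<comment> \<open>One radius for two purposes: at most \<open>D / (4 * C\<^sup>2)\<close> for the
    charts and at most \<open>D / 8\<close> for the separation.\<close>
  define r where "r = min (1 / 4) (D / (8 * C\<^sup>2))"
  have r: "0 < r" "r \<le> 1 / 4" "r \<le> D / (4 * C\<^sup>2)" "8 * r \<le> D"
  proof -
    show "0 < r" "r \<le> 1 / 4" using D C by (auto simp: r_def)
    have "D / (8 * C\<^sup>2) \<le> D / (4 * C\<^sup>2)" using D C2 by (intro divide_left_mono) auto
    then show "r \<le> D / (4 * C\<^sup>2)" by (simp add: r_def)
    have "D / (8 * C\<^sup>2) \<le> D / 8" using D C2 by (intro divide_left_mono) auto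
    then show "8 * r \<le> D" by (simp add: r_def)
  qed
  have ballP: "ball a D - {a} \<subseteq> - poles f" if "a \<in> poles f" for a
    using sepD[OF that] by force
  \<comment> \<open>Finitely many poles are set aside: those outside \<open>Pstar\<close> and those
    in the closed unit disc. They matter only for the bound of \<open>f\<close> on circles, where
    compactness replaces the estimates, and all lie below \<open>R1\<close>.\<close>
  define bad where "bad = (poles f - Pstar) \<union> (poles f \<inter> cball 0 1)"
  have fbad: "finite bad" using Pstar fin by (simp add: bad_def)
  have good: "a \<in> Pstar \<and> 1 \<le> norm a" if "a \<in> poles f" "a \<notin> bad" for a using that by (auto simp: bad_def)
  have sphD: "sphere a r \<subseteq> ball a D - {a}" for a using r D by auto
  have "\<exists>R. \<forall>a\<in>poles f. \<forall>z\<in>sphere a r. norm (f z) \<le> R"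
  proof -
    have "compact (f ` sphere a r)" if "a \<in> poles f" for a
      using sphD ballP[OF that] by (intro compact_continuous_image continuous_on_subset[OF holomorphic_on_imp_continuous_on[OF hol]]) auto
    then have "bounded (\<Union>a\<in>bad. f ` sphere a r)"
      using fbad by (intro bounded_UN) (auto simp: bad_def compact_imp_bounded)
    then obtain B where B: "\<And>a z. a \<in> bad \<Longrightarrow> z \<in> sphere a r \<Longrightarrow> norm (f z) \<le> B"
      unfolding bounded_iff by blast
    have "norm (f z) \<le> max B (C * (1 / r) ^ M)" if a: "a \<in> poles f" and z: "z \<in> sphere a r" for a z
    proof (cases "a \<in> bad")
      case True
      then show ?thesis using B z by (auto simp: le_max_iff_disj)
    next
      case False
      then have g: "a \<in> Pstar" "1 \<le> norm a" using good a by auto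
      let ?m = "pole_mult f a"
      have zr: "norm (z - a) = r" using z by (simp add: dist_norm norm_minus_commute)
      have "z \<in> ball a D - {a}" using z sphD by blast
      from up[OF g(1) a g(2) this] have "norm (f z) \<le> C * (norm a powr (- \<beta>) / r ^ ?m)" by (simp add: zr)
      also have "\<dots> \<le> C * (1 / r ^ ?m)"
      proof -
        have "norm a powr (- \<beta>) \<le> norm a powr 0" using g beta by (intro powr_mono) auto
        also have "\<dots> \<le> 1" by simp
        finally show ?thesis using C r by (intro mult_left_mono divide_right_mono) auto
      qed
      also have "1 / r ^ ?m = (1 / r) ^ ?m" by (simp add: power_one_over)
      also have "C * (1 / r) ^ ?m \<le> C * (1 / r) ^ M"
        using C r mult[OF g(1)] by (intro mult_left_mono power_increasing) auto
      finally show ?thesis by simp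
    qed
    then show ?thesis by blast
  qed
  then obtain R where R: "\<And>a z. a \<in> poles f \<Longrightarrow> z \<in> sphere a r \<Longrightarrow> norm (f z) \<le> R" by blast
  obtain R2 where R2: "\<And>z. z \<notin> poles f \<Longrightarrow> R2 < norm (f z) \<Longrightarrow> \<exists>a\<in>poles f. z \<in> ball a r"
    using near_pole_of_large_value[OF noasym hol fin cl r(1), of R] R by blast
  obtain N where N: "\<And>a. a \<in> bad \<Longrightarrow> norm a \<le> N"
    using finite_imp_bounded[OF fbad] unfolding bounded_iff by blast
  \<comment> \<open>Large enough for the constants \<open>8 * C\<close>, \<open>2 * C\<close> and
    \<open>64 * real m * C\<close> of the three chart estimates, for all
    \<open>m \<le> M\<close>.\<close>
  define K where "K = 64 * (real M + 1) * C"
  have K8: "64 * C \<le> K" unfolding K_def using C by simp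
  have K1: "1 \<le> K" "8 * C \<le> K" "2 * C \<le> K" using K8 C by linarith+
  define R1 where "R1 = Max {8, 2 * K, R2, N + 1, 8 * (C / r) ^ M}"
  have R1: "8 \<le> R1" "2 * K \<le> R1" "R2 \<le> R1" "N + 1 \<le> R1" "8 * (C / r) ^ M \<le> R1"
    by (simp_all add: R1_def)
  have goodR: "a \<in> Pstar" "1 \<le> norm a" if "a \<in> poles f" "R1 \<le> norm a" for a
  proof -
    have "a \<notin> bad" using N[of a] that R1 by auto
    then show "a \<in> Pstar" "1 \<le> norm a" using good that by auto
  qed
  have chart: "\<exists>\<psi>. pole_chart_at f a \<psi> (norm a powr (\<beta> / real (pole_mult f a))) C r (pole_mult f a)"
    if a: "a \<in> poles f" "R1 \<le> norm a" for a
  proof -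
    let ?m = "pole_mult f a"
    have g: "a \<in> Pstar" "1 \<le> norm a" using goodR[OF a] by auto
    have m: "1 \<le> ?m" using mult[OF g(1)] by simp
    have A: "0 < norm a powr (- \<beta>)" using g by auto
    have s: "(norm a powr (- \<beta>)) powr (- 1 / real ?m) = norm a powr (\<beta> / real ?m)"
      by (simp add: powr_powr)
    from pole_chart[OF holomorphic_on_subset[OF hol ballP[OF a(1)]] D C A m lo[OF g(1) a(1) g(2)] up[OF g(1) a(1) g(2)] r(1,3)]
    obtain \<psi> where p: "\<forall>z\<in>ball a r - {a}. f z * (of_real (norm a powr (\<beta> / real ?m)) * \<psi> z) ^ ?m = 1" "\<psi> a = 0"
      "\<forall>z\<in>ball a r. \<forall>z'\<in>ball a r. norm (z - z') \<le> 2 * C * norm (\<psi> z - \<psi> z') \<and>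
       norm (\<psi> z - \<psi> z') \<le> 2 * C * norm (z - z')" "ball 0 (r / C) \<subseteq> \<psi> ` ball a r"
      unfolding s by blast
    have "1 \<le> norm a powr (\<beta> / real ?m)" using g beta by (intro ge_one_powr_ge_zero) auto
    then have "pole_chart_at f a \<psi> (norm a powr (\<beta> / real ?m)) C r ?m"
      using m C r(1,2) p by unfold_locales auto
    then show ?thesis by blast
  qed
  have inv: "1 / norm a powr (\<beta> / real (pole_mult f a)) = norm a powr (- \<beta> / real (pole_mult f a))" for a
    by (simp add: powr_minus_divide)
  have "pole_system f \<beta> M r R1 K"
  proof
    show "0 \<le> \<beta>" "0 < r" "r \<le> 1 / 4" "1 \<le> K" "8 \<le> R1" "2 * K \<le> R1" by fact+
    show "f holomorphic_on - poles f" "\<And>B. finite (poles f \<inter> cball 0 B)" by fact+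
    show "countable {z \<in> - poles f. deriv f z = 0}" by (rule countable_critical_points[OF tr cl ct])
    show "8 * r \<le> dist a b" if "a \<in> poles f" "b \<in> poles f" "a \<noteq> b" for a b
      using sepD[OF that] r(4) by linarith
    show "\<exists>a\<in>poles f. z \<in> ball a r" if "z \<notin> poles f" "R1 < norm (f z)" for z
      using R2[OF that(1)] that(2) R1(3) by simp
    show "1 \<le> pole_mult f a \<and> pole_mult f a \<le> M" if "a \<in> poles f" "R1 \<le> norm a" for a
      using mult goodR[OF that] by blast
    show "\<exists>g. inverse_branches f (pole_mult f a) a b r
        (K * norm a powr (- \<beta> / real (pole_mult f a)) * norm b powr (- 1 - 1 / real (pole_mult f a))) g"
      if a: "a \<in> poles f" "R1 \<le> norm a" and b: "R1 \<le> norm b" for a b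
    proof -
      let ?m = "pole_mult f a"
      let ?k = "8 * C / norm a powr (\<beta> / real ?m) * norm b powr (- 1 - 1 / real ?m)"
      let ?k' = "K * norm a powr (- \<beta> / real ?m) * norm b powr (- 1 - 1 / real ?m)"
      obtain \<psi> where "pole_chart_at f a \<psi> (norm a powr (\<beta> / real ?m)) C r ?m" using chart[OF a] by blast
      then interpret pole_chart_at f a \<psi> "norm a powr (\<beta> / real ?m)" C r ?m .
      have kk: "?k \<le> ?k'"
      proof -
        have "8 * C / norm a powr (\<beta> / real ?m) = 8 * C * norm a powr (- \<beta> / real ?m)"
          using inv[of a] by (simp add: divide_inverse)
        also have "\<dots> \<le> K * norm a powr (- \<beta> / real ?m)" using K1(2) by (rule mult_right_mono) simp
        finally show ?thesis by (rule mult_right_mono) simp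
      qed
      have "?m \<le> M" "8 * (C / r) ^ M \<le> norm b" using mult[OF goodR(1)[OF a]] b R1(5) by auto
      then show ?thesis using branches[of M b] inverse_branches_mono[OF _ kk] by blast
    qed
    show "norm (z - a) \<le> K * norm a powr (- \<beta> / real (pole_mult f a))"
      if a: "a \<in> poles f" "R1 \<le> norm a" and z: "z \<in> ball a r - {a}" "R1 \<le> norm (f z)" for a z
    proof -
      let ?m = "pole_mult f a"
      obtain \<psi> where "pole_chart_at f a \<psi> (norm a powr (\<beta> / real ?m)) C r ?m" using chart[OF a] by blast
      then interpret pole_chart_at f a \<psi> "norm a powr (\<beta> / real ?m)" C r ?m .
      have "norm (z - a) \<le> 2 * C / norm a powr (\<beta> / real ?m)"
        using z R1(1) by (intro dist_pole_le) auto
      also have "\<dots> = 2 * C * norm a powr (- \<beta> / real ?m)" using inv[of a] by (simp add: divide_inverse)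
      also have "\<dots> \<le> K * norm a powr (- \<beta> / real ?m)" using K1(3) by (rule mult_right_mono) simp
      finally show ?thesis .
    qed
    show "norm (f z - f z') \<le> K * norm a powr (\<beta> / real (pole_mult f a)) * W powr (1 + 1 / real (pole_mult f a)) * norm (z - z')"
      if a: "a \<in> poles f" "R1 \<le> norm a" and z: "z \<in> ball a r - {a}" "z' \<in> ball a r - {a}" and W: "0 < W"
        "W / 2 \<le> norm (f z)" "norm (f z) \<le> 4 * W" "W / 2 \<le> norm (f z')" "norm (f z') \<le> 4 * W" for a z z' W
    proof -
      let ?m = "pole_mult f a"
      obtain \<psi> where "pole_chart_at f a \<psi> (norm a powr (\<beta> / real ?m)) C r ?m" using chart[OF a] by blast
      then interpret pole_chart_at f a \<psi> "norm a powr (\<beta> / real ?m)" C r ?m .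
      have "64 * real ?m * C \<le> K"
        unfolding K_def using mult[OF goodR(1)[OF a]] C by (intro mult_right_mono) auto
      then have "64 * real ?m * C * norm a powr (\<beta> / real ?m) * W powr (1 + 1 / real ?m) * norm (z - z')
          \<le> K * norm a powr (\<beta> / real ?m) * W powr (1 + 1 / real ?m) * norm (z - z')"
        by (intro mult_right_mono) auto
      then show ?thesis using expand[OF z W] by linarith
    qed
  qed
  then show ?thesis using goodR by blast
qed

section \<open>Limits in \<open>R\<close> and the two dimension bounds\<close>

text \<open>\<open>Lim\<close> denotes a limit only if one exists; for the dimensions in
  \<open>escaping_dim\<close> and \<open>eventual_hyp_dim\<close>, existence follows from their
  monotonicity in \<open>R\<close>.\<close>

lemma tendsto_antimono_at_top:
  fixes h :: "real \<Rightarrow> real"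
  assumes anti: "\<And>x y. x \<le> y \<Longrightarrow> h y \<le> h x" and pos: "\<And>x. 0 \<le> h x"
  shows "\<exists>l. (h \<longlongrightarrow> l) at_top"
proof (intro exI decreasing_tendsto)
  have bdd: "bdd_below (range h)" using pos by (intro bdd_belowI[of _ 0]) auto
  show "\<forall>\<^sub>F x in at_top. Inf (range h) \<le> h x" using bdd by (intro always_eventually allI cInf_lower) auto
  fix u assume "Inf (range h) < u"
  then obtain x where x: "h x < u" using bdd by (auto simp: cInf_less_iff)
  show "\<forall>\<^sub>F y in at_top. h y < u"
    using eventually_ge_at_top[of x]
  proof eventually_elim
    case (elim y)
    then show ?case using anti[of x y] x by linarith
  qed
qed

text \<open>If all annuli beyond \<open>B\<close> had fewer points, the dyadic bound would make the
  series converge for an exponent strictly between \<open>\<tau>\<close> and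
  \<open>\<rho>\<close>.\<close>

lemma large_good_annuli:
  fixes P :: "complex set"
  assumes fin: "\<And>B. finite (P \<inter> cball 0 B)" and tau: "0 \<le> \<tau>" "\<tau> < \<rho>"
    and div: "\<And>t. t < \<rho> \<Longrightarrow> \<not> (\<lambda>a. norm a powr (- t)) summable_on P"
  shows "\<exists>W\<ge>B. Q * W powr \<tau> \<le> real (card {a\<in>P. W \<le> norm a \<and> norm a < 2 * W})"
proof (rule ccontr)
  assume neg: "\<not> ?thesis"
  define t' where "t' = (\<tau> + \<rho>) / 2"
  have t': "\<tau> < t'" "t' < \<rho>" "0 \<le> t'" using tau by (auto simp: t'_def)
  define W where "W = max 1 B"
  have finA: "finite {a\<in>P. V \<le> norm a \<and> norm a < 2 * V}" for V
    by (rule finite_subset[OF _ fin[of "2 * V"]]) auto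
  have "(\<Sum>a\<in>F. norm a powr (- t')) \<le> max Q 0 * W powr (\<tau> - t') / (1 - 2 powr (\<tau> - t'))"
    if F: "finite F" "F \<subseteq> {a\<in>P. W \<le> norm a}" for F
  proof (rule sum_powr_dyadic_bound[OF _ t'(1,3) _ _ finA F])
    fix V assume V: "W \<le> V"
    then have "B \<le> V" by (simp add: W_def)
    then have "real (card {a\<in>P. V \<le> norm a \<and> norm a < 2 * V}) < Q * V powr \<tau>"
      using neg not_le by blast
    also have "\<dots> \<le> max Q 0 * V powr \<tau>" by (intro mult_right_mono) auto
    finally show "real (card {a\<in>P. V \<le> norm a \<and> norm a < 2 * V}) \<le> max Q 0 * V powr \<tau>" by simp
  qed (auto simp: W_def)
  then have "(\<lambda>a. norm a powr (- t')) summable_on {a\<in>P. W \<le> norm a}"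
    by (intro nonneg_bdd_above_summable_on bdd_aboveI) auto
  moreover have "(\<lambda>a. norm a powr (- t')) summable_on {a\<in>P. norm a < W}"
    by (rule summable_on_finite, rule finite_subset[OF _ fin[of W]]) auto
  ultimately have "(\<lambda>a. norm a powr (- t')) summable_on {a\<in>P. W \<le> norm a} \<union> {a\<in>P. norm a < W}"
    by (rule summable_on_Un_disjoint) auto
  also have "{a\<in>P. W \<le> norm a} \<union> {a\<in>P. norm a < W} = P" by auto
  finally show False using div[OF t'(2)] by blast
qed

context pole_system
begin

text \<open>The condition on \<open>s\<close> says exactly that
  \<open>t' = s * (1 + 1 / M + \<beta> / M)\<close> exceeds \<open>\<rho>\<close>. With
  \<open>t\<close> between \<open>\<rho>\<close> and \<open>t'\<close>, the annulus count makes the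
  sum over poles beyond \<open>R - 1\<close> at most a multiple of
  \<open>(R - 1) powr (t - t')\<close>, which tends to 0. The threshold does not depend on
  \<open>c\<close>, so it also serves the shifted sequences.\<close>

lemma eventually_null_large_orbits:
  assumes Pstar: "\<And>a. a \<in> poles f \<Longrightarrow> R1 \<le> norm a \<Longrightarrow> a \<in> Pstar"
    and Pm: "Pstar \<subseteq> poles f" "\<And>a. a \<in> Pstar \<Longrightarrow> 1 \<le> pole_mult f a"
    and order: "mero_order f = ereal \<rho>" and rho: "0 < \<rho>"
    and s: "\<rho> * real M / (\<beta> + real M + 1) < s"
  shows "\<exists>R0. \<forall>R\<ge>R0. \<forall>c. small_seq c \<longrightarrow> hausdorff_content s (large_orbits f R c) = 0"
proof (cases "M = 0")
  case True
  have "large_orbits f R c = {}" if R: "R1 + 2 \<le> R" and c: "small_seq c" for R c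
  proof (rule ccontr)
    assume "large_orbits f R c \<noteq> {}"
    then obtain z where "z \<in> large_orbits f R c" by blast
    then obtain a where "a \<in> poles f" "R - 1 < norm a" using large_orbits_near_pole[OF c R] by blast
    then have "1 \<le> pole_mult f a \<and> pole_mult f a \<le> M" using mult R by auto
    then show False using True by linarith
  qed
  then show ?thesis using hausdorff_content_countable_zero by (metis countable_empty)
next
  case False
  then have M: "1 \<le> M" by simp
  have "0 \<le> \<rho> * real M / (\<beta> + real M + 1)" using rho beta by simp
  then have s0: "0 < s" using s by linarith
  define t' where "t' = s * (1 + 1 / real M + \<beta> / real M)"
  have t': "\<rho> < t'"
  proof -
    have "0 < \<beta> + real M + 1" using beta by linarith
    then have "\<rho> * real M < s * (\<beta> + real M + 1)" using s by (simp add: divide_less_eq)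
    then have "\<rho> < s * (\<beta> + real M + 1) / real M" using M by (simp add: less_divide_eq)
    also have "\<dots> = t'" using M by (simp add: t'_def field_simps)
    finally show ?thesis .
  qed
  define t where "t = (\<rho> + t') / 2"
  have t: "\<rho> < t" "t < t'" "0 \<le> t'" using t' rho by (auto simp: t_def)
  define Q where "Q = (2 * exp 1) powr t"
  obtain W where W: "1 \<le> W" "\<And>V. W \<le> V \<Longrightarrow> real (card {a\<in>Pstar. V \<le> norm a \<and> norm a < 2 * V}) \<le> Q * V powr t"
    using card_poles_annulus_le_powr[OF finite_poles Pm order t(1)] unfolding Q_def by blast
  define E where "E = 1 / (2 * real M * (4 * K) powr s)"
  have E: "0 < E" using M K by (simp add: E_def)
  have "((\<lambda>V. Q * V powr (t - t') / (1 - 2 powr (t - t'))) \<longlongrightarrow> Q * 0 / (1 - 2 powr (t - t'))) at_top"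
  proof -
    have "1 - 2 powr (t - t') \<noteq> 0" using powr_less_one[of 2 "t - t'"] t by simp
    then show ?thesis using t by (intro tendsto_intros tendsto_neg_powr filterlim_ident) auto
  qed
  then have "eventually (\<lambda>V. Q * V powr (t - t') / (1 - 2 powr (t - t')) < E) at_top"
    using E by (intro order_tendstoD(2)) auto
  then obtain V0 where V0: "\<And>V. V0 \<le> V \<Longrightarrow> Q * V powr (t - t') / (1 - 2 powr (t - t')) < E"
    unfolding eventually_at_top_linorder by blast
  show ?thesis
  proof (intro exI[of _ "max (R1 + 2) (max W V0 + 1)"] allI impI)
    fix R c assume R: "max (R1 + 2) (max W V0 + 1) \<le> R" and c: "small_seq c"
    have RR: "R1 + 2 \<le> R" "W \<le> R - 1" "V0 \<le> R - 1" using R by linarith+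
    show "hausdorff_content s (large_orbits f R c) = 0"
    proof (rule null_large_orbits[OF s0 M _ _ c])
      show "R1 + 2 \<le> R" by (rule RR)
      fix F assume F: "finite F" "F \<subseteq> {b\<in>poles f. R - 1 \<le> norm b}"
      have FP: "F \<subseteq> {a\<in>Pstar. R - 1 \<le> norm a}" using F(2) Pstar RR(1) by force
      have "(\<Sum>b\<in>F. norm b powr (- t')) \<le> Q * (R - 1) powr (t - t') / (1 - 2 powr (t - t'))"
      proof (rule sum_powr_dyadic_bound[OF _ t(2,3) _ _ _ F(1) FP])
        show "0 \<le> Q" by (simp add: Q_def)
        show "0 < R - 1" using RR(2) W(1) by linarith
        fix V assume V: "R - 1 \<le> V"
        then show "real (card {a\<in>Pstar. V \<le> norm a \<and> norm a < 2 * V}) \<le> Q * V powr t"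
          using RR(2) by (intro W(2)) linarith
        show "finite {a\<in>Pstar. V \<le> norm a \<and> norm a < 2 * V}"
          using Pm(1) by (intro finite_subset[OF _ finite_poles[of "2 * V"]]) auto
      qed
      also have "\<dots> \<le> E" using V0[OF RR(3)] by simp
      finally show "(\<Sum>b\<in>F. norm b powr (- s * (1 + 1 / real M + \<beta> / real M))) \<le> 1 / (2 * real M * (4 * K) powr s)"
        by (simp add: t'_def E_def)
    qed
  qed
qed

text \<open>For \<open>t\<close> below the bound, the exponent
  \<open>t * (\<beta> / k + 1 + 1 / k)\<close> required of the alphabets is below
  \<open>\<rho>\<close>, so the divergence in \<open>Mstar_prop\<close> provides annuli rich enough
  in poles of multiplicity \<open>k\<close>.\<close>

lemma hausdorff_dim_escaping_ge:
  assumes c: "small_seq c" and k: "Mstar_prop f \<rho> N k"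
  shows "\<rho> * real k / (\<beta> + real k + 1) \<le> hausdorff_dim (escaping_julia f c)"
proof (rule hausdorff_dim_ge)
  fix t :: real assume t: "0 < t" "t < \<rho> * real k / (\<beta> + real k + 1)"
  have k1: "1 \<le> k" using k by (simp add: Mstar_prop_def)
  have "0 < \<beta> + real k + 1" using beta by linarith
  then have "t * (\<beta> + real k + 1) < \<rho> * real k" using t(2) by (simp add: less_divide_eq)
  then have "t * (\<beta> + real k + 1) / real k < \<rho>" using k1 by (simp add: divide_less_eq)
  moreover have "t * (\<beta> / real k + (1 + 1 / real k)) = t * (\<beta> + real k + 1) / real k"
    using k1 by (simp add: field_simps)
  ultimately have tau: "t * (\<beta> / real k + (1 + 1 / real k)) < \<rho>" by simp
  show "hausdorff_content t (escaping_julia f c) \<noteq> 0"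
  proof (rule escaping_content_nonzero[OF c t(1) k1])
    fix Q B
    let ?P = "{a\<in>poles f. pole_mult f a = k}"
    have "\<exists>W\<ge>B. Q * W powr (t * (\<beta> / real k + (1 + 1 / real k))) \<le> real (card {a\<in>?P. W \<le> norm a \<and> norm a < 2 * W})"
    proof (rule large_good_annuli[OF _ _ tau])
      show "finite (?P \<inter> cball 0 B)" for B by (rule finite_subset[OF _ finite_poles[of B]]) auto
      show "0 \<le> t * (\<beta> / real k + (1 + 1 / real k))" using t beta by simp
      show "\<not> (\<lambda>a. norm a powr (- t)) summable_on ?P" if "t < \<rho>" for t
        using k that by (simp add: Mstar_prop_def)
    qed
    also have "(\<lambda>W. {a\<in>?P. W \<le> norm a \<and> norm a < 2 * W}) =
        (\<lambda>W. {a\<in>poles f. pole_mult f a = k \<and> W \<le> norm a \<and> norm a < 2 * W})" by auto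
    finally show "\<exists>W\<ge>B. Q * W powr (t * (\<beta> / real k + (1 + 1 / real k)))
      \<le> real (card {a\<in>poles f. pole_mult f a = k \<and> W \<le> norm a \<and> norm a < 2 * W})" .
  qed
qed

end

theorem theorem2p7:
  fixes f0 :: "complex \<Rightarrow> complex" and \<rho> :: real
    and Pstar :: "complex set" and Rstar Rdag :: real and M :: nat and \<beta> :: real
  assumes transc: "transcendental_mero f0"
    and order: "mero_order f0 = ereal \<rho>" and rho_pos: "0 < \<rho>"
    and cond1: "\<not> infinity_asymptotic_value f0"
    and cond2: "0 < Rstar" "Pstar \<subseteq> poles f0" "finite (poles f0 - Pstar)"
      "\<forall>a\<in>Pstar. \<forall>w\<in>sing_values f0. Rstar < dist w a"
    and cond3: "0 < Rdag"
      "\<forall>a1\<in>poles f0. \<forall>a2\<in>poles f0. a1 \<noteq> a2 \<longrightarrow> ball a1 Rdag \<inter> ball a2 Rdag = {}"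
    and cond4: "0 \<le> \<beta>" "\<exists>C\<ge>1. \<forall>a\<in>Pstar. 1 \<le> pole_mult f0 a \<and> pole_mult f0 a \<le> M \<and>
       (\<forall>z\<in>ball a Rdag - {a}.
          (let A = (if \<beta> = 0 then 1 else norm a powr (-\<beta>)); m = pole_mult f0 a in
            A / norm (z - a) ^ m / C \<le> norm (f0 z) \<and>
            norm (f0 z) \<le> C * (A / norm (z - a) ^ m) \<and>
            real m * A / norm (z - a) ^ (m + 1) / C \<le> norm (deriv f0 z) \<and>
            norm (deriv f0 z) \<le> C * (real m * A / norm (z - a) ^ (m + 1))))"
  shows "\<exists>\<epsilon>>0. \<forall>c :: nat \<Rightarrow> complex. (\<forall>n\<ge>1. norm (c n) < \<epsilon>) \<longrightarrow>
           (\<forall>Ms. is_Mstar f0 \<rho> M Ms \<longrightarrow>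
              \<rho> * Ms / (\<beta> + Ms + 1) \<le> hausdorff_dim (escaping_julia f0 c) \<and>
              \<rho> * Ms / (\<beta> + Ms + 1) \<le> eventual_hyp_dim f0 c) \<and>
           hausdorff_dim (escaping_julia f0 c) \<le> escaping_dim f0 c \<and>
           escaping_dim f0 c \<le> \<rho> * M / (\<beta> + M + 1) \<and>
           eventual_hyp_dim f0 c \<le> escaping_dim f0 c"
proof -
  obtain C where C: "1 \<le> C" and mult_Pstar: "\<And>a. a \<in> Pstar \<Longrightarrow> 1 \<le> pole_mult f0 a \<and> pole_mult f0 a \<le> M"
    and est: "\<And>a z. a \<in> Pstar \<Longrightarrow> z \<in> ball a Rdag - {a} \<Longrightarrow>
      (if \<beta> = 0 then 1 else norm a powr (-\<beta>)) / norm (z - a) ^ pole_mult f0 a / C \<le> norm (f0 z) \<and>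
      norm (f0 z) \<le> C * ((if \<beta> = 0 then 1 else norm a powr (-\<beta>)) / norm (z - a) ^ pole_mult f0 a)"
    using cond4(2) unfolding Let_def by blast
  \<comment> \<open>The case distinction differs from \<open>powr\<close> only for a pole at 0 with
    \<open>\<beta> = 0\<close>, because \<open>0 powr 0 = 0\<close>.\<close>
  have A: "(if \<beta> = 0 then 1 else norm a powr (-\<beta>)) = norm a powr (-\<beta>)" if "1 \<le> norm a" for a :: complex
    using that by auto
  have sep: "Rdag \<le> dist a b" if ab: "a \<in> poles f0" "b \<in> poles f0" "a \<noteq> b" for a b
  proof (rule ccontr)
    assume "\<not> Rdag \<le> dist a b"
    then have "b \<in> ball a Rdag \<inter> ball b Rdag" using cond3(1) by simp
    then show False using cond3(2) ab by blast
  qed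
  have "\<exists>r R1 K. pole_system f0 \<beta> M r R1 K \<and> (\<forall>a\<in>poles f0. R1 \<le> norm a \<longrightarrow> a \<in> Pstar)"
  proof (rule pole_system_exists[OF transc cond1 cond2(3) cond3(1) sep cond4(1) C mult_Pstar])
    fix a z assume a: "a \<in> Pstar" "1 \<le> norm a" and z: "z \<in> ball a Rdag - {a}"
    show "norm a powr (- \<beta>) / norm (z - a) ^ pole_mult f0 a / C \<le> norm (f0 z)"
      "norm (f0 z) \<le> C * (norm a powr (- \<beta>) / norm (z - a) ^ pole_mult f0 a)"
      using est[OF a(1) z] unfolding A[OF a(2)] by blast+
  qed
  then obtain r R1 K where ps: "pole_system f0 \<beta> M r R1 K"
    and big: "\<And>a. a \<in> poles f0 \<Longrightarrow> R1 \<le> norm a \<Longrightarrow> a \<in> Pstar"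
    by blast
  interpret pole_system f0 \<beta> M r R1 K by (rule ps)
  let ?s = "\<rho> * M / (\<beta> + M + 1)"
  have s0: "0 \<le> ?s" using rho_pos beta by simp
  have main: "(\<forall>Ms. is_Mstar f0 \<rho> M Ms \<longrightarrow>
              \<rho> * Ms / (\<beta> + Ms + 1) \<le> hausdorff_dim (escaping_julia f0 c) \<and>
              \<rho> * Ms / (\<beta> + Ms + 1) \<le> eventual_hyp_dim f0 c) \<and>
           hausdorff_dim (escaping_julia f0 c) \<le> escaping_dim f0 c \<and>
           escaping_dim f0 c \<le> ?s \<and> eventual_hyp_dim f0 c \<le> escaping_dim f0 c"
    if "\<forall>n\<ge>1. norm (c n) < 1" for c
  proof -
    have c: "small_seq c" using that by (simp add: small_seq_def)
    define E where "E R = {z \<in> julia_set f0 c. \<forall>n\<ge>1. orbit_defined f0 c n z \<and> R < norm (Fcomp f0 c n z)}" for R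
    define H where "H R = {z \<in> radial_julia f0 c. \<forall>n\<ge>1. R < norm (Fcomp f0 c n z)}" for R
    have Emono: "E R' \<subseteq> E R" and Hmono: "H R' \<subseteq> H R" if "R \<le> R'" for R R'
      using that by (auto simp: E_def H_def intro: le_less_trans)
    have HE: "H R \<subseteq> E R" for R by (auto simp: H_def E_def radial_julia_def)
    have XH: "large_orbits f0 R c \<subseteq> H R" if "R1 + 2 \<le> R" for R
      using large_orbits_subset_radial[OF c that] by (auto simp: H_def large_orbits_def)
    obtain e where e: "((\<lambda>R. hausdorff_dim (E R)) \<longlongrightarrow> e) at_top"
      using tendsto_antimono_at_top[of "\<lambda>R. hausdorff_dim (E R)", OF hausdorff_dim_mono[OF Emono] hausdorff_dim_nonneg]
      by blast
    obtain h where h: "((\<lambda>R. hausdorff_dim (H R)) \<longlongrightarrow> h) at_top"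
      using tendsto_antimono_at_top[of "\<lambda>R. hausdorff_dim (H R)", OF hausdorff_dim_mono[OF Hmono] hausdorff_dim_nonneg]
      by blast
    have e_eq: "escaping_dim f0 c = e"
      unfolding escaping_dim_def E_def[symmetric] using e by (intro tendsto_Lim) auto
    have h_eq: "eventual_hyp_dim f0 c = h"
      unfolding eventual_hyp_dim_def H_def[symmetric] using h by (intro tendsto_Lim) auto
    have he: "h \<le> e"
      by (rule tendsto_le[OF _ e h]) (auto intro!: always_eventually hausdorff_dim_mono HE)
    \<comment> \<open>The bound holds for each large \<open>R\<close> and therefore survives in the
      limit; it also transfers the lower bound to \<open>eventual_hyp_dim\<close>.\<close>
    have "eventually (\<lambda>R. hausdorff_dim (escaping_julia f0 c) \<le> hausdorff_dim (H R)) at_top"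
      using eventually_ge_at_top[of "R1 + 2"]
    proof eventually_elim
      case (elim R)
      then show ?case
        using hausdorff_dim_escaping_le[OF c elim] hausdorff_dim_mono[OF XH[OF elim]] by linarith
    qed
    then have ih: "hausdorff_dim (escaping_julia f0 c) \<le> h"
      by (intro tendsto_lowerbound[OF h]) auto
    have "e \<le> s" if s: "?s < s" for s
    proof -
      have "\<exists>R0. \<forall>R\<ge>R0. \<forall>c. small_seq c \<longrightarrow> hausdorff_content s (large_orbits f0 R c) = 0"
        by (rule eventually_null_large_orbits[OF _ cond2(2) _ order rho_pos s]) (use big mult_Pstar in blast)+
      then obtain R0 where R0: "\<And>R c. R0 \<le> R \<Longrightarrow> small_seq c \<Longrightarrow> hausdorff_content s (large_orbits f0 R c) = 0"
        by blast
      have s_pos: "0 < s" using s s0 by linarith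
      have "hausdorff_dim (E R) \<le> s" if R: "R0 \<le> R" for R
      proof -
        \<comment> \<open>The set \<open>E R\<close> restricts the orbit only from time 1 on, so it
          is a one-step preimage of large orbits of the shifted sequence, and nullity is pulled back
          once more.\<close>
        have "E R \<subseteq> {z. z \<notin> poles f0 \<and> f0 z + c 1 \<in> large_orbits f0 R (shift_seq c)}"
        proof
          fix z assume z: "z \<in> E R"
          have od: "Fcomp f0 c n z \<notin> poles f0" for n
          proof -
            have "orbit_defined f0 c (Suc n) z" using z by (simp add: E_def)
            then show ?thesis by (simp add: orbit_defined_def)
          qed
          have "R < norm (Fcomp f0 c (Suc n) z)" for n using z by (simp add: E_def)
          then have "f0 z + c 1 \<in> large_orbits f0 R (shift_seq c)"
            using od unfolding large_orbits_def mem_Collect_eq Fcomp_Suc_shift[symmetric] by blast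
          then show "z \<in> {z. z \<notin> poles f0 \<and> f0 z + c 1 \<in> large_orbits f0 R (shift_seq c)}"
            using od[of 0] by simp
        qed
        then have "hausdorff_content s (E R) = 0"
          using null_step_preimage[OF s_pos R0[OF R small_seq_shift[OF c]], of "c 1"]
          by (rule hausdorff_content_zero_subset[rotated])
        then show ?thesis
          using hausdorff_dim_le_of_content_zero[OF s_pos] by blast
      qed
      then have "eventually (\<lambda>R. hausdorff_dim (E R) \<le> s) at_top"
        unfolding eventually_at_top_linorder by blast
      then show ?thesis by (intro tendsto_upperbound[OF e]) auto
    qed
    then have es: "e \<le> ?s" by (rule dense_ge)
    show ?thesis
      unfolding e_eq h_eq
      using he ih es hausdorff_dim_escaping_ge[OF c, of \<rho> M] by (auto simp: is_Mstar_def intro: order_trans)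
  qed
  \<comment> \<open>The value 1 is the bound built into \<open>small_seq\<close>.\<close>
  show ?thesis by (intro exI[of _ 1]) (use main in simp)
qed

end
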